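(* Let $\gamma>1$, $\rho_0>0$, $A_0>0$, $U_{02}<0$, $U_{03}\in\mathbb R$, and set $q_0^2=U_{02}^2+U_{03}^2$, $c_0=\sqrt{A_0\gamma\rho_0^{\gamma-1}}$, $a_1^2=U_{02}^2/c_0^2$. Suppose that $a_1^2>1$ and that for all $t\in(0,1)$ $$(\gamma-1)q_0^4t^2+\big(2c_0^2U_{02}^2-(3\gamma-1)U_{03}^2q_0^2\big)t+2\gamma U_{03}^4>0.$$ Then there exists a nonempty set $D\subset(0,\frac\pi2)$ such that for any $\theta_*\in D$, Problem II (defined in the context) has at least one conic shock solution $(\rho^\pm,U_1^\pm,U_2^\pm,U_3^\pm,A^\pm)(\theta)$ defined on $I^-=[\theta_b,\frac\pi2]$ and $I^+=(\theta_*,\theta_b]$ respectively, with the shock located at some $\theta=\theta_b\in(\theta_*,\frac\pi2)$. Moreover, $U_3^+(\theta_* )=0$ and the state just behind the shock can be classified as follows: 1. If $a_\sharp^2\ge a_1^2$, the state just behind the shock $\theta=\theta_b$ is always supersonic. 2. If $a_\sharp^2<a_1^2$, there exists a unique $\theta_\sharp\in(\underline\theta,\frac\pi2)$ (given by the equation in the context) such that: if $\theta_b\in(\underline\theta,\theta_\sharp)$, the state just behind the shock is supersonic; if $\theta_b=\theta_\sharp$, the state just behind the shock is sonic (the shock surface and the sonic surface coincide); if $\theta_b\in(\theta_\sharp,\frac\pi2)$, the state just behind the shock is subsonic. The quantities $a_\sharp^2,\underline\theta,\theta_\sharp$ depend only on $\rho_0,U_{02},U_{03},A_0,\gamma$.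
   Context: Problem II (supersonic self-similar flow past an infinite circular cone with surface $\theta=\theta_*$): find $\theta_b\in(\theta_*,\frac\pi2)$ and smooth functions $(\rho^-,U_1^-,U_2^-,U_3^-,A^-)$ on $(\theta_b,\frac\pi2]$ (upstream) and $(\rho^+,U_1^+,U_2^+,U_3^+,A^+)$ on $(\theta_*,\theta_b)$ (downstream), extending smoothly up to $\theta_b$ from each side, each satisfying, with $p=A\rho^\gamma$, $$\begin{cases}(\rho U_2)'+2\rho U_1+\frac{1}{\tan\theta}\rho U_2=0,\\ U_2U_1'-(U_2^2+U_3^2)=0,\\ U_2U_2'+\frac1\rho\frac{d}{d\theta}p+U_1U_2-\frac{U_3^2}{\tan\theta}=0,\\ U_2U_3'+U_1U_3+\frac{U_2U_3}{\tan\theta}=0,\\ U_2A'=0,\end{cases}$$ with the boundary conditions $(\rho,U_1,U_2,U_3,A)(\frac\pi2)=(\rho_0,0,U_{02},U_{03},A_0)$ and $U_2(\theta_* )=0$ (i.e. $U_2^+(\theta_* )=0$, as a limit), and such that at $\theta=\theta_b$, with $[f]=f^+(\theta_b)-f^-(\theta_b)$, the entropy condition $[p]>0$ and the Rankine–Hugoniot conditions $$[\rho U_2]=0,\quad [\rho U_1U_2]=0,\quad [\rho U_2^2+p]=0,\quad [\rho U_2U_3]=0,\quad [B]=0$$ hold, where $B=\frac12(U_1^2+U_2^2+U_3^2)+\frac{\gamma p}{(\gamma-1)\rho}$. The state just behind the shock is called supersonic, sonic or subsonic according to whether $(U_1^+)^2+(U_2^+)^2+(U_3^+)^2-\gamma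 A^+(\rho^+)^{\gamma-1}$ at $\theta_b$ is positive, zero or negative. With $M_0=q_0/c_0$ (where $q_0=\sqrt{U_{02}^2+U_{03}^2}$), $$a_\sharp^2=\frac{1}{4\gamma}\Big((\gamma-3)+(\gamma+1)M_0^2+\sqrt{(\gamma-3+(\gamma+1)M_0^2)^2+16\gamma}\Big).$$ The angle $\underline\theta\in(0,\frac\pi2)$ is defined by $$\sin^2\underline\theta=\frac{2q_0^2U_{03}^2+c_0^2U_{02}^2+c_0|U_{02}|\sqrt{4q_0^2U_{03}^2+c_0^2U_{02}^2}}{2q_0^4}.$$ When $a_\sharp^2<a_1^2$, $\theta_\sharp\in(\underline\theta,\frac\pi2)$ is defined by $$\frac{(U_{02}^2-q_0^2\cos^2\theta_\sharp)^2}{c_0^2U_{02}^2\sin^2\theta_\sharp}=a_\sharp^2,$$ i.e. the square of the upstream polar Mach number at $\theta_\sharp$ equals $a_\sharp^2$. *)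

theory Defs
  imports "HOL-Analysis.Analysis"
begin

text \<open>
  Steady conical flow in spherical coordinates, as a function of the polar angle alone.
  The functions are total, but only their values on the interval under consideration
  (upstream or downstream of the shock) are ever used.
\<close>

record conic_flow =
  density :: "real \<Rightarrow> real"
  U1 :: "real \<Rightarrow> real"
  U2 :: "real \<Rightarrow> real"
  U3 :: "real \<Rightarrow> real"
  entropy :: "real \<Rightarrow> real"

definition pressure :: "real \<Rightarrow> conic_flow \<Rightarrow> real \<Rightarrow> real" where
  "pressure \<gamma> W \<theta> = entropy W \<theta> * density W \<theta> powr \<gamma>"

definition bernoulli :: "real \<Rightarrow> conic_flow \<Rightarrow> real \<Rightarrow> real" where
  "bernoulli \<gamma> W \<theta> =
     (1/2) * ((U1 W \<theta>)\<^sup>2 + (U2 W \<theta>)\<^sup>2 + (U3 W \<theta>)\<^sup>2)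
       + \<gamma> * pressure \<gamma> W \<theta> / ((\<gamma> - 1) * density W \<theta>)"

text \<open>
  Smoothness on an interval, with one-sided derivatives at the endpoints that belong to
  it: \<open>F n\<close> is the \<open>n\<close>-th derivative.
\<close>

definition smooth_fun_on :: "real set \<Rightarrow> (real \<Rightarrow> real) \<Rightarrow> bool" where
  "smooth_fun_on I f \<longleftrightarrow>
     (\<exists>F :: nat \<Rightarrow> real \<Rightarrow> real. F 0 = f \<and>
        (\<forall>n. \<forall>\<theta>\<in>I. (F n has_real_derivative F (Suc n) \<theta>) (at \<theta> within I)))"

definition smooth_flow_on :: "real set \<Rightarrow> conic_flow \<Rightarrow> bool" where
  "smooth_flow_on I W \<longleftrightarrow>
     smooth_fun_on I (density W) \<and> smooth_fun_on I (U1 W) \<and> smooth_fun_on I (U2 W) \<and>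
     smooth_fun_on I (U3 W) \<and> smooth_fun_on I (entropy W)"

definition deriv_on :: "real set \<Rightarrow> (real \<Rightarrow> real) \<Rightarrow> real \<Rightarrow> real" where
  "deriv_on I f \<theta> = vector_derivative f (at \<theta> within I)"

text \<open>
  The factor \<open>1 / tan \<theta>\<close> of the equations is written as \<open>cot \<theta>\<close>, so that it has its
  correct value \<open>0\<close> at \<open>\<theta> = pi / 2\<close>.
\<close>

definition conic_euler_on :: "real \<Rightarrow> real set \<Rightarrow> conic_flow \<Rightarrow> bool" where
  "conic_euler_on \<gamma> I W \<longleftrightarrow>
     (\<forall>\<theta>\<in>I.
        deriv_on I (\<lambda>s. density W s * U2 W s) \<theta> + 2 * density W \<theta> * U1 W \<theta>
          + cot \<theta> * density W \<theta> * U2 W \<theta> = 0 \<and>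
        U2 W \<theta> * deriv_on I (U1 W) \<theta> - ((U2 W \<theta>)\<^sup>2 + (U3 W \<theta>)\<^sup>2) = 0 \<and>
        U2 W \<theta> * deriv_on I (U2 W) \<theta> + 1 / density W \<theta> * deriv_on I (pressure \<gamma> W) \<theta>
          + U1 W \<theta> * U2 W \<theta> - (U3 W \<theta>)\<^sup>2 * cot \<theta> = 0 \<and>
        U2 W \<theta> * deriv_on I (U3 W) \<theta> + U1 W \<theta> * U3 W \<theta>
          + U2 W \<theta> * U3 W \<theta> * cot \<theta> = 0 \<and>
        U2 W \<theta> * deriv_on I (entropy W) \<theta> = 0)"

text \<open>A flow is a smooth solution with positive density, as the equations presuppose.\<close>

definition conic_flow_on :: "real \<Rightarrow> real set \<Rightarrow> conic_flow \<Rightarrow> bool" where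
  "conic_flow_on \<gamma> I W \<longleftrightarrow>
     smooth_flow_on I W \<and> (\<forall>\<theta>\<in>I. density W \<theta> > 0) \<and> conic_euler_on \<gamma> I W"

definition rankine_hugoniot ::
    "real \<Rightarrow> real \<Rightarrow> conic_flow \<Rightarrow> conic_flow \<Rightarrow> bool" where
  "rankine_hugoniot \<gamma> \<theta>b Wm Wp \<longleftrightarrow>
     (let jump = (\<lambda>f. f Wp \<theta>b - f Wm \<theta>b) in
        jump (\<lambda>W \<theta>. density W \<theta> * U2 W \<theta>) = (0 :: real) \<and>
        jump (\<lambda>W \<theta>. density W \<theta> * U1 W \<theta> * U2 W \<theta>) = 0 \<and>
        jump (\<lambda>W \<theta>. density W \<theta> * (U2 W \<theta>)\<^sup>2 + pressure \<gamma> W \<theta>) = 0 \<and>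
        jump (\<lambda>W \<theta>. density W \<theta> * U2 W \<theta> * U3 W \<theta>) = 0 \<and>
        jump (bernoulli \<gamma>) = 0)"

text \<open>
  Problem II for the cone of half-angle \<open>\<theta>w\<close> (the angle written with a lower star):
  \<open>Wm\<close> is the upstream flow, \<open>Wp\<close> the downstream flow, \<open>\<theta>b\<close> the shock angle. Both flows
  contain the shock angle in their domain, where their values are the one-sided limits.
\<close>

definition problem_II_solution ::
    "real \<Rightarrow> real \<Rightarrow> real \<Rightarrow> real \<Rightarrow> real \<Rightarrow> real \<Rightarrow> real \<Rightarrow> conic_flow \<Rightarrow> conic_flow \<Rightarrow> bool" where
  "problem_II_solution \<gamma> \<rho>0 A0 U02 U03 \<theta>w \<theta>b Wm Wp \<longleftrightarrow>
     \<theta>w < \<theta>b \<and> \<theta>b < pi / 2 \<and>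
     conic_flow_on \<gamma> {\<theta>b..pi / 2} Wm \<and>
     conic_flow_on \<gamma> {\<theta>w<..\<theta>b} Wp \<and>
     density Wm (pi / 2) = \<rho>0 \<and> U1 Wm (pi / 2) = 0 \<and> U2 Wm (pi / 2) = U02 \<and>
     U3 Wm (pi / 2) = U03 \<and> entropy Wm (pi / 2) = A0 \<and>
     (U2 Wp \<longlongrightarrow> 0) (at_right \<theta>w) \<and>
     pressure \<gamma> Wp \<theta>b - pressure \<gamma> Wm \<theta>b > 0 \<and>
     rankine_hugoniot \<gamma> \<theta>b Wm Wp"

definition sonic_excess :: "real \<Rightarrow> conic_flow \<Rightarrow> real \<Rightarrow> real" where
  "sonic_excess \<gamma> W \<theta> =
     (U1 W \<theta>)\<^sup>2 + (U2 W \<theta>)\<^sup>2 + (U3 W \<theta>)\<^sup>2 - \<gamma> * entropy W \<theta> * density W \<theta> powr (\<gamma> - 1)"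

definition supersonic_at :: "real \<Rightarrow> conic_flow \<Rightarrow> real \<Rightarrow> bool" where
  "supersonic_at \<gamma> W \<theta> \<longleftrightarrow> sonic_excess \<gamma> W \<theta> > 0"

definition sonic_at :: "real \<Rightarrow> conic_flow \<Rightarrow> real \<Rightarrow> bool" where
  "sonic_at \<gamma> W \<theta> \<longleftrightarrow> sonic_excess \<gamma> W \<theta> = 0"

definition subsonic_at :: "real \<Rightarrow> conic_flow \<Rightarrow> real \<Rightarrow> bool" where
  "subsonic_at \<gamma> W \<theta> \<longleftrightarrow> sonic_excess \<gamma> W \<theta> < 0"

definition a_sharp_sq :: "real \<Rightarrow> real \<Rightarrow> real" where
  "a_sharp_sq \<gamma> M0 =
     1 / (4 * \<gamma>) * ((\<gamma> - 3) + (\<gamma> + 1) * M0\<^sup>2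
       + sqrt ((\<gamma> - 3 + (\<gamma> + 1) * M0\<^sup>2)\<^sup>2 + 16 * \<gamma>))"

definition theta_lower :: "real \<Rightarrow> real \<Rightarrow> real \<Rightarrow> real \<Rightarrow> real" where
  "theta_lower q0 c0 U02 U03 =
     (THE \<theta>. 0 < \<theta> \<and> \<theta> < pi / 2 \<and>
        (sin \<theta>)\<^sup>2 =
          (2 * q0\<^sup>2 * U03\<^sup>2 + c0\<^sup>2 * U02\<^sup>2
             + c0 * \<bar>U02\<bar> * sqrt (4 * q0\<^sup>2 * U03\<^sup>2 + c0\<^sup>2 * U02\<^sup>2)) / (2 * q0 ^ 4))"

definition is_theta_sharp :: "real \<Rightarrow> real \<Rightarrow> real \<Rightarrow> real \<Rightarrow> real \<Rightarrow> real \<Rightarrow> bool" where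
  "is_theta_sharp \<gamma> q0 c0 U02 U03 \<theta> \<longleftrightarrow>
     theta_lower q0 c0 U02 U03 < \<theta> \<and> \<theta> < pi / 2 \<and>
     (U02\<^sup>2 - q0\<^sup>2 * (cos \<theta>)\<^sup>2)\<^sup>2 / (c0\<^sup>2 * U02\<^sup>2 * (sin \<theta>)\<^sup>2) = a_sharp_sq \<gamma> (q0 / c0)"

end

theory Submission
  imports Defs
begin

text \<open>
  Where the gas moves towards the axis, put \<open>w = - U2 > 0\<close>, \<open>Z = U3\<^sup>2 / w\<close>, \<open>r = density' / density\<close>,
  \<open>c\<^sup>2 = \<gamma> * entropy * density powr (\<gamma> - 1)\<close> and
  \<open>L = U1 - cot \<theta> * (w + Z)\<close>. The conical Euler equations become (\<open>transverse_flow_equations\<close>)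
  \<open>U1' = - (w + Z)\<close>, \<open>w' = 2 * U1 - w * cot \<theta> - w * r\<close>, \<open>Z' = Z * (r - cot \<theta>)\<close>,
  \<open>(w\<^sup>2 - c\<^sup>2) * r = w * L\<close>, and a short computation (\<open>compression_derivative\<close>) gives
  \<open>L' = - cot \<theta> * (2 * L - (w - Z) * r)\<close>. So \<open>L\<close> is the only source of compression, and it obeys a
  homogeneous linear equation. In addition the entropy, the Bernoulli function and the quotient
  \<open>(U3 * sin \<theta>)\<^sup>2 / (density * U2 * sin \<theta>)\<close> are constant. The proof consists of reading these relations
  on either side of the shock.

  Ahead of the shock, \<open>L = 0\<close> at \<open>\<theta> = pi / 2\<close>, because \<open>U1\<close> and \<open>cot\<close> vanish there. The relation
  \<open>(w\<^sup>2 - c\<^sup>2) * L' = - cot \<theta> * (2 * (w\<^sup>2 - c\<^sup>2) - (w - Z) * w) * L\<close> then forces \<open>L = 0\<close> as long as \<open>w \<noteq> c\<close>. At the ray with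
  \<open>w = c\<close> the coefficient on the left has a simple zero, and here smoothness decides: the density is
  constant on one side, hence flat at that ray, and a flat solution of an equation with a regular
  singular point vanishes (\<open>local_constancy\<close>). Therefore the density is constant, the equations integrate
  explicitly (\<open>constant_density_profile\<close>), and every upstream flow is the explicit one
  (\<open>upstream_rigidity\<close>). Its polar speed is proportional to
  \<open>q0\<^sup>2 * sin \<theta> - U03\<^sup>2 / sin \<theta>\<close>, which is strictly increasing.

  At the shock, the jump conditions and \<open>[p] > 0\<close> determine the state behind from the polar Mach number
  ahead; the sign of the sonic excess behind is the sign of \<open>a_sharp_sq\<close> minus the square of that Mach
  number (\<open>sonic_excess_behind_shock\<close>, \<open>sonic_classification\<close>). By monotonicity of the polar
  speed this is a statement about the shock angle, which is the classification. The limit of \<open>U3\<close> at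
  the cone follows from the third constant quotient, the density being bounded by Bernoulli's law
  (\<open>swirl_vanishes_at_cone\<close>). Both conclusions hold for every cone angle in \<open>(0, pi / 2)\<close> and every solution, so
  for \<open>D\<close> a single cone angle suffices.

  For existence, let the shock stand anywhere between \<open>theta_lower\<close> and \<open>pi / 2\<close>. The hypothesis on
  \<open>t\<close>, taken at \<open>t = (sin \<theta>b)\<^sup>2\<close>, says that \<open>U3\<^sup>2\<close> is less than the product of the polar speeds on the two
  sides, and this is equivalent to \<open>L > 0\<close> behind the shock (\<open>shock_solution_exists\<close>). Followed from the
  shock towards the axis, \<open>L * sin \<theta>\<close> does not decrease, whereas \<open>L \<le> U1\<close> is bounded by Bernoulli's law;
  hence \<open>w\<close> cannot stay positive up to the axis, and its first zero is the cone
  (\<open>compressive_branch_bounds\<close>, \<open>downstream_branch\<close>).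
\<close>

section \<open>Smoothness from generators closed under differentiation\<close>

text \<open>
  The profiles constructed below solve differential equations whose right-hand sides are polynomials in
  finitely many functions (the profiles, \<open>sin\<close>, \<open>cos\<close> and some reciprocals). If those functions have
  derivatives in the algebra they generate, the whole algebra is closed under differentiation, and all
  of its members are smooth.
\<close>

inductive alg_generated :: "(real \<Rightarrow> real) set \<Rightarrow> (real \<Rightarrow> real) \<Rightarrow> bool" for G where
  alg_gen: "f \<in> G \<Longrightarrow> alg_generated G f"
| alg_const: "alg_generated G (\<lambda>x. c)"
| alg_add: "alg_generated G f \<Longrightarrow> alg_generated G g \<Longrightarrow> alg_generated G (\<lambda>x. f x + g x)"
| alg_mult: "alg_generated G f \<Longrightarrow> alg_generated G g \<Longrightarrow> alg_generated G (\<lambda>x. f x * g x)"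

lemma alg_uminus: "alg_generated G f \<Longrightarrow> alg_generated G (\<lambda>x. - f x)"
  using alg_mult[OF alg_const[of G "-1"]] by fastforce

lemma alg_diff:
  "alg_generated G f \<Longrightarrow> alg_generated G g \<Longrightarrow> alg_generated G (\<lambda>x. f x - g x)"
  using alg_add[of G f "\<lambda>x. - g x"] alg_uminus by fastforce

lemma alg_power: "alg_generated G f \<Longrightarrow> alg_generated G (\<lambda>x. f x ^ n)"
  by (induction n) (auto intro: alg_const alg_mult)

lemmas alg_intros = alg_const alg_add alg_mult alg_uminus alg_diff alg_power

lemma smooth_if_generators_closed:
  assumes gen: "\<And>g. g \<in> G \<Longrightarrow>
      \<exists>g'. alg_generated G g' \<and> (\<forall>x\<in>I. (g has_real_derivative g' x) (at x within I))"
    and f: "alg_generated G f"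
  shows "smooth_fun_on I f"
proof -
  have "\<exists>g'. alg_generated G g' \<and> (\<forall>x\<in>I. (g has_real_derivative g' x) (at x within I))"
    if "alg_generated G g" for g
    using that
  proof induction
    case (alg_gen f)
    then show ?case by (rule gen)
  next
    case (alg_const c)
    show ?case
      by (intro exI[of _ "\<lambda>x. 0"] conjI ballI alg_intros) (auto intro!: derivative_eq_intros)
  next
    case (alg_add f g)
    then obtain f' g' where "alg_generated G f'" "alg_generated G g'"
      and "\<forall>x\<in>I. (f has_real_derivative f' x) (at x within I)"
        "\<forall>x\<in>I. (g has_real_derivative g' x) (at x within I)" by blast
    then show ?case
      by (intro exI[of _ "\<lambda>x. f' x + g' x"] conjI ballI alg_intros)
        (auto intro!: derivative_eq_intros)
  next
    case (alg_mult f g)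
    then obtain f' g' where "alg_generated G f'" "alg_generated G g'"
      and "\<forall>x\<in>I. (f has_real_derivative f' x) (at x within I)"
        "\<forall>x\<in>I. (g has_real_derivative g' x) (at x within I)" by blast
    with alg_mult show ?case
      by (intro exI[of _ "\<lambda>x. f' x * g x + g' x * f x"] conjI ballI alg_intros)
        (auto intro!: derivative_eq_intros)
  qed
  then obtain D where D: "\<And>g. alg_generated G g \<Longrightarrow> alg_generated G (D g)"
      "\<And>g x. alg_generated G g \<Longrightarrow> x \<in> I \<Longrightarrow> (g has_real_derivative D g x) (at x within I)"
    by metis
  define F where "F n = (D ^^ n) f" for n
  have "alg_generated G (F n)" for n
    unfolding F_def by (induction n) (auto intro: f D)
  then have "\<forall>n. \<forall>x\<in>I. (F n has_real_derivative F (Suc n) x) (at x within I)"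
    using D(2) by (auto simp: F_def)
  then show ?thesis
    unfolding smooth_fun_on_def by (intro exI[of _ F]) (auto simp: F_def)
qed

section \<open>Global existence for Lipschitz differential equations\<close>

lemma continuous_on_compact_abs_bound:
  fixes f :: "real \<Rightarrow> real"
  assumes "compact S" "continuous_on S f"
  shows "\<exists>K\<ge>0. \<forall>x\<in>S. \<bar>f x\<bar> \<le> K"
proof -
  have "bounded (f ` S)" by (intro compact_imp_bounded compact_continuous_image assms)
  then obtain K where "\<forall>x\<in>S. \<bar>f x\<bar> \<le> K" by (auto simp: bounded_iff)
  then show ?thesis by (intro exI[of _ "max 0 K"]) (auto simp: le_max_iff_disj)
qed

text \<open>
  Banach's fixed point theorem for the integral equation. The weight \<open>exp (2 * K * (b - s))\<close> makes the
  integral operator a contraction with factor \<open>1/2\<close> on the whole interval at once, so that nothing has to be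
  continued. The value is prescribed at the right endpoint because the flow is followed from the shock
  down to the cone.
\<close>

lemma picard_terminal_value:
  fixes f :: "real \<Rightarrow> 'a::euclidean_space \<Rightarrow> 'a"
  assumes ab: "a \<le> b" and K: "K > 0"
    and cont: "continuous_on ({a..b} \<times> UNIV) (\<lambda>(t, x). f t x)"
    and lip: "\<And>t x y. t \<in> {a..b} \<Longrightarrow> norm (f t x - f t y) \<le> K * norm (x - y)"
  obtains y where "y b = y0"
    and "\<And>t. t \<in> {a..b} \<Longrightarrow> (y has_vector_derivative f t (y t)) (at t within {a..b})"
proof -
  \<comment> \<open>Bounded continuous functions live on the whole line; times outside the interval are clamped.\<close>
  define cl where "cl t = max a (min b t)" for t
  have cl_in: "cl t \<in> {a..b}" for t using ab by (auto simp: cl_def)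
  have cl_id: "cl t = t" if "t \<in> {a..b}" for t using that by (auto simp: cl_def)
  have cl_cont: "continuous_on UNIV cl" unfolding cl_def by (intro continuous_intros)
  define h where "h z s = f s (exp (2 * K * (b - s)) *\<^sub>R apply_bcontfun z s)"
    for z :: "real \<Rightarrow>\<^sub>C 'a" and s
  have hc: "continuous_on {a..b} (h z)" for z
    unfolding h_def
    by (rule continuous_on_compose2[OF cont, of "{a..b}"
        "\<lambda>s. (s, exp (2 * K * (b - s)) *\<^sub>R apply_bcontfun z s)", simplified])
      (auto intro!: continuous_intros)
  define S where "S z t = exp (- 2 * K * (b - t)) *\<^sub>R (y0 - integral {t..b} (h z))"
    for z :: "real \<Rightarrow>\<^sub>C 'a" and t
  have Sc: "continuous_on {a..b} (S z)" for z
    unfolding S_def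
    by (intro continuous_intros indefinite_integral_continuous_1' integrable_continuous_real hc)
  have SB: "S z \<circ> cl \<in> bcontfun" for z
  proof -
    have "continuous_on UNIV (S z \<circ> cl)"
      by (rule continuous_on_compose[OF cl_cont continuous_on_subset[OF Sc]]) (use cl_in in auto)
    moreover have "bounded (S z ` {a..b})"
      by (intro compact_imp_bounded compact_continuous_image Sc) auto
    then have "bounded (range (S z \<circ> cl))"
      by (rule bounded_subset) (use cl_in in auto)
    ultimately show ?thesis by (simp add: bcontfun_def)
  qed
  define T where "T z = Bcontfun (S z \<circ> cl)" for z
  have T: "apply_bcontfun (T z) t = S z (cl t)" for z t
    using SB by (simp add: T_def Bcontfun_inverse)
  have contr: "dist (T z) (T z') \<le> 1/2 * dist z z'" for z z'
  proof (rule dist_bound)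
    fix t0
    define t where "t = cl t0"
    have t: "a \<le> t" "t \<le> b" using cl_in[of t0] by (auto simp: t_def)
    have hi: "h z integrable_on {t..b}" for z
      using t by (intro integrable_continuous_real continuous_on_subset[OF hc]) auto
    have ei: "((\<lambda>s. K * exp (2 * K * (b - s)) * dist z z') has_integral
        (- 1/2 * exp (2 * K * (b - b)) * dist z z') - (- 1/2 * exp (2 * K * (b - t)) * dist z z')) {t..b}"
      by (rule fundamental_theorem_of_calculus[OF t(2)])
        (auto intro!: derivative_eq_intros
          simp flip: has_real_derivative_iff_has_vector_derivative)
    have "S z t - S z' t = exp (- 2 * K * (b - t)) *\<^sub>R (integral {t..b} (h z') - integral {t..b} (h z))"
      by (simp add: S_def algebra_simps)
    also have "integral {t..b} (h z') - integral {t..b} (h z) = integral {t..b} (\<lambda>s. h z' s - h z s)"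
      by (rule integral_diff[symmetric]) (auto intro: hi)
    finally have "norm (S z t - S z' t)
        = exp (- 2 * K * (b - t)) * norm (integral {t..b} (\<lambda>s. h z' s - h z s))" by simp
    also have "\<dots> \<le> exp (- 2 * K * (b - t)) * integral {t..b} (\<lambda>s. K * exp (2 * K * (b - s)) * dist z z')"
    proof (rule mult_left_mono[OF integral_norm_bound_integral])
      fix s assume s: "s \<in> {t..b}"
      have "norm (h z' s - h z s) \<le> K * norm (exp (2 * K * (b - s)) *\<^sub>R apply_bcontfun z' s
          - exp (2 * K * (b - s)) *\<^sub>R apply_bcontfun z s)"
        unfolding h_def using s t by (intro lip) auto
      also have "\<dots> = K * exp (2 * K * (b - s)) * dist (apply_bcontfun z' s) (apply_bcontfun z s)"
        by (simp add: dist_norm flip: scaleR_diff_right)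
      also have "\<dots> \<le> K * exp (2 * K * (b - s)) * dist z z'"
        using K dist_bounded[of z' s z] by (simp add: dist_commute)
      finally show "norm (h z' s - h z s) \<le> K * exp (2 * K * (b - s)) * dist z z'" .
    qed (use ei hi in \<open>auto intro!: integrable_diff\<close>)
    also have "integral {t..b} (\<lambda>s. K * exp (2 * K * (b - s)) * dist z z')
        = 1/2 * (exp (2 * K * (b - t)) - 1) * dist z z'"
      using integral_unique[OF ei] by (simp add: algebra_simps)
    also have "exp (- 2 * K * (b - t)) * (1/2 * (exp (2 * K * (b - t)) - 1) * dist z z')
        = 1/2 * (1 - exp (- 2 * K * (b - t))) * dist z z'"
      by (simp add: algebra_simps exp_minus flip: exp_add)
    also have "\<dots> \<le> 1/2 * 1 * dist z z'"
      by (intro mult_right_mono mult_left_mono) auto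
    finally show "dist (apply_bcontfun (T z) t0) (apply_bcontfun (T z') t0) \<le> 1/2 * dist z z'"
      by (simp add: T dist_norm t_def)
  qed
  obtain z where z: "T z = z"
    using banach_fix_type[of "1/2" T] contr by auto
  define y where "y t = exp (2 * K * (b - t)) *\<^sub>R apply_bcontfun z t" for t
  have yeq: "y t = y0 - integral {t..b} (h z)" if t: "t \<in> {a..b}" for t
  proof -
    have "apply_bcontfun z t = S z t"
      using T[of z t] z cl_id[OF t] by simp
    then show ?thesis
      by (simp add: y_def S_def flip: exp_add)
  qed
  show ?thesis
  proof
    show "y b = y0" using yeq[of b] ab by simp
    fix t assume t: "t \<in> {a..b}"
    have "((\<lambda>t. y0 - integral {t..b} (h z)) has_vector_derivative 0 - (- h z t)) (at t within {a..b})"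
      by (intro has_vector_derivative_diff integral_has_vector_derivative' hc t derivative_intros)
    then have "(y has_vector_derivative h z t) (at t within {a..b})"
      using t by (auto intro: has_vector_derivative_transform[OF t yeq])
    then show "(y has_vector_derivative f t (y t)) (at t within {a..b})"
      by (simp add: h_def y_def)
  qed
qed

text \<open>
  Fields that are continuous, bounded, and Lipschitz in the state uniformly in time. Boundedness is
  included because without it products of Lipschitz functions need not be Lipschitz.
\<close>

definition tame_bound :: "real set \<Rightarrow> (real \<Rightarrow> 'a::real_normed_vector \<Rightarrow> real) \<Rightarrow> real \<Rightarrow> real \<Rightarrow> bool" where
  "tame_bound S f M K \<longleftrightarrow> 0 \<le> M \<and> 0 \<le> K \<and>
     continuous_on (S \<times> UNIV) (\<lambda>p. f (fst p) (snd p)) \<and>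
     (\<forall>t\<in>S. \<forall>x y. \<bar>f t x\<bar> \<le> M \<and> \<bar>f t x - f t y\<bar> \<le> K * norm (x - y))"

definition tame :: "real set \<Rightarrow> (real \<Rightarrow> 'a::real_normed_vector \<Rightarrow> real) \<Rightarrow> bool" where
  "tame S f \<longleftrightarrow> (\<exists>M K. tame_bound S f M K)"

lemma tameI:
  assumes "continuous_on (S \<times> UNIV) (\<lambda>p. f (fst p) (snd p))" "M \<ge> 0" "K \<ge> 0"
    "\<And>t x. t \<in> S \<Longrightarrow> \<bar>f t x\<bar> \<le> M"
    "\<And>t x y. t \<in> S \<Longrightarrow> \<bar>f t x - f t y\<bar> \<le> K * norm (x - y)"
  shows "tame S f"
  using assms unfolding tame_def tame_bound_def by blast

lemma tame_boundD:
  assumes "tame_bound S f M K"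
  shows "M \<ge> 0" "K \<ge> 0" "continuous_on (S \<times> UNIV) (\<lambda>p. f (fst p) (snd p))"
    "\<And>t x. t \<in> S \<Longrightarrow> \<bar>f t x\<bar> \<le> M"
    "\<And>t x y. t \<in> S \<Longrightarrow> \<bar>f t x - f t y\<bar> \<le> K * norm (x - y)"
  using assms unfolding tame_bound_def by blast+

lemma tame_time:
  assumes "compact S" "continuous_on S g"
  shows "tame S (\<lambda>t x. g t)"
proof -
  obtain M where "M \<ge> 0" "\<forall>t\<in>S. \<bar>g t\<bar> \<le> M"
    using continuous_on_compact_abs_bound[OF assms] by blast
  then show ?thesis
    by (intro tameI[of _ _ M 0])
      (auto intro!: continuous_on_compose2[OF assms(2)] continuous_intros)
qed

lemma tame_clamp:
  assumes "a \<le> b" and "\<And>x y. \<bar>p x - p y\<bar> \<le> norm (x - y)" "continuous_on UNIV p"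
  shows "tame S (\<lambda>t x. max a (min b (p x)))"
proof (rule tameI[of _ _ "max \<bar>a\<bar> \<bar>b\<bar>" 1])
  show "continuous_on (S \<times> UNIV) (\<lambda>q. max a (min b (p (snd q))))"
    by (intro continuous_intros continuous_on_compose2[OF assms(3)]) auto
  fix x y
  show "\<bar>max a (min b (p x)) - max a (min b (p y))\<bar> \<le> 1 * norm (x - y)"
    using assms(2)[of x y] by (simp split: split_max split_min)
qed (use assms(1) in auto)

lemma tame_add:
  assumes "tame S f" "tame S g" shows "tame S (\<lambda>t x. f t x + g t x)"
proof -
  obtain M K where "tame_bound S f M K" using assms(1) by (auto simp: tame_def)
  note f = tame_boundD[OF this]
  obtain M' K' where "tame_bound S g M' K'" using assms(2) by (auto simp: tame_def)
  note g = tame_boundD[OF this]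
  show ?thesis
  proof (rule tameI[of _ _ "M + M'" "K + K'"])
    fix t x y assume t: "t \<in> S"
    show "\<bar>f t x + g t x\<bar> \<le> M + M'" using f(4)[OF t, of x] g(4)[OF t, of x] by linarith
    show "\<bar>f t x + g t x - (f t y + g t y)\<bar> \<le> (K + K') * norm (x - y)"
      using f(5)[OF t, of x y] g(5)[OF t, of x y] unfolding distrib_right by linarith
  qed (use f g in \<open>auto intro!: continuous_intros\<close>)
qed

lemma tame_mult:
  assumes "tame S f" "tame S g" shows "tame S (\<lambda>t x. f t x * g t x)"
proof -
  obtain M K where "tame_bound S f M K" using assms(1) by (auto simp: tame_def)
  note f = tame_boundD[OF this]
  obtain M' K' where "tame_bound S g M' K'" using assms(2) by (auto simp: tame_def)
  note g = tame_boundD[OF this]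
  show ?thesis
  proof (rule tameI[of _ _ "M * M'" "M * K' + M' * K"])
    fix t x y assume t: "t \<in> S"
    show "\<bar>f t x * g t x\<bar> \<le> M * M'"
      using f(4)[OF t, of x] g(4)[OF t, of x] f(1) by (simp add: abs_mult mult_mono)
    have "f t x * g t x - f t y * g t y = f t x * (g t x - g t y) + g t y * (f t x - f t y)"
      by (simp add: algebra_simps)
    then have "\<bar>f t x * g t x - f t y * g t y\<bar>
        \<le> \<bar>f t x\<bar> * \<bar>g t x - g t y\<bar> + \<bar>g t y\<bar> * \<bar>f t x - f t y\<bar>"
      by (metis abs_mult abs_triangle_ineq)
    also have "\<dots> \<le> M * (K' * norm (x - y)) + M' * (K * norm (x - y))"
      by (intro add_mono mult_mono) (auto intro: f g t)
    finally show "\<bar>f t x * g t x - f t y * g t y\<bar> \<le> (M * K' + M' * K) * norm (x - y)"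
      by (simp add: algebra_simps)
  qed (use f g in \<open>auto intro!: continuous_intros\<close>)
qed

lemma tame_compose:
  assumes f: "tame S f" and phi: "continuous_on R \<phi>" "bounded (\<phi> ` R)" "C \<ge> 0"
    "\<And>x y. x \<in> R \<Longrightarrow> y \<in> R \<Longrightarrow> \<bar>\<phi> x - \<phi> y\<bar> \<le> C * \<bar>x - y\<bar>"
    and R: "\<And>t x. t \<in> S \<Longrightarrow> f t x \<in> R"
  shows "tame S (\<lambda>t x. \<phi> (f t x))"
proof -
  obtain M K where "tame_bound S f M K" using f by (auto simp: tame_def)
  note f = tame_boundD[OF this]
  obtain N where N: "\<And>x. x \<in> R \<Longrightarrow> \<bar>\<phi> x\<bar> \<le> N" using phi(2) by (auto simp: bounded_iff)
  show ?thesis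
  proof (rule tameI[of _ _ "max 0 N" "C * K"])
    show "continuous_on (S \<times> UNIV) (\<lambda>p. \<phi> (f (fst p) (snd p)))"
      by (rule continuous_on_compose2[OF phi(1) f(3)]) (auto intro: R)
    fix t x y assume t: "t \<in> S"
    show "\<bar>\<phi> (f t x)\<bar> \<le> max 0 N" using N[OF R[OF t]] by (simp add: le_max_iff_disj)
    have "\<bar>\<phi> (f t x) - \<phi> (f t y)\<bar> \<le> C * \<bar>f t x - f t y\<bar>" by (intro phi R t)
    also have "\<dots> \<le> C * (K * norm (x - y))" by (intro mult_left_mono f t phi)
    finally show "\<bar>\<phi> (f t x) - \<phi> (f t y)\<bar> \<le> C * K * norm (x - y)" by simp
  qed (use f phi in auto)
qed

lemma tame_positive_part:
  assumes "tame S f" shows "tame S (\<lambda>t x. max 0 (f t x))"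
proof -
  obtain M K where "tame_bound S f M K" using assms by (auto simp: tame_def)
  note f = tame_boundD[OF this]
  show ?thesis
  proof (rule tameI[of _ _ M K])
    fix t x y assume t: "t \<in> S"
    show "\<bar>max 0 (f t x)\<bar> \<le> M" using f(4)[OF t, of x] by linarith
    show "\<bar>max 0 (f t x) - max 0 (f t y)\<bar> \<le> K * norm (x - y)"
      using f(5)[OF t, of x y] by linarith
  qed (use f in \<open>auto intro!: continuous_intros\<close>)
qed

lemma tame_inverse:
  assumes "tame S f" "\<delta> > 0" "\<And>t x. t \<in> S \<Longrightarrow> \<delta> \<le> f t x"
  shows "tame S (\<lambda>t x. inverse (f t x))"
proof (rule tame_compose[OF assms(1), of "{\<delta>..}" inverse "inverse \<delta> * inverse \<delta>"])
  show "continuous_on {\<delta>..} (inverse :: real \<Rightarrow> real)"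
    using assms(2) by (intro continuous_intros) auto
  have "\<bar>inverse x\<bar> \<le> inverse \<delta>" if "x \<in> {\<delta>..}" for x
    using that assms(2) by (auto simp: field_simps)
  then show "bounded (inverse ` {\<delta>..})" by (auto simp: bounded_iff)
  fix x y assume xy: "x \<in> {\<delta>..}" "y \<in> {\<delta>..}"
  then have "x > 0" "y > 0" using assms(2) by auto
  then have "\<bar>inverse x - inverse y\<bar> = inverse x * inverse y * \<bar>x - y\<bar>"
    by (simp add: field_simps abs_if)
  also have "\<dots> \<le> inverse \<delta> * inverse \<delta> * \<bar>x - y\<bar>"
    using xy assms(2) by (intro mult_right_mono mult_mono) (auto intro!: le_imp_inverse_le)
  finally show "\<bar>inverse x - inverse y\<bar> \<le> inverse \<delta> * inverse \<delta> * \<bar>x - y\<bar>" .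
qed (use assms in auto)

lemma tame_minus:
  assumes "tame S f" "tame S g" shows "tame S (\<lambda>t x. f t x - g t x)"
proof -
  have "tame S (\<lambda>t (x::'a). - 1 :: real)" by (rule tameI[of _ _ 1 0]) auto
  from tame_add[OF assms(1) tame_mult[OF this assms(2)]] show ?thesis by simp
qed

lemma picard_for_tame_system:
  fixes f g h :: "real \<Rightarrow> real \<times> real \<times> real \<Rightarrow> real"
  assumes ab: "a \<le> b" and tame: "tame {a..b} f" "tame {a..b} g" "tame {a..b} h"
  obtains u w r where "u b = u0" "w b = w0" "r b = r0"
    "\<And>t. t \<in> {a..b} \<Longrightarrow> (u has_real_derivative f t (u t, w t, r t)) (at t within {a..b})"
    "\<And>t. t \<in> {a..b} \<Longrightarrow> (w has_real_derivative g t (u t, w t, r t)) (at t within {a..b})"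
    "\<And>t. t \<in> {a..b} \<Longrightarrow> (r has_real_derivative h t (u t, w t, r t)) (at t within {a..b})"
proof -
  obtain M1 K1 where "tame_bound {a..b} f M1 K1" using tame(1) by (auto simp: tame_def)
  note f = tame_boundD[OF this]
  obtain M2 K2 where "tame_bound {a..b} g M2 K2" using tame(2) by (auto simp: tame_def)
  note g = tame_boundD[OF this]
  obtain M3 K3 where "tame_bound {a..b} h M3 K3" using tame(3) by (auto simp: tame_def)
  note h = tame_boundD[OF this]
  obtain y where y: "y b = (u0, w0, r0)"
    "\<And>t. t \<in> {a..b} \<Longrightarrow> (y has_vector_derivative (f t (y t), g t (y t), h t (y t))) (at t within {a..b})"
  proof (rule picard_terminal_value[OF ab, of "K1 + K2 + K3 + 1" "\<lambda>t x. (f t x, g t x, h t x)" "(u0, w0, r0)"])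
    show "continuous_on ({a..b} \<times> UNIV) (\<lambda>(t, x). (f t x, g t x, h t x))"
      unfolding case_prod_unfold by (intro continuous_on_Pair f(3) g(3) h(3))
    fix t x y assume t: "t \<in> {a..b}"
    have "norm ((f t x, g t x, h t x) - (f t y, g t y, h t y))
        \<le> \<bar>f t x - f t y\<bar> + norm (g t x - g t y, h t x - h t y)"
      using norm_Pair_le[of "f t x - f t y" "(g t x - g t y, h t x - h t y)"] by simp
    also have "norm (g t x - g t y, h t x - h t y) \<le> \<bar>g t x - g t y\<bar> + \<bar>h t x - h t y\<bar>"
      using norm_Pair_le[of "g t x - g t y" "h t x - h t y"] by simp
    also have "\<bar>f t x - f t y\<bar> + (\<bar>g t x - g t y\<bar> + \<bar>h t x - h t y\<bar>)
        \<le> (K1 + K2 + K3 + 1) * norm (x - y)"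
      using f(5)[OF t, of x y] g(5)[OF t, of x y] h(5)[OF t, of x y]
      using norm_ge_zero[of "x - y"] unfolding distrib_right by linarith
    finally show "norm ((f t x, g t x, h t x) - (f t y, g t y, h t y)) \<le> (K1 + K2 + K3 + 1) * norm (x - y)"
      by simp
  qed (use f(2) g(2) h(2) in auto)
  have d1: "((\<lambda>t. fst (y t)) has_vector_derivative f t (y t)) (at t within {a..b})"
    and d2: "((\<lambda>t. fst (snd (y t))) has_vector_derivative g t (y t)) (at t within {a..b})"
    and d3: "((\<lambda>t. snd (snd (y t))) has_vector_derivative h t (y t)) (at t within {a..b})"
    if t: "t \<in> {a..b}" for t
    using bounded_linear.has_vector_derivative[OF bounded_linear_fst y(2)[OF t]]
      bounded_linear.has_vector_derivative[OF bounded_linear_fst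
        bounded_linear.has_vector_derivative[OF bounded_linear_snd y(2)[OF t]]]
      bounded_linear.has_vector_derivative[OF bounded_linear_snd
        bounded_linear.has_vector_derivative[OF bounded_linear_snd y(2)[OF t]]] by simp_all
  show ?thesis
    by (rule that[of "\<lambda>t. fst (y t)" "\<lambda>t. fst (snd (y t))" "\<lambda>t. snd (snd (y t))"])
      (use y(1) d1 d2 d3 in \<open>auto simp: has_real_derivative_iff_has_vector_derivative\<close>)
qed

section \<open>The compressive branch behind the shock\<close>

lemma DERIV_cot_within:
  fixes x :: real
  assumes "sin x \<noteq> 0"
  shows "(cot has_real_derivative - (1 + (cot x)\<^sup>2)) (at x within I)"
proof -
  have "- inverse ((sin x)\<^sup>2) = - (1 + (cot x)\<^sup>2)"
    using assms sin_cos_squared_add[of x] by (simp add: cot_def field_simps)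
  then show ?thesis
    using has_field_derivative_at_within[OF DERIV_cot[OF assms], of I] by simp
qed

text \<open>
  The equation for the compression \<open>L = u - cot * (w + Z)\<close>. It uses only the continuity equation and the
  two equations without pressure, so it serves both the given flows ahead of the shock and the flow
  constructed behind it; \<open>r\<close> is the logarithmic derivative of the density.
\<close>

lemma compression_derivative:
  fixes u w Z :: "real \<Rightarrow> real"
  assumes u: "(u has_real_derivative - (w x + Z x)) (at x within I)"
    and w: "(w has_real_derivative 2 * u x - w x * cot x - w x * r) (at x within I)"
    and Z: "(Z has_real_derivative Z x * (r - cot x)) (at x within I)"
    and x: "sin x \<noteq> 0"
  shows "((\<lambda>s. u s - cot s * (w s + Z s)) has_real_derivative
     - cot x * (2 * (u x - cot x * (w x + Z x)) - (w x - Z x) * r)) (at x within I)"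
  by (rule derivative_eq_intros DERIV_cot_within u w Z x refl)+ (simp add: algebra_simps power2_eq_square)

lemma powr_log_derivative:
  fixes \<rho> :: "real \<Rightarrow> real"
  assumes "(\<rho> has_real_derivative d) (at x within I)" "\<rho> x > 0"
  shows "((\<lambda>s. \<rho> s powr q) has_real_derivative q * \<rho> x powr q * (d / \<rho> x)) (at x within I)"
proof -
  have "((\<lambda>s. \<rho> s powr q) has_real_derivative q * \<rho> x powr (q - 1) * d) (at x within I)"
    using DERIV_chain2[OF has_real_derivative_powr[OF assms(2)] assms(1)] by simp
  then show ?thesis using assms(2) by (simp add: powr_diff field_simps)
qed

lemma powr_lipschitz_on_interval:
  fixes a b q :: real
  assumes "0 < a"
  obtains C where "C \<ge> 0"
    "\<And>x y. x \<in> {a..b} \<Longrightarrow> y \<in> {a..b} \<Longrightarrow> \<bar>x powr q - y powr q\<bar> \<le> C * \<bar>x - y\<bar>"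
proof -
  have c: "continuous_on {a..b} (\<lambda>x. q * x powr (q - 1))"
    using assms by (intro continuous_intros) auto
  obtain C where C: "C \<ge> 0" "\<forall>x\<in>{a..b}. \<bar>q * x powr (q - 1)\<bar> \<le> C"
    using continuous_on_compact_abs_bound[OF _ c] by auto
  show ?thesis
  proof
    fix x y assume xy: "x \<in> {a..b}" "y \<in> {a..b}"
    have "norm (x powr q - y powr q) \<le> C * norm (x - y)"
    proof (rule field_differentiable_bound[of "{a..b}" "\<lambda>x. x powr q" "\<lambda>x. q * x powr (q - 1)"])
      fix z assume z: "z \<in> {a..b}"
      then have "z > 0" using assms by auto
      then show "((\<lambda>x. x powr q) has_real_derivative q * z powr (q - 1)) (at z within {a..b})"
        by (auto intro!: derivative_eq_intros)
      show "norm (q * z powr (q - 1)) \<le> C" using C(2) z by simp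
    qed (use xy in auto)
    then show "\<bar>x powr q - y powr q\<bar> \<le> C * \<bar>x - y\<bar>" by simp
  qed (rule C(1))
qed

lemma cot_nonneg: "0 < x \<Longrightarrow> x \<le> pi / 2 \<Longrightarrow> 0 \<le> cot x"
  by (auto simp: cot_def intro!: divide_nonneg_nonneg cos_ge_zero sin_ge_zero)

text \<open>
  The flow equations in the unknowns \<open>u = U1\<close>, \<open>w = - U2\<close> and the density \<open>\<rho>\<close>. The swirl has been
  eliminated: conservation of \<open>(U3 * sin \<theta>)\<^sup>2 / (\<rho> * w * sin \<theta>)\<close> amounts to
  \<open>U3\<^sup>2 = w * (\<kappa> * \<rho> / sin \<theta>)\<close> with a constant \<open>\<kappa> \<ge> 0\<close>. The function \<open>r\<close> is the rate of
  compression towards the axis, that is, minus the logarithmic derivative of \<open>\<rho>\<close>.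
\<close>

definition compressive_branch ::
    "real \<Rightarrow> real \<Rightarrow> real \<Rightarrow> real set \<Rightarrow> (real \<Rightarrow> real) \<Rightarrow> (real \<Rightarrow> real) \<Rightarrow> (real \<Rightarrow> real) \<Rightarrow> (real \<Rightarrow> real) \<Rightarrow> bool" where
  "compressive_branch \<gamma> A \<kappa> I u w \<rho> r \<longleftrightarrow> (\<forall>\<theta>\<in>I.
     w \<theta> > 0 \<and> \<rho> \<theta> > 0 \<and> (w \<theta>)\<^sup>2 < \<gamma> * A * \<rho> \<theta> powr (\<gamma> - 1) \<and>
     r \<theta> = w \<theta> * (u \<theta> - cot \<theta> * (w \<theta> + \<kappa> * \<rho> \<theta> / sin \<theta>)) / (\<gamma> * A * \<rho> \<theta> powr (\<gamma> - 1) - (w \<theta>)\<^sup>2) \<and>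
     (u has_real_derivative - (w \<theta> + \<kappa> * \<rho> \<theta> / sin \<theta>)) (at \<theta> within I) \<and>
     (w has_real_derivative 2 * u \<theta> - w \<theta> * cot \<theta> + w \<theta> * r \<theta>) (at \<theta> within I) \<and>
     (\<rho> has_real_derivative - (\<rho> \<theta> * r \<theta>)) (at \<theta> within I))"

text \<open>
  Towards the axis \<open>u\<close> and \<open>\<rho>\<close> grow. Differentiation along the branch shows that the Bernoulli sum is
  constant, that \<open>w * Z\<close>, the square of the swirl, does not increase towards the axis, and that
  \<open>(L * sin)' = - cos * L * (c\<^sup>2 - w * Z) / (c\<^sup>2 - w\<^sup>2)\<close> with \<open>Z = \<kappa> * \<rho> / sin\<close>. The bound on the swirl at \<open>b\<close>
  therefore persists, and it makes \<open>L * sin\<close> monotone.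
\<close>

lemma compressive_branch_bounds:
  fixes \<gamma> A \<kappa> t b :: real and u w \<rho> r :: "real \<Rightarrow> real"
  assumes pos: "\<gamma> > 1" "A > 0" "\<kappa> \<ge> 0" "0 < t" "t < b" "b < pi / 2"
    and cont: "continuous_on {t..b} u" "continuous_on {t..b} w" "continuous_on {t..b} \<rho>"
    and branch: "compressive_branch \<gamma> A \<kappa> {t<..<b} u w \<rho> r"
    and end_pos: "\<rho> b > 0"
    and compression: "\<And>x. x \<in> {t<..<b} \<Longrightarrow> cot x * (w x + \<kappa> * \<rho> x / sin x) < u x"
    and swirl: "w b * (\<kappa> * \<rho> b / sin b) \<le> \<gamma> * A * \<rho> b powr (\<gamma> - 1)"
  shows "0 \<le> w t"
    and "(u t)\<^sup>2 + (w t)\<^sup>2 + w t * (\<kappa> * \<rho> t / sin t) + 2 * (\<gamma> * A * \<rho> t powr (\<gamma> - 1)) / (\<gamma> - 1)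
       = (u b)\<^sup>2 + (w b)\<^sup>2 + w b * (\<kappa> * \<rho> b / sin b) + 2 * (\<gamma> * A * \<rho> b powr (\<gamma> - 1)) / (\<gamma> - 1)"
    and "(u b - cot b * (w b + \<kappa> * \<rho> b / sin b)) * sin b \<le> (u t - cot t * (w t + \<kappa> * \<rho> t / sin t)) * sin t"
proof -
  define X where "X x = \<gamma> * A * \<rho> x powr (\<gamma> - 1)" for x
  define Z where "Z x = \<kappa> * \<rho> x / sin x" for x
  define L where "L x = u x - cot x * (w x + Z x)" for x
  have sin: "sin x > 0" and cot: "cot x \<ge> 0" if "x \<in> {t..b}" for x
    using that pos by (auto intro!: sin_gt_zero cot_nonneg)
  have at: "at x within {t<..<b} = at x" if "x \<in> {t<..<b}" for x
    using that by (rule at_within_open) simp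
  have B: "w x > 0" "\<rho> x > 0" "(w x)\<^sup>2 < X x" "r x = w x * L x / (X x - (w x)\<^sup>2)"
    "(u has_real_derivative - (w x + Z x)) (at x)"
    "(w has_real_derivative 2 * u x - w x * cot x + w x * r x) (at x)"
    "(\<rho> has_real_derivative - (\<rho> x * r x)) (at x)" if x: "x \<in> {t<..<b}" for x
    using branch[unfolded compressive_branch_def, THEN bspec, OF x] unfolding at[OF x] L_def Z_def X_def
    by blast+
  have L: "L x > 0" if "x \<in> {t<..<b}" for x
    using compression[OF that] by (simp add: L_def Z_def)
  have rL: "r x * (X x - (w x)\<^sup>2) = w x * L x" if "x \<in> {t<..<b}" for x
    using B(3,4)[OF that] by simp
  have r0: "0 \<le> r x" if "x \<in> {t<..<b}" for x
    unfolding B(4)[OF that] using B(1,3)[OF that] L[OF that] by simp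
  have \<rho>_ge: "\<rho> b \<le> \<rho> x" if x: "x \<in> {t..b}" for x
  proof (rule DERIV_nonpos_imp_decreasing_open[of x b \<rho>])
    show "continuous_on {x..b} \<rho>" using x by (intro continuous_on_subset[OF cont(3)]) auto
    fix y assume "x < y" "y < b"
    then have y: "y \<in> {t<..<b}" using x by auto
    have "- (\<rho> y * r y) \<le> 0" using B(2)[OF y] r0[OF y] by simp
    with B(7)[OF y] show "\<exists>d. (\<rho> has_real_derivative d) (at y) \<and> d \<le> 0" by blast
  qed (use x in auto)
  have \<rho>_pos: "\<rho> x > 0" if "x \<in> {t..b}" for x using \<rho>_ge[OF that] end_pos by simp
  have Z0: "0 \<le> Z x" if "x \<in> {t..b}" for x
    unfolding Z_def using \<rho>_pos[OF that] sin[OF that] pos by simp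
  have ccot: "continuous_on {t..b} cot"
  proof (rule DERIV_continuous_on[OF DERIV_cot_within])
    show "sin x \<noteq> 0" if "x \<in> {t..b}" for x using sin[OF that] by simp
  qed
  have cZ: "continuous_on {t..b} Z"
    unfolding Z_def using sin by (auto intro!: continuous_intros cont simp: less_imp_neq[THEN not_sym])
  have cL: "continuous_on {t..b} L" unfolding L_def by (intro continuous_intros cont cZ ccot)
  have cX: "continuous_on {t..b} X"
    unfolding X_def using \<rho>_pos by (intro continuous_intros cont) force
  show "0 \<le> w t"
  proof (rule tendsto_lowerbound)
    show "(w \<longlongrightarrow> w t) (at_right t)" using cont(2) pos by (simp add: continuous_on_Icc_at_rightD)
    show "\<forall>\<^sub>F x in at_right t. 0 \<le> w x"
      using pos B(1) by (auto simp: eventually_at_right_field intro!: exI[of _ b] less_imp_le)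
  qed simp
  have dZ: "(Z has_real_derivative Z x * (- r x - cot x)) (at x)" if x: "x \<in> {t<..<b}" for x
  proof -
    have sx: "sin x > 0" using sin[of x] x by simp
    have "(Z has_real_derivative
        (\<kappa> * - (\<rho> x * r x) * sin x - \<kappa> * \<rho> x * cos x) / (sin x * sin x)) (at x)"
      using DERIV_divide[OF DERIV_cmult[OF B(7)[OF x], of \<kappa>] DERIV_sin] sx by (simp add: Z_def[abs_def])
    also have "(\<kappa> * - (\<rho> x * r x) * sin x - \<kappa> * \<rho> x * cos x) / (sin x * sin x) = Z x * (- r x - cot x)"
      using sx by (simp add: Z_def cot_def field_simps)
    finally show ?thesis .
  qed
  have dX: "(X has_real_derivative - (\<gamma> - 1) * X x * r x) (at x)" if x: "x \<in> {t<..<b}" for x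
    unfolding X_def using DERIV_cmult[OF powr_log_derivative[OF B(7,2)[OF x], of "\<gamma> - 1"], of "\<gamma> * A"] B(2)[OF x]
    by (simp add: algebra_simps)
  define E where "E x = (u x)\<^sup>2 + (w x)\<^sup>2 + w x * Z x + 2 * X x / (\<gamma> - 1)" for x
  have dE: "(E has_real_derivative 0) (at x)" if x: "x \<in> {t<..<b}" for x
  proof -
    have "((\<lambda>x. (u x)\<^sup>2 + (w x)\<^sup>2 + w x * Z x + 2 * X x / (\<gamma> - 1)) has_real_derivative
      (2 * u x * - (w x + Z x) + 2 * w x * (2 * u x - w x * cot x + w x * r x)
       + ((2 * u x - w x * cot x + w x * r x) * Z x + w x * (Z x * (- r x - cot x)))
       + 2 * (- (\<gamma> - 1) * X x * r x) / (\<gamma> - 1))) (at x)"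
      using B(5,6)[OF x] pos(1) by (auto intro!: derivative_eq_intros dZ[OF x] dX[OF x])
    also have "2 * (- (\<gamma> - 1) * X x * r x) / (\<gamma> - 1) = - 2 * X x * r x"
      using pos by (simp add: field_simps)
    also have "2 * u x * - (w x + Z x) + 2 * w x * (2 * u x - w x * cot x + w x * r x)
       + ((2 * u x - w x * cot x + w x * r x) * Z x + w x * (Z x * (- r x - cot x)))
       + - 2 * X x * r x = 2 * w x * L x - 2 * (r x * (X x - (w x)\<^sup>2))"
      by (simp add: L_def algebra_simps power2_eq_square)
    finally show ?thesis by (simp add: rL[OF x] E_def[abs_def])
  qed
  have "continuous_on {t..b} E"
    unfolding E_def using pos(1) by (intro continuous_intros cont cZ cX) auto
  from DERIV_isconst_end[OF pos(5) this dE] have "E b = E t" by simp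
  then show "(u t)\<^sup>2 + (w t)\<^sup>2 + w t * (\<kappa> * \<rho> t / sin t) + 2 * (\<gamma> * A * \<rho> t powr (\<gamma> - 1)) / (\<gamma> - 1)
      = (u b)\<^sup>2 + (w b)\<^sup>2 + w b * (\<kappa> * \<rho> b / sin b) + 2 * (\<gamma> * A * \<rho> b powr (\<gamma> - 1)) / (\<gamma> - 1)"
    by (simp add: E_def X_def Z_def)
  have cwZ: "continuous_on {t..b} (\<lambda>x. w x * Z x)" by (intro continuous_intros cont cZ)
  have wZ_le: "w x * Z x \<le> X x" if x: "x \<in> {t<..<b}" for x
  proof -
    have "w x * Z x \<le> w b * Z b"
    proof (rule DERIV_nonneg_imp_increasing_open[of x b "\<lambda>x. w x * Z x"])
      show "continuous_on {x..b} (\<lambda>x. w x * Z x)"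
        by (rule continuous_on_subset[OF cwZ]) (use x in auto)
      fix y assume "x < y" "y < b"
      then have y: "y \<in> {t<..<b}" using x by auto
      have "((\<lambda>x. w x * Z x) has_real_derivative
          (2 * u y - w y * cot y + w y * r y) * Z y + w y * (Z y * (- r y - cot y))) (at y)"
        using B(6)[OF y] by (auto intro!: derivative_eq_intros dZ[OF y])
      also have "(2 * u y - w y * cot y + w y * r y) * Z y + w y * (Z y * (- r y - cot y))
          = 2 * Z y * (L y + cot y * Z y)" by (simp add: L_def algebra_simps)
      finally have "((\<lambda>x. w x * Z x) has_real_derivative 2 * Z y * (L y + cot y * Z y)) (at y)" .
      moreover have "0 \<le> 2 * Z y * (L y + cot y * Z y)"
        using Z0[of y] cot[of y] L[OF y] y by simp
      ultimately show "\<exists>d. ((\<lambda>x. w x * Z x) has_real_derivative d) (at y) \<and> 0 \<le> d" by blast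
    qed (use x in auto)
    also have "\<dots> \<le> X b" using swirl by (simp add: Z_def X_def)
    also have "\<dots> \<le> X x" unfolding X_def
      using \<rho>_ge[of x] end_pos pos x by (intro mult_left_mono powr_mono2) auto
    finally show ?thesis .
  qed
  have "L b * sin b \<le> L t * sin t"
  proof (rule DERIV_nonpos_imp_decreasing_open[of t b "\<lambda>x. L x * sin x"])
    show "continuous_on {t..b} (\<lambda>x. L x * sin x)" by (intro continuous_intros cL)
    fix x assume "t < x" "x < b"
    then have x: "x \<in> {t<..<b}" by simp
    have sx: "sin x > 0" using sin[of x] x by simp
    have "(L has_real_derivative - cot x * (2 * L x - (w x - Z x) * - r x)) (at x)"
      unfolding L_def using B(5,6)[OF x] sx dZ[OF x] by (intro compression_derivative) auto
    then have "((\<lambda>x. L x * sin x) has_real_derivative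
        - cot x * (2 * L x - (w x - Z x) * - r x) * sin x + L x * cos x) (at x)"
      by (auto intro!: derivative_eq_intros)
    also have "- cot x * (2 * L x - (w x - Z x) * - r x) * sin x + L x * cos x
        = - cos x * (L x + (w x - Z x) * r x)"
      using sx by (simp add: cot_def field_simps)
    finally have d: "((\<lambda>x. L x * sin x) has_real_derivative - cos x * (L x + (w x - Z x) * r x)) (at x)" .
    have "(L x + (w x - Z x) * r x) * (X x - (w x)\<^sup>2)
        = L x * (X x - (w x)\<^sup>2) + (w x - Z x) * (r x * (X x - (w x)\<^sup>2))"
      by (simp add: algebra_simps)
    also have "\<dots> = L x * (X x - w x * Z x)"
      unfolding rL[OF x] by (simp add: algebra_simps power2_eq_square)
    also have "\<dots> \<ge> 0" using wZ_le[OF x] L[OF x] by simp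
    finally have "0 \<le> L x + (w x - Z x) * r x" using B(3)[OF x] by (simp add: zero_le_mult_iff)
    moreover have "cos x \<ge> 0" using x pos by (intro cos_ge_zero) auto
    ultimately have "- cos x * (L x + (w x - Z x) * r x) \<le> 0" by simp
    with d show "\<exists>y. ((\<lambda>x. L x * sin x) has_real_derivative y) (at x) \<and> y \<le> 0" by blast
  qed (use pos in simp)
  then show "(u b - cot b * (w b + \<kappa> * \<rho> b / sin b)) * sin b \<le> (u t - cot t * (w t + \<kappa> * \<rho> t / sin t)) * sin t"
    by (simp add: L_def Z_def)
qed

text \<open>
  If \<open>w\<close> stayed positive down to the axis, then \<open>L \<ge> Lb * sin \<theta>b / sin \<theta>\<close> by the bounds above. But \<open>L \<le> u\<close>, and
  \<open>u\<close> is bounded by the Bernoulli sum.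

  The solution is obtained for a system truncated to a box, which is globally Lipschitz. The truncation
  keeps \<open>u\<close> and \<open>\<rho>\<close> monotone, and the a priori bounds show that it is never felt before \<open>w\<close> vanishes.
\<close>

lemma downstream_branch:
  fixes \<gamma> A \<kappa> \<theta>b ub wb \<rho>b :: real
  assumes pos: "\<gamma> > 1" "A > 0" "\<kappa> \<ge> 0" "0 < \<theta>b" "\<theta>b < pi / 2" "ub > 0" "wb > 0" "\<rho>b > 0"
    and subsonic: "wb\<^sup>2 < \<gamma> * A * \<rho>b powr (\<gamma> - 1)"
    and swirl: "wb * (\<kappa> * \<rho>b / sin \<theta>b) \<le> \<gamma> * A * \<rho>b powr (\<gamma> - 1)"
    and compression: "cot \<theta>b * (wb + \<kappa> * \<rho>b / sin \<theta>b) < ub"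
  obtains \<theta>w u w \<rho> r where "0 < \<theta>w" "\<theta>w < \<theta>b"
    and "u \<theta>b = ub" "w \<theta>b = wb" "\<rho> \<theta>b = \<rho>b"
    and "compressive_branch \<gamma> A \<kappa> {\<theta>w<..\<theta>b} u w \<rho> r"
    and "(w \<longlongrightarrow> 0) (at_right \<theta>w)"
proof -
  define X where "X \<rho> = \<gamma> * A * \<rho> powr (\<gamma> - 1)" for \<rho>
  have X_mono: "X x \<le> X y" if "0 < x" "x \<le> y" for x y
    unfolding X_def using pos that by (intro mult_left_mono powr_mono2) auto
  have Xb: "X \<rho>b > 0" using pos by (simp add: X_def)
  define \<delta> where "\<delta> = X \<rho>b - wb\<^sup>2"
  have \<delta>: "\<delta> > 0" using subsonic by (simp add: \<delta>_def X_def)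
  have sinb: "sin \<theta>b > 0" using pos by (intro sin_gt_zero) auto
  \<comment> \<open>Twice the Bernoulli constant; it bounds \<open>u\<close> by \<open>sqrt E2\<close> and the density by \<open>\<rho>M\<close>.\<close>
  define E2 where "E2 = ub\<^sup>2 + wb\<^sup>2 + wb * (\<kappa> * \<rho>b / sin \<theta>b) + 2 * X \<rho>b / (\<gamma> - 1)"
  have wZb: "0 \<le> wb * (\<kappa> * \<rho>b / sin \<theta>b)" using pos sinb by simp
  have E2_u: "ub\<^sup>2 \<le> E2"
    unfolding E2_def using wZb Xb pos by (smt (verit) divide_nonneg_pos zero_le_power2)
  have E2_X: "2 * X \<rho>b / (\<gamma> - 1) \<le> E2"
    unfolding E2_def using wZb by (smt (verit) zero_le_power2)
  define um where "um = sqrt E2 + 1"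
  define \<rho>M where "\<rho>M = ((\<gamma> - 1) * E2 / (2 * \<gamma> * A)) powr (1 / (\<gamma> - 1))"
  have le_um: "x < um" if "x\<^sup>2 \<le> E2" for x
    unfolding um_def using real_le_rsqrt[OF that] by linarith
  have le_\<rho>M: "x \<le> \<rho>M" if "x > 0" "2 * X x / (\<gamma> - 1) \<le> E2" for x
  proof -
    have "x powr (\<gamma> - 1) \<le> (\<gamma> - 1) * E2 / (2 * \<gamma> * A)"
      using that pos by (simp add: X_def field_simps)
    then have "(x powr (\<gamma> - 1)) powr (1 / (\<gamma> - 1)) \<le> \<rho>M"
      unfolding \<rho>M_def using pos by (intro powr_mono2) auto
    then show ?thesis using that pos by (simp add: powr_powr)
  qed
  have ub_um: "ub < um" by (rule le_um[OF E2_u])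
  have \<rho>b_\<rho>M: "\<rho>b \<le> \<rho>M" using pos E2_X by (intro le_\<rho>M) auto
  define Lb where "Lb = ub - cot \<theta>b * (wb + \<kappa> * \<rho>b / sin \<theta>b)"
  have Lb: "Lb > 0" using compression by (simp add: Lb_def)
  \<comment> \<open>So close to the axis that \<open>L < um\<close> keeps \<open>L * sin\<close> below its value at the shock.\<close>
  define \<epsilon> where "\<epsilon> = min (\<theta>b / 2) (Lb * sin \<theta>b / (2 * um))"
  have um: "um > 0" using ub_um pos by simp
  have \<epsilon>: "0 < \<epsilon>" "\<epsilon> < \<theta>b" using pos Lb sinb um by (auto simp: \<epsilon>_def min_def)
  have sin_\<epsilon>: "um * sin \<epsilon> < Lb * sin \<theta>b"
  proof -
    have "um * sin \<epsilon> \<le> um * \<epsilon>" using um \<epsilon> sin_x_le_x[of \<epsilon>] by (intro mult_left_mono) auto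
    also have "\<dots> \<le> um * (Lb * sin \<theta>b / (2 * um))" using um by (intro mult_left_mono) (auto simp: \<epsilon>_def)
    also have "\<dots> < Lb * sin \<theta>b" using um Lb sinb by simp
    finally show ?thesis .
  qed
  define J where "J = {\<epsilon>..\<theta>b}"
  have sinJ: "sin t > 0" and cotJ: "cot t \<ge> 0" if "t \<in> J" for t
    using that \<epsilon> pos unfolding J_def by (auto intro!: sin_gt_zero cot_nonneg)

  \<comment> \<open>The truncated system: within the bounds proved below the truncation is invisible.\<close>
  define uh where "uh t p = max ub (min um (fst p))" for t :: real and p :: "real \<times> real \<times> real"
  define wh where "wh t p = max 0 (min wb (fst (snd p)))" for t :: real and p :: "real \<times> real \<times> real"
  define \<rho>h where "\<rho>h t p = max \<rho>b (min (\<rho>M + 1) (snd (snd p)))" for t :: real and p :: "real \<times> real \<times> real"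
  \<comment> \<open>Cutting off the negative part of \<open>L\<close> makes the truncated rate of compression nonnegative throughout.\<close>
  define Lh where "Lh t p = max 0 (uh t p - cot t * (wh t p + \<kappa> * inverse (sin t) * \<rho>h t p))" for t p
  define rh where "rh t p = wh t p * Lh t p * inverse (X (\<rho>h t p) - wh t p * wh t p)" for t p
  have wh_range: "0 \<le> wh t p" "wh t p \<le> wb" for t p using pos by (auto simp: wh_def)
  have \<rho>h_range: "\<rho>b \<le> \<rho>h t p" "\<rho>h t p \<le> \<rho>M + 1" for t p using \<rho>b_\<rho>M by (auto simp: \<rho>h_def)
  have den: "\<delta> \<le> X (\<rho>h t p) - wh t p * wh t p" for t p
    using X_mono[OF _ \<rho>h_range(1)] pos mult_mono[OF wh_range(2) wh_range(2)] wh_range(1)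
    unfolding \<delta>_def power2_eq_square by (smt (verit))
  have nf: "norm (fst p) \<le> norm p" "norm (snd p) \<le> norm p" for p :: "'x::real_normed_vector \<times> 'y::real_normed_vector"
    by (metis norm_fst_le prod.collapse) (metis norm_snd_le prod.collapse)
  have n1: "\<bar>fst x - fst y\<bar> \<le> norm (x - y)" for x y :: "real \<times> real \<times> real"
    using nf(1)[of "x - y"] by simp
  have n2: "norm (snd x - snd y) \<le> norm (x - y)" for x y :: "real \<times> real \<times> real"
    using nf(2)[of "x - y"] by simp
  have n3: "\<bar>fst (snd x) - fst (snd y)\<bar> \<le> norm (x - y)" for x y :: "real \<times> real \<times> real"
    using nf(1)[of "snd x - snd y"] n2[of x y] by simp
  have n4: "\<bar>snd (snd x) - snd (snd y)\<bar> \<le> norm (x - y)" for x y :: "real \<times> real \<times> real"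
    using nf(2)[of "snd x - snd y"] n2[of x y] by simp
  have tu: "tame J uh" unfolding uh_def using ub_um
    by (intro tame_clamp n1) (auto intro!: continuous_intros)
  have tw: "tame J wh" unfolding wh_def using pos
    by (intro tame_clamp n3) (auto intro!: continuous_intros)
  have tr: "tame J \<rho>h" unfolding \<rho>h_def using \<rho>b_\<rho>M
    by (intro tame_clamp n4) (auto intro!: continuous_intros)
  have J: "compact J" by (simp add: J_def)
  have tcot: "tame J (\<lambda>t p. cot t)" and tsin: "tame J (\<lambda>t p. inverse (sin t))"
    and tconst: "tame J (\<lambda>t p. c)" for c :: real
    using sinJ by (auto intro!: tame_time J continuous_intros continuous_at_imp_continuous_on isCont_cot
      simp: less_imp_neq[THEN not_sym])
  have tX: "tame J (\<lambda>t p. X (\<rho>h t p))"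
  proof -
    obtain C where C: "C \<ge> 0"
      "\<And>x y. x \<in> {\<rho>b..\<rho>M + 1} \<Longrightarrow> y \<in> {\<rho>b..\<rho>M + 1} \<Longrightarrow> \<bar>x powr (\<gamma> - 1) - y powr (\<gamma> - 1)\<bar> \<le> C * \<bar>x - y\<bar>"
      using powr_lipschitz_on_interval pos(8) by blast
    have c: "continuous_on {\<rho>b..\<rho>M + 1} (\<lambda>x. x powr (\<gamma> - 1))"
      using pos by (intro continuous_intros) auto
    have "tame J (\<lambda>t p. \<rho>h t p powr (\<gamma> - 1))"
      by (rule tame_compose[OF tr c _ C])
        (use \<rho>h_range in \<open>auto intro!: compact_imp_bounded compact_continuous_image c\<close>)
    then show ?thesis unfolding X_def by (intro tame_mult tconst)
  qed
  have tL: "tame J Lh" unfolding Lh_def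
    by (intro tame_positive_part tame_minus tame_mult tame_add tu tw tr tcot tsin tconst)
  have trh: "tame J rh" unfolding rh_def
    by (intro tame_mult tame_inverse[OF _ \<delta>] tame_minus tw tL tX den)
  obtain u w \<rho> where init: "u \<theta>b = ub" "w \<theta>b = wb" "\<rho> \<theta>b = \<rho>b"
    and du: "\<And>t. t \<in> J \<Longrightarrow> (u has_real_derivative
        (0 - (wh t (u t, w t, \<rho> t) + \<kappa> * inverse (sin t) * \<rho>h t (u t, w t, \<rho> t)))) (at t within J)"
    and dw: "\<And>t. t \<in> J \<Longrightarrow> (w has_real_derivative
        (2 * uh t (u t, w t, \<rho> t) - wh t (u t, w t, \<rho> t) * cot t
          + wh t (u t, w t, \<rho> t) * rh t (u t, w t, \<rho> t))) (at t within J)"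
    and dr: "\<And>t. t \<in> J \<Longrightarrow> (\<rho> has_real_derivative
        (0 - \<rho>h t (u t, w t, \<rho> t) * rh t (u t, w t, \<rho> t))) (at t within J)"
    unfolding J_def
  proof (rule picard_for_tame_system[of \<epsilon> \<theta>b
      "\<lambda>t p. 0 - (wh t p + \<kappa> * inverse (sin t) * \<rho>h t p)"
      "\<lambda>t p. 2 * uh t p - wh t p * cot t + wh t p * rh t p"
      "\<lambda>t p. 0 - \<rho>h t p * rh t p" ub wb \<rho>b], goal_cases)
    case 2 show ?case unfolding J_def[symmetric]
      by (intro tame_minus tame_mult tame_add tu tw tr tcot tsin tconst trh)
  next
    case 3 show ?case unfolding J_def[symmetric]
      by (intro tame_minus tame_mult tame_add tu tw tr tcot tsin tconst trh)
  next
    case 4 show ?case unfolding J_def[symmetric]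
      by (intro tame_minus tame_mult tame_add tu tw tr tcot tsin tconst trh)
  next
    case 5 show ?case by (rule 5(1)) (fact 5)+
  qed (use \<epsilon> in auto)
  let ?p = "\<lambda>t. (u t, w t, \<rho> t)"
  have Lh0: "0 \<le> Lh t p" for t p by (simp add: Lh_def)
  have rh0: "0 \<le> rh t p" for t p
    unfolding rh_def using wh_range(1)[of t p] Lh0[of t p] den[of t p] \<delta> by simp
  have cu: "continuous_on J u" and cw: "continuous_on J w" and cr: "continuous_on J \<rho>"
    using DERIV_continuous_on[OF du] DERIV_continuous_on[OF dw] DERIV_continuous_on[OF dr] by auto
  have at: "at t within J = at t" if "\<epsilon> < t" "t < \<theta>b" for t
    unfolding J_def by (rule at_within_Icc_at[OF that])
  have sub: "{s..\<theta>b} \<subseteq> J" if "s \<in> J" for s using that by (auto simp: J_def)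
  have nonincr: "f \<theta>b \<le> f s"
    if "s \<in> J" "continuous_on J f" "\<And>t. s < t \<Longrightarrow> t < \<theta>b \<Longrightarrow> \<exists>y. (f has_real_derivative y) (at t within J) \<and> y \<le> 0"
    for f s
  proof (rule DERIV_nonpos_imp_decreasing_open[of s \<theta>b f])
    fix t assume t: "s < t" "t < \<theta>b"
    then have "at t within J = at t" using that(1) at by (auto simp: J_def)
    with that(3)[OF t] show "\<exists>y. (f has_real_derivative y) (at t) \<and> y \<le> 0" by simp
  qed (use that sub in \<open>auto simp: J_def intro: continuous_on_subset\<close>)
  have nondecr: "f s \<le> f \<theta>b"
    if "s \<in> J" "continuous_on J f" "\<And>t. s < t \<Longrightarrow> t < \<theta>b \<Longrightarrow> \<exists>y. (f has_real_derivative y) (at t within J) \<and> y \<ge> 0"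
    for f s
    using nonincr[of s "\<lambda>t. - f t"] that by (force intro: continuous_intros derivative_intros)
  have u_ge: "ub \<le> u s" if s: "s \<in> J" for s
    using nonincr[OF s cu] init
  proof (simp, elim meta_mp)
    fix t assume "s < t" "t < \<theta>b"
    then have t: "t \<in> J" using s by (auto simp: J_def)
    have "0 \<le> wh t (?p t) + \<kappa> * inverse (sin t) * \<rho>h t (?p t)"
      using wh_range(1)[of t "?p t"] \<rho>h_range(1)[of t "?p t"] pos sinJ[OF t] by simp
    with du[OF t] show "\<exists>y. (u has_real_derivative y) (at t within J) \<and> y \<le> 0" by (smt (verit))
  qed
  have \<rho>_ge: "\<rho>b \<le> \<rho> s" if s: "s \<in> J" for s
    using nonincr[OF s cr] init
  proof (simp, elim meta_mp)
    fix t assume "s < t" "t < \<theta>b"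
    then have t: "t \<in> J" using s by (auto simp: J_def)
    have "0 \<le> \<rho>h t (?p t) * rh t (?p t)"
      using \<rho>h_range(1)[of t "?p t"] pos rh0[of t "?p t"] by simp
    with dr[OF t] show "\<exists>y. (\<rho> has_real_derivative y) (at t within J) \<and> y \<le> 0" by (smt (verit))
  qed
  define Z where "Z t = \<kappa> * \<rho> t / sin t" for t
  define L where "L t = u t - cot t * (w t + Z t)" for t
  have Z0: "0 \<le> Z t" if "t \<in> J" for t
    unfolding Z_def using \<rho>_ge[OF that] sinJ[OF that] pos by simp
  have ccot: "continuous_on J cot"
    using sinJ by (auto intro!: continuous_at_imp_continuous_on isCont_cot simp: less_imp_neq[THEN not_sym])
  have cZ: "continuous_on J Z"
    unfolding Z_def using sinJ by (auto intro!: continuous_intros cr simp: less_imp_neq[THEN not_sym])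
  have cL: "continuous_on J L"
    unfolding L_def by (intro continuous_intros cu cw cZ ccot)
  \<comment> \<open>Positivity of \<open>Q\<close> comprises the open conditions under which the truncated and the true system agree.\<close>
  define Q where "Q t = min (min (w t) (L t)) (min (um - u t) (\<rho>M + 1 - \<rho> t))" for t
  have cQ: "continuous_on J Q"
    unfolding Q_def by (intro continuous_intros cu cw cr cL)
  define r where "r t = w t * L t / (X (\<rho> t) - (w t)\<^sup>2)" for t

  \<comment> \<open>Monotonicity first, since it is what keeps \<open>w\<close> inside the box.\<close>
  have exact: "w s \<le> wb \<and> (w s)\<^sup>2 < X (\<rho> s) \<and>
      (u has_real_derivative - (w s + Z s)) (at s within J) \<and>
      (w has_real_derivative 2 * u s - w s * cot s + w s * r s) (at s within J) \<and>
      (\<rho> has_real_derivative - (\<rho> s * r s)) (at s within J)"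
    if Q: "\<And>s. s \<in> {t<..\<theta>b} \<Longrightarrow> Q s > 0" and t: "t \<in> J" and s: "s \<in> {t<..\<theta>b}" for s t
  proof -
    have inJ: "x \<in> J" if "x \<in> {t<..\<theta>b}" for x using that t by (auto simp: J_def)
    have uh: "uh x (?p x) = u x" if "x \<in> {t<..\<theta>b}" for x
      using u_ge[OF inJ[OF that]] Q[OF that] by (simp add: uh_def Q_def)
    have \<rho>h: "\<rho>h x (?p x) = \<rho> x" if "x \<in> {t<..\<theta>b}" for x
      using \<rho>_ge[OF inJ[OF that]] Q[OF that] by (simp add: \<rho>h_def Q_def)
    have w_le: "w x \<le> wb" if x: "x \<in> {t<..\<theta>b}" for x
      using nondecr[OF inJ[OF x] cw] init
    proof (simp, elim meta_mp)
      fix y assume "x < y" "y < \<theta>b"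
      with x have y: "y \<in> {t<..\<theta>b}" by auto
      note yJ = inJ[OF y]
      have "wh y (?p y) \<le> w y" using Q[OF y] by (simp add: wh_def Q_def)
      then have "wh y (?p y) * cot y \<le> (w y + Z y) * cot y"
        using cotJ[OF yJ] Z0[OF yJ] by (intro mult_right_mono) auto
      also have "\<dots> \<le> u y" using Q[OF y] by (simp add: Q_def L_def mult.commute)
      finally have "0 \<le> 2 * uh y (?p y) - wh y (?p y) * cot y"
        using u_ge[OF yJ] pos by (simp add: uh[OF y])
      moreover have "0 \<le> wh y (?p y) * rh y (?p y)"
        using wh_range(1) rh0 by simp
      ultimately show "\<exists>z. (w has_real_derivative z) (at y within J) \<and> 0 \<le> z"
        using dw[OF yJ] by (smt (verit))
    qed
    have wh: "wh s (?p s) = w s" using w_le[OF s] Q[OF s] by (simp add: wh_def Q_def)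
    have Lh: "Lh s (?p s) = L s" using Q[OF s] unfolding Lh_def wh \<rho>h[OF s] uh[OF s]
      by (simp add: L_def Z_def Q_def divide_inverse mult_ac)
    have rh: "rh s (?p s) = r s"
      unfolding rh_def wh \<rho>h[OF s] Lh by (simp add: r_def divide_inverse power2_eq_square)
    have "(w s)\<^sup>2 < X (\<rho> s)"
      using den[of s "?p s"] \<delta> by (simp add: wh \<rho>h[OF s] power2_eq_square)
    then show ?thesis
      using w_le[OF s] du[OF inJ[OF s]] dw[OF inJ[OF s]] dr[OF inJ[OF s]]
      unfolding uh[OF s] \<rho>h[OF s] wh rh by (simp add: Z_def divide_inverse mult_ac)
  qed
  have bounds: "u t < um \<and> \<rho> t < \<rho>M + 1 \<and> 0 \<le> w t \<and> Lb * sin \<theta>b \<le> L t * sin t"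
    if Q: "\<And>s. s \<in> {t<..\<theta>b} \<Longrightarrow> Q s > 0" and t: "t \<in> J" for t
  proof (cases "t = \<theta>b")
    case True
    then show ?thesis using ub_um \<rho>b_\<rho>M pos init by (simp add: L_def Z_def Lb_def)
  next
    case False
    then have tb: "t < \<theta>b" using t by (simp add: J_def)
    have branch: "compressive_branch \<gamma> A \<kappa> {t<..<\<theta>b} u w \<rho> r"
      unfolding compressive_branch_def
    proof
      fix x assume x: "x \<in> {t<..<\<theta>b}"
      have sub': "{t<..<\<theta>b} \<subseteq> J" using t by (auto simp: J_def)
      have "w x > 0" "\<rho> x > 0" using Q[of x] \<rho>_ge[of x] x pos t by (auto simp: Q_def J_def)
      then show "w x > 0 \<and> \<rho> x > 0 \<and> (w x)\<^sup>2 < \<gamma> * A * \<rho> x powr (\<gamma> - 1) \<and>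
        r x = w x * (u x - cot x * (w x + \<kappa> * \<rho> x / sin x)) / (\<gamma> * A * \<rho> x powr (\<gamma> - 1) - (w x)\<^sup>2) \<and>
        (u has_real_derivative - (w x + \<kappa> * \<rho> x / sin x)) (at x within {t<..<\<theta>b}) \<and>
        (w has_real_derivative 2 * u x - w x * cot x + w x * r x) (at x within {t<..<\<theta>b}) \<and>
        (\<rho> has_real_derivative - (\<rho> x * r x)) (at x within {t<..<\<theta>b})"
        using exact[OF Q t, of x] x sub'
        by (auto simp: r_def L_def Z_def X_def intro: DERIV_subset)
    qed
    have t0: "0 < t" using t \<epsilon> by (simp add: J_def)
    have comp: "cot x * (w x + \<kappa> * \<rho> x / sin x) < u x" if "x \<in> {t<..<\<theta>b}" for x
      using Q[of x] that by (simp add: Q_def L_def Z_def)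
    have ends: "\<rho> \<theta>b > 0" "w \<theta>b * (\<kappa> * \<rho> \<theta>b / sin \<theta>b) \<le> \<gamma> * A * \<rho> \<theta>b powr (\<gamma> - 1)"
      unfolding init by (fact pos(8), fact swirl)
    note B = compressive_branch_bounds[OF pos(1-3) t0 tb pos(5) continuous_on_subset[OF cu sub[OF t]]
        continuous_on_subset[OF cw sub[OF t]] continuous_on_subset[OF cr sub[OF t]] branch ends(1) comp ends(2)]
    have wZ: "0 \<le> w t * Z t" using B(1) Z0[OF t] by simp
    have \<rho>t: "\<rho> t > 0" "X (\<rho> t) > 0" using \<rho>_ge[OF t] pos X_mono[of \<rho>b "\<rho> t"] Xb by auto
    have E: "(u t)\<^sup>2 + (w t)\<^sup>2 + w t * Z t + 2 * X (\<rho> t) / (\<gamma> - 1) = E2"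
      using B(2) by (simp add: E2_def Z_def X_def init)
    have X0: "0 \<le> 2 * X (\<rho> t) / (\<gamma> - 1)" using \<rho>t pos by simp
    have "(u t)\<^sup>2 \<le> E2" "2 * X (\<rho> t) / (\<gamma> - 1) \<le> E2"
      using E wZ X0 zero_le_power2[of "u t"] zero_le_power2[of "w t"] by linarith+
    moreover have "Lb * sin \<theta>b \<le> L t * sin t"
      using B(3) by (simp add: L_def init Z_def Lb_def)
    ultimately show ?thesis using B(1) le_um[of "u t"] le_\<rho>M[OF \<rho>t(1)] by force
  qed
  \<comment> \<open>The largest angle at which \<open>Q\<close> fails is the cone angle: all conditions but \<open>w > 0\<close> persist there.\<close>
  define bad where "bad = {t \<in> J. Q t \<le> 0}"
  have bad_ne: "bad \<noteq> {}"
  proof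
    assume "bad = {}"
    then have Q: "Q s > 0" if "s \<in> J" for s using that by (force simp: bad_def)
    have \<epsilon>J: "\<epsilon> \<in> J" using \<epsilon> by (simp add: J_def)
    have b: "Lb * sin \<theta>b \<le> L \<epsilon> * sin \<epsilon>"
      using bounds[of \<epsilon>] Q \<epsilon>J by (auto simp: J_def)
    have "L \<epsilon> \<le> um"
    proof -
      have "0 \<le> cot \<epsilon> * (w \<epsilon> + Z \<epsilon>)"
        using Q[OF \<epsilon>J] Z0[OF \<epsilon>J] cotJ[OF \<epsilon>J] by (simp add: Q_def)
      then show ?thesis using Q[OF \<epsilon>J] unfolding Q_def L_def by simp
    qed
    then have "L \<epsilon> * sin \<epsilon> \<le> um * sin \<epsilon>" using sinJ[OF \<epsilon>J] by simp
    with b sin_\<epsilon> show False by linarith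
  qed
  have "bad = J \<inter> Q -` {..0}" by (auto simp: bad_def)
  then have "compact bad"
    using continuous_closed_preimage[OF cQ, of "{..0}"] J
    by (metis compact_Int_closed compact_imp_closed closed_atMost inf.left_idem)
  then obtain \<theta>w where \<theta>w: "\<theta>w \<in> bad" "\<And>t. t \<in> bad \<Longrightarrow> t \<le> \<theta>w"
    using compact_attains_sup[of bad] bad_ne by auto
  have \<theta>wJ: "\<theta>w \<in> J" using \<theta>w by (simp add: bad_def)
  have "Q \<theta>b > 0" using pos ub_um \<rho>b_\<rho>M Lb by (simp add: Q_def init L_def Z_def Lb_def)
  then have \<theta>w_less: "\<theta>w < \<theta>b" using \<theta>w \<theta>wJ by (force simp: bad_def J_def)
  have Qpos: "Q s > 0" if "s \<in> {\<theta>w<..\<theta>b}" for s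
    using \<theta>w(2)[of s] that \<theta>wJ by (force simp: bad_def J_def)
  note bw = bounds[OF Qpos \<theta>wJ]
  have "L \<theta>w > 0"
  proof -
    have "0 < L \<theta>w * sin \<theta>w" using bw Lb sinb by (smt (verit) mult_pos_pos)
    then show ?thesis using sinJ[OF \<theta>wJ] by (simp add: zero_less_mult_iff)
  qed
  then have w\<theta>w: "w \<theta>w = 0" using bw \<theta>w(1) by (auto simp: bad_def Q_def min_le_iff_disj)
  have "(w \<longlongrightarrow> w \<theta>w) (at \<theta>w within {\<theta>w..\<theta>b})"
    using cw sub[OF \<theta>wJ] by (auto simp: continuous_on_def intro: tendsto_within_subset \<theta>wJ)
  then have lim: "(w \<longlongrightarrow> 0) (at_right \<theta>w)"
    using \<theta>w_less w\<theta>w by (simp add: at_within_Icc_at_right)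
  show ?thesis
  proof (rule that[of \<theta>w u w \<rho> r])
    show "0 < \<theta>w" using \<theta>wJ \<epsilon> by (simp add: J_def)
    show "compressive_branch \<gamma> A \<kappa> {\<theta>w<..\<theta>b} u w \<rho> r"
      unfolding compressive_branch_def
    proof
      fix \<theta> assume \<theta>: "\<theta> \<in> {\<theta>w<..\<theta>b}"
      have \<theta>J: "\<theta> \<in> J" using \<theta> \<theta>wJ by (auto simp: J_def)
      have sub': "{\<theta>w<..\<theta>b} \<subseteq> J" using \<theta>wJ by (auto simp: J_def)
      have "w \<theta> > 0" using Qpos[OF \<theta>] by (simp add: Q_def)
      moreover have "\<rho> \<theta> > 0" using \<rho>_ge[OF \<theta>J] pos by simp
      ultimately show "w \<theta> > 0 \<and> \<rho> \<theta> > 0 \<and> (w \<theta>)\<^sup>2 < \<gamma> * A * \<rho> \<theta> powr (\<gamma> - 1) \<and>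
        r \<theta> = w \<theta> * (u \<theta> - cot \<theta> * (w \<theta> + \<kappa> * \<rho> \<theta> / sin \<theta>)) / (\<gamma> * A * \<rho> \<theta> powr (\<gamma> - 1) - (w \<theta>)\<^sup>2) \<and>
        (u has_real_derivative - (w \<theta> + \<kappa> * \<rho> \<theta> / sin \<theta>)) (at \<theta> within {\<theta>w<..\<theta>b}) \<and>
        (w has_real_derivative 2 * u \<theta> - w \<theta> * cot \<theta> + w \<theta> * r \<theta>) (at \<theta> within {\<theta>w<..\<theta>b}) \<and>
        (\<rho> has_real_derivative - (\<rho> \<theta> * r \<theta>)) (at \<theta> within {\<theta>w<..\<theta>b})"
        using exact[OF Qpos \<theta>wJ \<theta>] sub'
        by (auto simp: r_def L_def Z_def X_def intro: DERIV_subset)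
    qed
  qed (use \<theta>w_less init lim in auto)
qed

section \<open>The flow equations\<close>

lemma interval_limit_point:
  fixes I :: "real set"
  assumes "connected I" "a \<in> I" "b \<in> I" "a < b" "x \<in> I"
  shows "at x within I \<noteq> bot"
proof -
  have "x islimpt I"
    using assms by (intro connected_imp_perfect) auto
  then show ?thesis by (simp add: trivial_limit_within)
qed

lemma smooth_fun_on_deriv_on:
  assumes "smooth_fun_on I f" "x \<in> I" "at x within I \<noteq> bot"
  shows "(f has_real_derivative deriv_on I f x) (at x within I)"
proof -
  from assms obtain d where "(f has_real_derivative d) (at x within I)"
    unfolding smooth_fun_on_def by metis
  then have "(f has_vector_derivative d) (at x within I)"
    by (simp add: has_real_derivative_iff_has_vector_derivative)
  then show ?thesis
    unfolding deriv_on_def has_real_derivative_iff_has_vector_derivative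
    using vector_derivative_within[OF assms(3)] by metis
qed

lemma deriv_on_eqI:
  assumes "(f has_real_derivative d) (at x within I)" "at x within I \<noteq> bot"
  shows "deriv_on I f x = d"
  using assms unfolding deriv_on_def has_real_derivative_iff_has_vector_derivative
  by (intro vector_derivative_within)

lemma pressure_derivative:
  assumes "(density W has_real_derivative d\<rho>) (at x within I)"
    "(entropy W has_real_derivative dA) (at x within I)" "density W x > 0"
  shows "(pressure \<gamma> W has_real_derivative
     density W x * (dA * density W x powr (\<gamma> - 1)
       + \<gamma> * entropy W x * density W x powr (\<gamma> - 1) * (d\<rho> / density W x))) (at x within I)"
proof -
  have "(pressure \<gamma> W has_real_derivative
     dA * density W x powr \<gamma> + \<gamma> * density W x powr \<gamma> * (d\<rho> / density W x) * entropy W x) (at x within I)"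
    unfolding pressure_def
    by (rule DERIV_mult[OF assms(2) powr_log_derivative[OF assms(1,3)], THEN DERIV_cong]) simp
  moreover have "density W x powr \<gamma> = density W x * density W x powr (\<gamma> - 1)"
    using assms(3) by (simp add: powr_diff)
  ultimately show ?thesis using assms(3) by (simp add: algebra_simps)
qed

text \<open>
  The quotient of the pressure gradient by the density is expanded here once, so that later arguments see
  only the squared speed of sound \<open>\<gamma> * entropy * density powr (\<gamma> - 1)\<close>.
\<close>

lemma conic_flow_equations:
  fixes W I \<gamma>
  assumes flow: "conic_flow_on \<gamma> I W" and x: "x \<in> I" and lim: "at x within I \<noteq> bot"
  defines "d\<rho> \<equiv> deriv_on I (density W)" and "du \<equiv> deriv_on I (U1 W)" and "dv \<equiv> deriv_on I (U2 W)"
    and "dz \<equiv> deriv_on I (U3 W)" and "dA \<equiv> deriv_on I (entropy W)"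
  shows "density W x > 0"
    and "(density W has_real_derivative d\<rho> x) (at x within I)"
    and "(U1 W has_real_derivative du x) (at x within I)"
    and "(U2 W has_real_derivative dv x) (at x within I)"
    and "(U3 W has_real_derivative dz x) (at x within I)"
    and "(entropy W has_real_derivative dA x) (at x within I)"
    and "d\<rho> x * U2 W x + density W x * dv x + 2 * density W x * U1 W x + cot x * density W x * U2 W x = 0"
    and "U2 W x * du x = (U2 W x)\<^sup>2 + (U3 W x)\<^sup>2"
    and "U2 W x * dv x + (dA x * density W x powr (\<gamma> - 1)
       + \<gamma> * entropy W x * density W x powr (\<gamma> - 1) * (d\<rho> x / density W x))
       + U1 W x * U2 W x - (U3 W x)\<^sup>2 * cot x = 0"
    and "U2 W x * dz x + U1 W x * U3 W x + U2 W x * U3 W x * cot x = 0"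
    and "U2 W x * dA x = 0"
proof -
  have sm: "smooth_flow_on I W" and rho: "density W x > 0" and eu: "conic_euler_on \<gamma> I W"
    using flow x by (auto simp: conic_flow_on_def)
  note D = smooth_fun_on_deriv_on[OF _ x lim]
  show rho: "density W x > 0" by fact
  show d\<rho>: "(density W has_real_derivative d\<rho> x) (at x within I)"
    and "(U1 W has_real_derivative du x) (at x within I)"
    and dv: "(U2 W has_real_derivative dv x) (at x within I)"
    and "(U3 W has_real_derivative dz x) (at x within I)"
    and dA: "(entropy W has_real_derivative dA x) (at x within I)"
    using sm unfolding smooth_flow_on_def d\<rho>_def du_def dv_def dz_def dA_def by (auto intro: D)
  have "deriv_on I (\<lambda>s. density W s * U2 W s) x = d\<rho> x * U2 W x + dv x * density W x"
    by (intro deriv_on_eqI[OF _ lim] DERIV_mult d\<rho> dv)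
  then show "d\<rho> x * U2 W x + density W x * dv x + 2 * density W x * U1 W x + cot x * density W x * U2 W x = 0"
    using eu x by (auto simp: conic_euler_on_def mult_ac)
  have "deriv_on I (pressure \<gamma> W) x = density W x * (dA x * density W x powr (\<gamma> - 1)
       + \<gamma> * entropy W x * density W x powr (\<gamma> - 1) * (d\<rho> x / density W x))"
    by (intro deriv_on_eqI[OF _ lim] pressure_derivative d\<rho> dA rho)
  then have "1 / density W x * deriv_on I (pressure \<gamma> W) x = dA x * density W x powr (\<gamma> - 1)
       + \<gamma> * entropy W x * density W x powr (\<gamma> - 1) * (d\<rho> x / density W x)" using rho by simp
  then show "U2 W x * dv x + (dA x * density W x powr (\<gamma> - 1)
       + \<gamma> * entropy W x * density W x powr (\<gamma> - 1) * (d\<rho> x / density W x))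
       + U1 W x * U2 W x - (U3 W x)\<^sup>2 * cot x = 0"
    using eu x unfolding conic_euler_on_def dv_def by metis
  show "U2 W x * du x = (U2 W x)\<^sup>2 + (U3 W x)\<^sup>2"
    "U2 W x * dz x + U1 W x * U3 W x + U2 W x * U3 W x * cot x = 0" "U2 W x * dA x = 0"
    using eu x unfolding conic_euler_on_def du_def dz_def dA_def by auto
qed

text \<open>
  Using \<open>\<gamma> - 1\<close> as the exponent exhibits the squared speed of sound.
\<close>

lemma bernoulli_alt:
  assumes "density W x > 0"
  shows "bernoulli \<gamma> W x = (1/2) * ((U1 W x)\<^sup>2 + (U2 W x)\<^sup>2 + (U3 W x)\<^sup>2)
     + \<gamma> * entropy W x * density W x powr (\<gamma> - 1) / (\<gamma> - 1)"
proof -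
  have "density W x powr \<gamma> = density W x * density W x powr (\<gamma> - 1)"
    using assms by (simp add: powr_diff)
  then show ?thesis using assms by (simp add: bernoulli_def pressure_def)
qed

text \<open>
  Each ray carries matter across itself where \<open>U2 \<noteq> 0\<close>. There the entropy is transported, and the energy
  balance follows by multiplying the three momentum equations by the velocity components.
\<close>

lemma entropy_bernoulli_constant:
  assumes flow: "conic_flow_on \<gamma> I W" and \<gamma>: "\<gamma> > 1"
    and I: "\<And>x. x \<in> I \<Longrightarrow> at x within I \<noteq> bot"
    and S: "convex S" "S \<subseteq> I" and U2: "\<And>x. x \<in> S \<Longrightarrow> U2 W x \<noteq> 0"
    and xy: "x \<in> S" "y \<in> S"
  shows "entropy W x = entropy W y" and "bernoulli \<gamma> W x = bernoulli \<gamma> W y"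
proof -
  have cancel: "\<gamma> / (\<gamma> - 1) * (0 * a + (\<gamma> - 1) * R * q * A) = \<gamma> * A * R * q" for a R q A
    using \<gamma> by (simp add: field_simps)
  have "(entropy W has_real_derivative 0) (at t within S)
      \<and> (bernoulli \<gamma> W has_real_derivative 0) (at t within S)" if t: "t \<in> S" for t
  proof -
    have tI: "t \<in> I" using t S by auto
    note E = conic_flow_equations[OF flow tI I[OF tI]]
    let ?\<rho> = "density W t" and ?u = "U1 W t" and ?v = "U2 W t" and ?z = "U3 W t" and ?A = "entropy W t"
    let ?d\<rho> = "deriv_on I (density W) t" and ?du = "deriv_on I (U1 W) t" and ?dv = "deriv_on I (U2 W) t"
      and ?dz = "deriv_on I (U3 W) t"
    have dA: "deriv_on I (entropy W) t = 0" using E(11) U2[OF t] by simp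
    have "((\<lambda>s. (1/2) * ((U1 W s)\<^sup>2 + (U2 W s)\<^sup>2 + (U3 W s)\<^sup>2)
        + \<gamma> / (\<gamma> - 1) * (entropy W s * density W s powr (\<gamma> - 1))) has_real_derivative
        (1/2) * (2 * ?u * ?du + 2 * ?v * ?dv + 2 * ?z * ?dz)
        + \<gamma> / (\<gamma> - 1) * (0 * ?\<rho> powr (\<gamma> - 1) + (\<gamma> - 1) * ?\<rho> powr (\<gamma> - 1) * (?d\<rho> / ?\<rho>) * ?A)) (at t within I)"
      using E(3-5) E(6)[unfolded dA] powr_log_derivative[OF E(2,1), of "\<gamma> - 1"]
      by (intro DERIV_add DERIV_cmult DERIV_mult) (auto intro!: derivative_eq_intros)
    also have "(1/2) * (2 * ?u * ?du + 2 * ?v * ?dv + 2 * ?z * ?dz)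
        + \<gamma> / (\<gamma> - 1) * (0 * ?\<rho> powr (\<gamma> - 1) + (\<gamma> - 1) * ?\<rho> powr (\<gamma> - 1) * (?d\<rho> / ?\<rho>) * ?A)
        = ?u * ?du + ?v * ?dv + ?z * ?dz + \<gamma> * ?A * ?\<rho> powr (\<gamma> - 1) * (?d\<rho> / ?\<rho>)"
      unfolding cancel by (simp add: algebra_simps)
    also have "\<dots> = 0"
    proof -
      have "?v * (?u * ?du + ?v * ?dv + ?z * ?dz + \<gamma> * ?A * ?\<rho> powr (\<gamma> - 1) * (?d\<rho> / ?\<rho>))
          = ?u * (?v * ?du) + ?z * (?v * ?dz) + ?v * (?v * ?dv + \<gamma> * ?A * ?\<rho> powr (\<gamma> - 1) * (?d\<rho> / ?\<rho>))"
        by (simp add: algebra_simps)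
      also have "?v * ?dz = - ?u * ?z - ?v * ?z * cot t" using E(10) by simp
      also have "?v * ?dv + \<gamma> * ?A * ?\<rho> powr (\<gamma> - 1) * (?d\<rho> / ?\<rho>) = ?z\<^sup>2 * cot t - ?u * ?v"
        using E(9) unfolding dA by simp
      finally have "?v * (?u * ?du + ?v * ?dv + ?z * ?dz + \<gamma> * ?A * ?\<rho> powr (\<gamma> - 1) * (?d\<rho> / ?\<rho>)) = 0"
        unfolding E(8) by (simp add: algebra_simps power2_eq_square)
      then show ?thesis using U2[OF t] by simp
    qed
    finally have "((\<lambda>s. (1/2) * ((U1 W s)\<^sup>2 + (U2 W s)\<^sup>2 + (U3 W s)\<^sup>2)
        + \<gamma> / (\<gamma> - 1) * (entropy W s * density W s powr (\<gamma> - 1))) has_real_derivative 0) (at t within S)"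
      by (rule DERIV_subset[OF _ S(2)])
    then have "(bernoulli \<gamma> W has_real_derivative 0) (at t within S)"
    proof (rule has_field_derivative_transform_within[where d=1])
      fix s assume "s \<in> S"
      then have "density W s > 0" using S flow by (auto simp: conic_flow_on_def)
      then show "(1/2) * ((U1 W s)\<^sup>2 + (U2 W s)\<^sup>2 + (U3 W s)\<^sup>2)
        + \<gamma> / (\<gamma> - 1) * (entropy W s * density W s powr (\<gamma> - 1)) = bernoulli \<gamma> W s"
        by (simp add: bernoulli_alt)
    qed (use t in auto)
    then show ?thesis using DERIV_subset[OF E(6) S(2)] dA by simp
  qed
  then show "entropy W x = entropy W y" "bernoulli \<gamma> W x = bernoulli \<gamma> W y"
    using has_field_derivative_zero_constant[OF S(1), of "entropy W"]
      has_field_derivative_zero_constant[OF S(1), of "bernoulli \<gamma> W"] xy by metis+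
qed

section \<open>Swirl and stagnation\<close>

text \<open>
  Continuity and the angular momentum equation. They have the same shape: the flux
  \<open>density * U2 * sin\<close> has logarithmic derivative \<open>- 2 * U1 / U2\<close>, and \<open>U3 * sin\<close> has half of it.
\<close>

lemma swirl_flux_derivatives:
  assumes flow: "conic_flow_on \<gamma> I W" and x: "x \<in> I" "at x within I \<noteq> bot" "sin x \<noteq> 0"
  defines "dV \<equiv> deriv_on I (U3 W) x * sin x + cos x * U3 W x"
  shows "((\<lambda>s. density W s * U2 W s * sin s) has_real_derivative - 2 * density W x * U1 W x * sin x) (at x within I)"
    and "((\<lambda>s. U3 W s * sin s) has_real_derivative dV) (at x within I)"
    and "U2 W x * dV = - U1 W x * (U3 W x * sin x)"
proof -
  note E = conic_flow_equations[OF flow x(1,2)]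
  let ?\<rho> = "density W x" and ?u = "U1 W x" and ?v = "U2 W x" and ?z = "U3 W x"
  have cs: "cot x * sin x = cos x" using x by (simp add: cot_def)
    have "((\<lambda>s. density W s * U2 W s * sin s) has_real_derivative
        (deriv_on I (density W) x * ?v + deriv_on I (U2 W) x * ?\<rho>) * sin x + cos x * (?\<rho> * ?v)) (at x within I)"
      by (intro DERIV_mult E has_field_derivative_at_within[OF DERIV_sin])
    also have "(deriv_on I (density W) x * ?v + deriv_on I (U2 W) x * ?\<rho>) * sin x + cos x * (?\<rho> * ?v)
        = (deriv_on I (density W) x * ?v + ?\<rho> * deriv_on I (U2 W) x + cot x * ?\<rho> * ?v) * sin x"
      unfolding cs[symmetric] by (simp add: algebra_simps)
    also have "deriv_on I (density W) x * ?v + ?\<rho> * deriv_on I (U2 W) x + cot x * ?\<rho> * ?v = - 2 * ?\<rho> * ?u"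
      using E(7) by simp
    finally show "((\<lambda>s. density W s * U2 W s * sin s) has_real_derivative - 2 * ?\<rho> * ?u * sin x) (at x within I)" .
    show "((\<lambda>s. U3 W s * sin s) has_real_derivative dV) (at x within I)" unfolding dV_def
      by (intro DERIV_mult E has_field_derivative_at_within[OF DERIV_sin])
    have "?v * (deriv_on I (U3 W) x * sin x + cos x * ?z) = (?v * deriv_on I (U3 W) x + ?v * ?z * cot x) * sin x"
      unfolding cs[symmetric] by (simp add: algebra_simps)
    also have "?v * deriv_on I (U3 W) x + ?v * ?z * cot x = - ?u * ?z" using E(10) by simp
    finally show "?v * dV = - ?u * (?z * sin x)" by (simp add: dV_def)
qed

lemma swirl_over_flux_constant:
  assumes flow: "conic_flow_on \<gamma> I W" and I: "\<And>x. x \<in> I \<Longrightarrow> at x within I \<noteq> bot" "I \<subseteq> {0<..<pi}"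
    and S: "convex S" "S \<subseteq> I" and U2: "\<And>x. x \<in> S \<Longrightarrow> U2 W x \<noteq> 0"
  shows "\<exists>C. \<forall>x\<in>S. (U3 W x * sin x)\<^sup>2 = C * (density W x * U2 W x * sin x)"
proof -
  have "((\<lambda>s. (U3 W s * sin s)\<^sup>2 / (density W s * U2 W s * sin s)) has_real_derivative 0) (at x within S)"
    if x: "x \<in> S" for x
  proof -
    have xI: "x \<in> I" using x S by auto
    then have s: "sin x > 0" using I(2) sin_gt_zero[of x] by auto
    have \<rho>: "density W x > 0" using flow xI by (simp add: conic_flow_on_def)
    define dV where "dV = deriv_on I (U3 W) x * sin x + cos x * U3 W x"
    note d = swirl_flux_derivatives[OF flow xI I(1)[OF xI] less_imp_neq[OF s, THEN not_sym], folded dV_def]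
    let ?F = "density W x * U2 W x * sin x" and ?V = "U3 W x * sin x"
    have ne: "?F \<noteq> 0" using \<rho> s U2[OF x] by simp
    have "((\<lambda>s. (U3 W s * sin s) * (U3 W s * sin s) / (density W s * U2 W s * sin s)) has_real_derivative
        ((dV * ?V + dV * ?V) * ?F - ?V * ?V * (- 2 * density W x * U1 W x * sin x)) / (?F * ?F)) (at x within I)"
      by (intro DERIV_divide DERIV_mult d ne)
    also have "(dV * ?V + dV * ?V) * ?F - ?V * ?V * (- 2 * density W x * U1 W x * sin x)
        = 2 * density W x * sin x * ?V * (U2 W x * dV + U1 W x * ?V)"
      by (simp add: algebra_simps)
    also have "\<dots> = 0" using d(3) by simp
    finally show ?thesis using DERIV_subset[OF _ S(2)] by (simp add: power2_eq_square)
  qed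
  from has_field_derivative_zero_constant[OF S(1) this]
  obtain C where C: "\<And>x. x \<in> S \<Longrightarrow> (U3 W x * sin x)\<^sup>2 / (density W x * U2 W x * sin x) = C"
    by auto
  show ?thesis
  proof (intro exI ballI)
    fix x assume x: "x \<in> S"
    then have xI: "x \<in> I" using S by auto
    then have "density W x > 0" "sin x > 0"
      using flow I(2) sin_gt_zero[of x] by (auto simp: conic_flow_on_def)
    then show "(U3 W x * sin x)\<^sup>2 = C * (density W x * U2 W x * sin x)"
      using C[OF x] U2[OF x] by (auto simp: field_simps)
  qed
qed

text \<open>
  If \<open>U2\<close> vanishes at an endpoint, then so does \<open>V = U3 * sin\<close>, and \<open>V\<^sup>2 = C * F\<close> with the flux
  \<open>F = density * U2 * sin\<close>. Suppose \<open>C \<noteq> 0\<close>. Then \<open>F\<close> has a double zero, which puts \<open>U1 = 0\<close> there.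
  But \<open>C * U1\<close> is strictly increasing, since \<open>U2 * U1' = U2\<^sup>2 + U3\<^sup>2\<close> and \<open>C * U2 > 0\<close>; together with
  \<open>F' = - 2 * density * U1 * sin\<close> this makes \<open>C * F\<close> negative on either side of its zero, and
  \<open>C * F\<close> is a square.
\<close>

lemma no_swirl_near_stagnation:
  assumes flow: "conic_flow_on \<gamma> I W" and I: "\<And>x. x \<in> I \<Longrightarrow> at x within I \<noteq> bot" "I \<subseteq> {0<..<pi}"
    and pq: "p < q" "{p..q} \<subseteq> I" and e: "e = p \<or> e = q" "U2 W e = 0"
    and U2: "\<And>x. x \<in> {p..q} - {e} \<Longrightarrow> U2 W x \<noteq> 0"
    and x: "x \<in> {p..q} - {e}"
  shows "U3 W x = 0"
proof (rule ccontr)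
  assume Vx: "U3 W x \<noteq> 0"
  define F where "F s = density W s * U2 W s * sin s" for s
  define V where "V s = U3 W s * sin s" for s
  have conv: "convex ({p..q} - {e})"
  proof -
    have "{p..q} - {e} = {p<..q} \<or> {p..q} - {e} = {p..<q}" using e(1) by auto
    then show ?thesis by (elim disjE) (simp_all only: convex_real_interval)
  qed
  have "{p..q} - {e} \<subseteq> I" using pq(2) by auto
  from swirl_over_flux_constant[OF flow I conv this U2]
  obtain C where C: "\<And>x. x \<in> {p..q} - {e} \<Longrightarrow> (V x)\<^sup>2 = C * F x"
    unfolding V_def F_def by blast
  have pos: "sin s > 0" "density W s > 0" "s \<in> I" if "s \<in> {p..q}" for s
  proof -
    show "s \<in> I" using that pq by auto
    then show "sin s > 0" "density W s > 0"
      using I(2) flow sin_gt_zero[of s] by (auto simp: conic_flow_on_def)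
  qed
  have eI: "e \<in> {p..q}" using e(1) pq by auto
  have Ve: "V e = 0" using conic_flow_equations(8)[OF flow pos(3)[OF eI] I(1)[OF pos(3)[OF eI]]] e(2)
    by (simp add: V_def)
  have Fe: "F e = 0" by (simp add: F_def e)
  have VC: "(V s)\<^sup>2 = C * F s" if "s \<in> {p..q}" for s
    using C[of s] that Ve Fe by (cases "s = e") auto
  have C0: "C \<noteq> 0" using C[OF x] Vx pos[of x] x by (auto simp: V_def)
  have dF: "(F has_real_derivative - 2 * density W s * U1 W s * sin s) (at s within {p..q})" if "s \<in> {p..q}" for s
    unfolding F_def
    using swirl_flux_derivatives(1)[OF flow pos(3)[OF that] I(1)[OF pos(3)[OF that]]] pos(1)[OF that]
    by (intro DERIV_subset[OF _ pq(2)]) simp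
  have du: "(U1 W has_real_derivative deriv_on I (U1 W) s) (at s within {p..q})" if "s \<in> {p..q}" for s
    using conic_flow_equations(3)[OF flow pos(3)[OF that] I(1)[OF pos(3)[OF that]]]
    by (rule DERIV_subset[OF _ pq(2)])
  have at: "at s within {p..q} = at s" if "p < s" "s < q" for s by (rule at_within_Icc_at[OF that])
  have ue: "U1 W e = 0"
  proof -
    define dV where "dV = deriv_on I (U3 W) e * sin e + cos e * U3 W e"
    have "(V has_real_derivative dV) (at e within I)"
      using swirl_flux_derivatives(2)[OF flow pos(3)[OF eI] I(1)[OF pos(3)[OF eI]]] pos(1)[OF eI]
      unfolding V_def dV_def by simp
    then have dV: "(V has_real_derivative dV) (at e within {p..q})"
      by (rule DERIV_subset[OF _ pq(2)])
    have "((\<lambda>s. V s * V s - C * F s) has_real_derivative dV * V e + dV * V e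
        - C * (- 2 * density W e * U1 W e * sin e)) (at e within {p..q})"
      by (intro DERIV_diff DERIV_mult DERIV_cmult dV dF eI)
    moreover have "((\<lambda>s. V s * V s - C * F s) has_real_derivative 0) (at e within {p..q})"
      by (rule has_field_derivative_transform_within[where f="\<lambda>s. 0" and d=1])
        (use VC eI in \<open>auto simp: power2_eq_square\<close>)
    moreover have "at e within {p..q} \<noteq> bot"
      using eI pq by (intro interval_limit_point[of _ p q]) auto
    ultimately have "dV * V e + dV * V e - C * (- 2 * density W e * U1 W e * sin e) = 0"
      unfolding has_real_derivative_iff_has_vector_derivative
      by (intro vector_derivative_unique_within)
    then show ?thesis using Ve C0 pos[OF eI] by simp
  qed
  have cF: "continuous_on {p..q} (\<lambda>s. C * F s)" and cu: "continuous_on {p..q} (\<lambda>s. C * U1 W s)"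
    using DERIV_continuous_on[OF dF] DERIV_continuous_on[OF du] by (auto intro!: continuous_intros)
  have CF: "C * F s > 0" if "s \<in> {p..q}" "s \<noteq> e" for s
  proof -
    have "C * F s \<noteq> 0" using U2[of s] pos[OF that(1)] C0 that by (simp add: F_def)
    then show ?thesis using VC[OF that(1)] by (metis less_eq_real_def zero_le_power2)
  qed
  have u_incr: "C * U1 W a < C * U1 W b" if ab: "p \<le> a" "a < b" "b \<le> q" for a b
  proof (rule DERIV_pos_imp_increasing_open[OF ab(2)])
    fix s assume s: "a < s" "s < b"
    then have s': "p < s" "s < q" "s \<in> {p..q}" "s \<noteq> e" using ab e(1) by auto
    have "C * F s = C * U2 W s * (density W s * sin s)" by (simp add: F_def)
    with CF[OF s'(3,4)] mult_pos_pos[OF pos(2,1), OF s'(3,3)] have v0: "C * U2 W s > 0"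
      by (simp only: zero_less_mult_pos2)
    have v1: "U2 W s \<noteq> 0" using v0 by auto
    have "U2 W s * (C * deriv_on I (U1 W) s) = C * ((U2 W s)\<^sup>2 + (U3 W s)\<^sup>2)"
      using conic_flow_equations(8)[OF flow pos(3)[OF s'(3)] I(1)[OF pos(3)[OF s'(3)]]] by simp
    then have "C * deriv_on I (U1 W) s = C * U2 W s * (1 + (U3 W s / U2 W s)\<^sup>2)"
      using v1 by (simp add: field_simps power2_eq_square)
    also have "\<dots> > 0" by (rule mult_pos_pos[OF v0]) (auto intro: add_pos_nonneg)
    finally have "C * deriv_on I (U1 W) s > 0" .
    moreover have "((\<lambda>s. C * U1 W s) has_real_derivative C * deriv_on I (U1 W) s) (at s)"
      using DERIV_cmult[OF du[OF s'(3)]] at[OF s'(1,2)] by simp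
    ultimately show "\<exists>y. ((\<lambda>s. C * U1 W s) has_real_derivative y) (at s) \<and> 0 < y" by blast
  qed (rule continuous_on_subset[OF cu], use ab in auto)
  have dCF: "((\<lambda>s. C * F s) has_real_derivative - 2 * density W s * sin s * (C * U1 W s)) (at s)"
    if s: "p < s" "s < q" for s
    using DERIV_cmult[OF dF[of s], of C] at[OF s] s by (simp add: mult_ac)
  show False
  proof (cases "e = p")
    case True
    have "C * F q < C * F p"
    proof (rule DERIV_neg_imp_decreasing_open[OF pq(1) _ cF])
      fix s assume s: "p < s" "s < q"
      have "C * U1 W s > 0" using u_incr[of p s] s ue True by simp
      then have "- 2 * density W s * sin s * (C * U1 W s) < 0" using pos[of s] s by (simp add: mult_pos_pos)
      then show "\<exists>y. ((\<lambda>s. C * F s) has_real_derivative y) (at s) \<and> y < 0" using dCF[OF s] by blast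
    qed
    then show False using CF[of q] Fe True pq by simp
  next
    case False
    then have eq: "e = q" using e by auto
    have "C * F p < C * F q"
    proof (rule DERIV_pos_imp_increasing_open[OF pq(1) _ cF])
      fix s assume s: "p < s" "s < q"
      have "C * U1 W s < 0" using u_incr[of s q] s ue eq by simp
      then have "- 2 * density W s * sin s * (C * U1 W s) > 0" using pos[of s] s
        by (simp add: mult_pos_neg)
      then show "\<exists>y. ((\<lambda>s. C * F s) has_real_derivative y) (at s) \<and> 0 < y" using dCF[OF s] by blast
    qed
    then show False using CF[of p] Fe eq pq by simp
  qed
qed

text \<open>
  The previous lemma is applied between \<open>x\<close> and the zero of \<open>U2\<close> nearest to it.
\<close>

lemma no_swirl_with_stagnation:
  assumes flow: "conic_flow_on \<gamma> I W" and I: "\<And>x. x \<in> I \<Longrightarrow> at x within I \<noteq> bot" "I \<subseteq> {0<..<pi}" "is_interval I"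
    and b: "b \<in> I" "U2 W b = 0" and x: "x \<in> I"
  shows "U3 W x = 0"
proof (cases "U2 W x = 0")
  case True
  then show ?thesis using conic_flow_equations(8)[OF flow x I(1)[OF x]] by simp
next
  case False
  have sub: "{min b x..max b x} \<subseteq> I"
  proof
    fix y assume y: "y \<in> {min b x..max b x}"
    show "y \<in> I"
    proof (cases "b \<le> x")
      case True
      then show ?thesis using y by (intro mem_is_interval_1_I[OF I(3) b(1) x]) auto
    next
      case False
      then show ?thesis using y by (intro mem_is_interval_1_I[OF I(3) x b(1)]) auto
    qed
  qed
  have "continuous_on I (U2 W)"
    using conic_flow_equations(4)[OF flow _ I(1)] by (intro DERIV_continuous_on) auto
  then have c: "continuous_on {min b x..max b x} (U2 W)" by (rule continuous_on_subset[OF _ sub])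
  define Y where "Y = {s \<in> {min b x..max b x}. U2 W s = 0}"
  have "Y = {min b x..max b x} \<inter> U2 W -` {0}" by (auto simp: Y_def)
  then have "closed Y" using continuous_closed_preimage[OF c, of "{0}"] by simp
  moreover have "bounded Y" by (rule bounded_subset[of "{min b x..max b x}"]) (auto simp: Y_def)
  ultimately have "compact Y" by (simp add: compact_eq_bounded_closed)
  have bY: "b \<in> Y" using b by (simp add: Y_def)
  have xY: "x \<notin> Y" using False by (simp add: Y_def)
  show ?thesis
  proof (cases "b < x")
    case True
    obtain e where e: "e \<in> Y" "\<And>y. y \<in> Y \<Longrightarrow> y \<le> e"
      using compact_attains_sup[OF \<open>compact Y\<close>] bY by auto
    have ex: "e < x" "b \<le> e" using e xY bY True by (force simp: Y_def)+
    show ?thesis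
    proof (rule no_swirl_near_stagnation[OF flow I(1,2), of e x e])
      show "{e..x} \<subseteq> I" using sub ex by (auto simp: subset_iff)
      show "U2 W y \<noteq> 0" if "y \<in> {e..x} - {e}" for y
        using e(2)[of y] that ex by (auto simp: Y_def)
    qed (use e ex in \<open>auto simp: Y_def\<close>)
  next
    case False
    then have "x < b" using bY xY by (metis linorder_less_linear)
    obtain e where e: "e \<in> Y" "\<And>y. y \<in> Y \<Longrightarrow> e \<le> y"
      using compact_attains_inf[OF \<open>compact Y\<close>] bY by auto
    have ex: "x < e" "e \<le> b" using e xY bY \<open>x < b\<close> by (force simp: Y_def)+
    show ?thesis
    proof (rule no_swirl_near_stagnation[OF flow I(1,2), of x e e])
      show "{x..e} \<subseteq> I" using sub ex by (auto simp: subset_iff)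
      show "U2 W y \<noteq> 0" if "y \<in> {x..e} - {e}" for y
        using e(2)[of y] that ex by (auto simp: Y_def)
    qed (use e ex in \<open>auto simp: Y_def\<close>)
  qed
qed

text \<open>
  Either \<open>U2\<close> vanishes somewhere before the cone, and there is no swirl at all, or
  \<open>(U3 * sin)\<^sup>2\<close> is a constant multiple of the flux, which tends to zero because Bernoulli's law bounds the
  density.
\<close>

lemma swirl_vanishes_at_cone:
  assumes flow: "conic_flow_on \<gamma> {\<theta>w<..\<theta>b} W" and \<gamma>: "\<gamma> > 1" and \<theta>: "0 < \<theta>w" "\<theta>w < \<theta>b" "\<theta>b < pi"
    and A: "entropy W \<theta>b > 0" and lim: "(U2 W \<longlongrightarrow> 0) (at_right \<theta>w)"
  shows "(U3 W \<longlongrightarrow> 0) (at_right \<theta>w)"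
proof -
  define I where "I = {\<theta>w<..\<theta>b}"
  have flow: "conic_flow_on \<gamma> I W" using flow by (simp add: I_def)
  have Ibot: "at x within I \<noteq> bot" if "x \<in> I" for x
    using that \<theta> by (intro interval_limit_point[of I "(\<theta>w + \<theta>b) / 2" \<theta>b])
      (auto simp: I_def intro: convex_connected convex_real_interval)
  have Ipi: "I \<subseteq> {0<..<pi}" using \<theta> by (auto simp: I_def)
  have conv: "convex I" by (simp add: I_def convex_real_interval)
  have ev: "\<forall>\<^sub>F x in at_right \<theta>w. x \<in> I"
    using \<theta> by (auto simp: I_def eventually_at_right_field intro!: exI[of _ \<theta>b])
  show ?thesis
  proof (cases "\<exists>b\<in>I. U2 W b = 0")
    case True
    then obtain b where b: "b \<in> I" "U2 W b = 0" by blast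
    have "U3 W x = 0" if "x \<in> I" for x
      using no_swirl_with_stagnation[OF flow Ibot Ipi _ b that] conv by (simp add: is_interval_convex_1)
    with ev have "\<forall>\<^sub>F x in at_right \<theta>w. U3 W x = 0" by (simp add: eventually_mono)
    then show ?thesis by (rule tendsto_eventually)
  next
    case False
    then have v: "U2 W x \<noteq> 0" if "x \<in> I" for x using that by auto
    have bI: "\<theta>b \<in> I" using \<theta> by (simp add: I_def)
    from swirl_over_flux_constant[OF flow Ibot Ipi conv subset_refl v]
    obtain C where C: "\<And>x. x \<in> I \<Longrightarrow> (U3 W x * sin x)\<^sup>2 = C * (density W x * U2 W x * sin x)"
      by blast
    define M where "M = ((\<gamma> - 1) * bernoulli \<gamma> W \<theta>b / (\<gamma> * entropy W \<theta>b)) powr (1 / (\<gamma> - 1))"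
    have M: "\<bar>density W x\<bar> \<le> M" if x: "x \<in> I" for x
    proof -
      have \<rho>: "density W x > 0" using flow x by (simp add: conic_flow_on_def)
      have "\<gamma> * entropy W \<theta>b * density W x powr (\<gamma> - 1) / (\<gamma> - 1) \<le> bernoulli \<gamma> W x"
        using entropy_bernoulli_constant(1)[OF flow \<gamma> Ibot conv subset_refl v x bI]
        by (simp add: bernoulli_alt[of W x, OF \<rho>])
      also have "\<dots> = bernoulli \<gamma> W \<theta>b"
        by (rule entropy_bernoulli_constant(2)[OF flow \<gamma> Ibot conv subset_refl v x bI])
      finally have "density W x powr (\<gamma> - 1) \<le> (\<gamma> - 1) * bernoulli \<gamma> W \<theta>b / (\<gamma> * entropy W \<theta>b)"
        using \<gamma> A by (simp add: field_simps)
      then have "(density W x powr (\<gamma> - 1)) powr (1 / (\<gamma> - 1)) \<le> M"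
        unfolding M_def using \<gamma> by (intro powr_mono2) auto
      then show ?thesis using \<rho> \<gamma> by (simp add: powr_powr)
    qed
    have l0: "((\<lambda>x. \<bar>C\<bar> * M * \<bar>U2 W x\<bar>) \<longlongrightarrow> \<bar>C\<bar> * M * \<bar>0\<bar>) (at_right \<theta>w)"
      by (intro tendsto_intros lim)
    have "((\<lambda>x. (U3 W x * sin x)\<^sup>2) \<longlongrightarrow> 0) (at_right \<theta>w)"
    proof (rule Lim_null_comparison)
      show "\<forall>\<^sub>F x in at_right \<theta>w. norm ((U3 W x * sin x)\<^sup>2) \<le> \<bar>C\<bar> * M * \<bar>U2 W x\<bar>"
        using ev
      proof eventually_elim
        case (elim x)
        have "norm ((U3 W x * sin x)\<^sup>2) = \<bar>C\<bar> * \<bar>density W x\<bar> * \<bar>U2 W x\<bar> * \<bar>sin x\<bar>"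
          unfolding C[OF elim] by (simp add: abs_mult)
        also have "\<dots> \<le> \<bar>C\<bar> * M * \<bar>U2 W x\<bar> * 1"
          using M[OF elim] by (intro mult_mono) auto
        finally show ?case by simp
      qed
    qed (use l0 in simp)
    then have "((\<lambda>x. sqrt ((U3 W x * sin x)\<^sup>2)) \<longlongrightarrow> sqrt 0) (at_right \<theta>w)"
      by (intro tendsto_intros)
    then have "((\<lambda>x. U3 W x * sin x) \<longlongrightarrow> 0) (at_right \<theta>w)"
      by (simp add: tendsto_rabs_zero_iff)
    moreover have "(sin \<longlongrightarrow> sin \<theta>w) (at_right \<theta>w)"
      by (intro tendsto_intros)
    moreover have s: "sin \<theta>w \<noteq> 0" using sin_gt_zero[of \<theta>w] \<theta> by simp
    ultimately have "((\<lambda>x. U3 W x * sin x / sin x) \<longlongrightarrow> 0 / sin \<theta>w) (at_right \<theta>w)"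
      by (intro tendsto_divide)
    moreover have "\<forall>\<^sub>F x in at_right \<theta>w. U3 W x * sin x / sin x = U3 W x"
      using ev
    proof eventually_elim
      case (elim x)
      then have "sin x > 0" using Ipi sin_gt_zero[of x] by auto
      then show ?case by simp
    qed
    ultimately show ?thesis by (simp add: Lim_transform_eventually)
  qed
qed

text \<open>
  The equations in the variables that decouple the compression. The last identity is the polar momentum
  equation: away from the rays where the polar velocity is sonic it expresses the density gradient
  through \<open>L = U1 - cot * (w + Z)\<close>.
\<close>

lemma transverse_flow_equations:
  fixes \<gamma> J W x
  assumes flow: "conic_flow_on \<gamma> J W" and x: "x \<in> J" "at x within J \<noteq> bot" and moving: "U2 W x < 0"
  defines "w \<equiv> \<lambda>s. - U2 W s" and "Z \<equiv> \<lambda>s. (U3 W s)\<^sup>2 / - U2 W s"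
    and "r \<equiv> deriv_on J (density W) x / density W x"
  shows "deriv_on J (entropy W) x = 0"
    and "(U1 W has_real_derivative - (w x + Z x)) (at x within J)"
    and "(w has_real_derivative 2 * U1 W x - w x * cot x - w x * r) (at x within J)"
    and "(Z has_real_derivative Z x * (r - cot x)) (at x within J)"
    and "((w x)\<^sup>2 - \<gamma> * entropy W x * density W x powr (\<gamma> - 1)) * r = w x * (U1 W x - cot x * (w x + Z x))"
proof -
  note E = conic_flow_equations[OF flow x]
  have w: "w x > 0" using moving by (simp add: w_def)
  have U3: "(U3 W x)\<^sup>2 = w x * Z x" using moving by (simp add: Z_def w_def)
  show dA: "deriv_on J (entropy W) x = 0" using E(11) moving by simp
  have "w x * deriv_on J (U1 W) x = w x * - (w x + Z x)"
    using E(8) U3 by (simp add: w_def algebra_simps power2_eq_square)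
  then have "deriv_on J (U1 W) x = - (w x + Z x)" using w by (metis mult_left_cancel less_irrefl)
  then show "(U1 W has_real_derivative - (w x + Z x)) (at x within J)" using E(3) by simp
  have "density W x * deriv_on J (U2 W) x = density W x * - (2 * U1 W x - w x * cot x - w x * r)"
    using E(7) E(1) by (simp add: w_def r_def algebra_simps)
  then have dv: "deriv_on J (U2 W) x = - (2 * U1 W x - w x * cot x - w x * r)"
    using E(1) by (metis mult_left_cancel less_irrefl)
  have "(w has_real_derivative - deriv_on J (U2 W) x) (at x within J)"
    unfolding w_def by (rule DERIV_minus[OF E(4)])
  then show dw: "(w has_real_derivative 2 * U1 W x - w x * cot x - w x * r) (at x within J)"
    by (simp only: dv minus_minus)
  show "(Z has_real_derivative Z x * (r - cot x)) (at x within J)"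
  proof -
    let ?z = "U3 W x" and ?dz = "deriv_on J (U3 W) x"
    have w0: "w x \<noteq> 0" using w by simp
    have dz: "w x * ?dz = (U1 W x - w x * cot x) * ?z"
      using E(10) by (simp add: w_def algebra_simps)
    have "((\<lambda>s. U3 W s * U3 W s / w s) has_real_derivative ((?dz * ?z + ?dz * ?z) * w x
        - ?z * ?z * (2 * U1 W x - w x * cot x - w x * r)) / (w x * w x)) (at x within J)"
      by (intro DERIV_divide DERIV_mult E(5) dw w0)
    also have "(?dz * ?z + ?dz * ?z) * w x = 2 * ((U1 W x - w x * cot x) * ?z) * ?z"
      by (simp add: dz[symmetric])
    also have "(2 * ((U1 W x - w x * cot x) * ?z) * ?z - ?z * ?z * (2 * U1 W x - w x * cot x - w x * r)) / (w x * w x)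
        = (?z * ?z / w x) * (r - cot x)"
      using w0 by (simp add: field_simps power2_eq_square)
    finally show ?thesis by (simp only: Z_def w_def power2_eq_square)
  qed
  have "- w x * - (2 * U1 W x - w x * cot x - w x * r) + \<gamma> * entropy W x * density W x powr (\<gamma> - 1) * r
      + U1 W x * - w x - w x * Z x * cot x = 0"
    using E(9) unfolding dA dv U3 by (simp add: w_def r_def)
  then show "((w x)\<^sup>2 - \<gamma> * entropy W x * density W x powr (\<gamma> - 1)) * r = w x * (U1 W x - cot x * (w x + Z x))"
    by (simp add: algebra_simps power2_eq_square)
qed

section \<open>Rigidity of the upstream flow\<close>

text \<open>
  A solution of \<open>(t - x) * \<bar>g'\<bar> \<le> N / 2 * \<bar>g\<bar>\<close> can leave zero at \<open>t\<close> only like a power of order at most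
  \<open>N / 2\<close>. Indeed \<open>g\<^sup>2 / (t - x) ^ N\<close> is nondecreasing, and flatness of order \<open>N\<close> makes it tend to zero
  at \<open>t\<close>. For \<open>N = 1\<close> this covers regular points, for large \<open>N\<close> regular singular ones.
\<close>

lemma singular_gronwall:
  fixes g g' :: "real \<Rightarrow> real"
  assumes N: "N \<ge> 1"
    and d: "\<And>x. a < x \<Longrightarrow> x < t \<Longrightarrow> (g has_real_derivative g' x) (at x)"
    and b: "\<And>x. a < x \<Longrightarrow> x < t \<Longrightarrow> 2 * \<bar>g' x\<bar> * (t - x) \<le> real N * \<bar>g x\<bar>"
    and fl: "\<And>x. a < x \<Longrightarrow> x < t \<Longrightarrow> \<bar>g x\<bar> \<le> C * (t - x) ^ N"
    and x: "a < x" "x < t"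
  shows "g x = 0"
proof -
  obtain n where n: "N = Suc n" using N by (cases N) auto
  define h where "h y = (g y)\<^sup>2 / (t - y) ^ N" for y
  have mono: "h x \<le> h y" if y: "x \<le> y" "y < t" for y
  proof (rule DERIV_nonneg_imp_nondecreasing[OF y(1)])
    fix s assume "x \<le> s" "s \<le> y"
    then have s: "a < s" "s < t" using x y by auto
    have "((\<lambda>y. t - y) has_real_derivative - 1) (at s)" by (auto intro!: derivative_eq_intros)
    from DERIV_power[OF this, of N] have p: "((\<lambda>y. (t - y) ^ N) has_real_derivative - (real N * (t - s) ^ n)) (at s)"
      by (simp add: n)
    have g2: "((\<lambda>y. (g y)\<^sup>2) has_real_derivative 2 * g s * g' s) (at s)"
      by (auto intro!: derivative_eq_intros d[OF s])
    have "(h has_real_derivative (2 * g s * g' s * (t - s) ^ N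
        - (g s)\<^sup>2 * (- (real N * (t - s) ^ n))) / ((t - s) ^ N * (t - s) ^ N)) (at s)"
      unfolding h_def using s
      by (intro DERIV_divide p g2) auto
    moreover have "2 * g s * g' s * (t - s) ^ N - (g s)\<^sup>2 * (- (real N * (t - s) ^ n))
        = (t - s) ^ n * (2 * g s * g' s * (t - s) + real N * (g s)\<^sup>2)"
      by (simp add: n algebra_simps)
    moreover have "0 \<le> 2 * g s * g' s * (t - s) + real N * (g s)\<^sup>2"
    proof -
      have "\<bar>2 * g s * g' s * (t - s)\<bar> = \<bar>g s\<bar> * (2 * \<bar>g' s\<bar> * (t - s))"
        using s by (simp add: abs_mult)
      also have "\<dots> \<le> \<bar>g s\<bar> * (real N * \<bar>g s\<bar>)" by (intro mult_left_mono b s) auto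
      also have "\<dots> = real N * (g s)\<^sup>2" by (simp add: power2_eq_square)
      finally show ?thesis by linarith
    qed
    ultimately show "\<exists>d. (h has_real_derivative d) (at s) \<and> 0 \<le> d"
      using s by (intro exI conjI) (assumption, simp)
  qed
  have "h x \<le> C\<^sup>2 * (t - t) ^ N"
  proof (rule tendsto_lowerbound)
    show "((\<lambda>y. C\<^sup>2 * (t - y) ^ N) \<longlongrightarrow> C\<^sup>2 * (t - t) ^ N) (at_left t)"
      by (intro tendsto_intros)
    have "h x \<le> C\<^sup>2 * (t - y) ^ N" if y: "x < y" "y < t" for y
    proof -
      have p: "(t - y) ^ N > 0" using y by simp
      have "(g y)\<^sup>2 \<le> (C * (t - y) ^ N)\<^sup>2"
        using fl[of y] x y by (intro abs_le_square_iff[THEN iffD1]) auto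
      then have "h y \<le> (C * (t - y) ^ N)\<^sup>2 / (t - y) ^ N"
        unfolding h_def using p by (intro divide_right_mono) auto
      also have "\<dots> = C\<^sup>2 * (t - y) ^ N" using p by (simp add: power2_eq_square)
      finally show ?thesis using mono[of y] y by simp
    qed
    then show "\<forall>\<^sub>F y in at_left t. h x \<le> C\<^sup>2 * (t - y) ^ N"
      using x(2) by (auto simp: eventually_at_left_field)
  qed simp
  moreover have "h x \<ge> 0" using x by (simp add: h_def)
  ultimately have "h x = 0" using N by (simp add: n)
  then show ?thesis using x by (simp add: h_def)
qed

lemma flat_bound:
  fixes F :: "nat \<Rightarrow> real \<Rightarrow> real"
  assumes d: "\<And>n x. x \<in> {a..t} \<Longrightarrow> (F n has_real_derivative F (Suc n) x) (at x within {a..t})"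
    and z: "\<And>j. k \<le> j \<Longrightarrow> j < k + N \<Longrightarrow> F j t = 0"
  shows "\<exists>C\<ge>0. \<forall>x\<in>{a..t}. \<bar>F k x\<bar> \<le> C * (t - x) ^ N"
  using z
proof (induction N arbitrary: k)
  case 0
  show ?case
    using continuous_on_compact_abs_bound[OF compact_Icc DERIV_continuous_on[OF d]] by simp
next
  case (Suc N)
  obtain C where C: "C \<ge> 0" "\<And>x. x \<in> {a..t} \<Longrightarrow> \<bar>F (Suc k) x\<bar> \<le> C * (t - x) ^ N"
    using Suc.IH[of "Suc k"] Suc.prems by auto
  have "\<bar>F k x\<bar> \<le> C * (t - x) ^ Suc N" if x: "x \<in> {a..t}" for x
  proof -
    have "norm (F k x - F k t) \<le> C * (t - x) ^ N * norm (x - t)"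
    proof (rule field_differentiable_bound[of "{x..t}" "F k" "F (Suc k)"])
      fix y assume y: "y \<in> {x..t}"
      then have y': "y \<in> {a..t}" using x by auto
      show "(F k has_real_derivative F (Suc k) y) (at y within {x..t})"
        by (rule DERIV_subset[OF d[OF y']]) (use x in auto)
      have "\<bar>F (Suc k) y\<bar> \<le> C * (t - y) ^ N" by (rule C(2)[OF y'])
      also have "\<dots> \<le> C * (t - x) ^ N" using y C(1) by (intro mult_left_mono power_mono) auto
      finally show "norm (F (Suc k) y) \<le> C * (t - x) ^ N" by simp
    qed (use x in auto)
    then show ?thesis using x Suc.prems[of k] by (simp add: mult_ac)
  qed
  then show ?case using C(1) by blast
qed

lemma derivatives_vanish_after_constancy:
  fixes F :: "nat \<Rightarrow> real \<Rightarrow> real"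
  assumes d: "\<And>n x. x \<in> {t..b} \<Longrightarrow> (F n has_real_derivative F (Suc n) x) (at x within {t..b})"
    and tb: "t < b" and z: "\<And>x. x \<in> {t..b} \<Longrightarrow> F 1 x = 0"
    and j: "j \<ge> 1" "x \<in> {t..b}"
  shows "F j x = 0"
  using j(1) j(2)
proof (induction j arbitrary: x rule: dec_induct)
  case base
  then show ?case by (rule z)
next
  case (step n)
  have "(F n has_real_derivative 0) (at x within {t..b})"
    by (rule has_field_derivative_transform_within[where f="\<lambda>s. 0" and d=1])
      (use step in auto)
  moreover have "at x within {t..b} \<noteq> bot"
    using step.prems tb by (intro interval_limit_point[of _ t b]) auto
  ultimately show ?case using d[OF step.prems, of n]
    unfolding has_real_derivative_iff_has_vector_derivative
    by (intro vector_derivative_unique_within)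
qed

text \<open>
  The compression satisfies \<open>m * L' = - cot * (2 * m - (w - Z) * w) * L\<close> with \<open>m = w\<^sup>2 - c\<^sup>2\<close>. If \<open>m t \<noteq> 0\<close>, this is
  a regular linear equation with \<open>L t = 0\<close>. If \<open>m t = 0\<close>, then \<open>t < pi / 2\<close>, where \<open>L t = 0\<close> makes \<open>w\<close>
  strictly increasing while \<open>c\<close> is stationary, so \<open>m\<close> has a simple zero. The density is
  constant above \<open>t\<close>; being smooth, it is flat at \<open>t\<close>, and \<open>w * L = m * r\<close> carries this flatness over to
  \<open>L\<close>. In both cases \<open>singular_gronwall\<close> gives \<open>L = 0\<close> below \<open>t\<close>, and \<open>m \<noteq> 0\<close> there turns this
  into constancy of the density.
\<close>

lemma local_constancy:
  fixes \<gamma> A \<theta>b t :: real and W :: conic_flow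
  assumes flow: "conic_flow_on \<gamma> {\<theta>b..pi / 2} W" and \<gamma>: "\<gamma> > 1" and \<theta>b: "0 < \<theta>b" "\<theta>b < pi / 2"
    and t: "t \<in> {\<theta>b<..pi / 2}" and w: "U2 W t < 0"
    and F: "F 0 = density W" "\<And>n x. x \<in> {\<theta>b..pi / 2} \<Longrightarrow>
        (F n has_real_derivative F (Suc n) x) (at x within {\<theta>b..pi / 2})"
    and rest: "\<And>s. s \<in> {t..pi / 2} \<Longrightarrow> F 1 s = 0"
    and compression: "U1 W t * U2 W t + cot t * ((U2 W t)\<^sup>2 + (U3 W t)\<^sup>2) = 0"
    and start: "t = pi / 2 \<Longrightarrow> (U2 W t)\<^sup>2 \<noteq> \<gamma> * entropy W t * density W t powr (\<gamma> - 1)"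
  shows "\<exists>s\<in>{\<theta>b<..<t}. \<forall>x\<in>{s<..<t}. U2 W x < 0 \<and> F 1 x = 0"
proof -
  define J where "J = {\<theta>b..pi / 2}"
  define \<rho> where "\<rho> = density W"
  define w where "w x = - U2 W x" for x
  define u where "u = U1 W"
  define Z where "Z x = (U3 W x)\<^sup>2 / w x" for x
  define r where "r x = F 1 x / \<rho> x" for x
  define X where "X x = \<gamma> * entropy W x * \<rho> x powr (\<gamma> - 1)" for x
  define m where "m x = (w x)\<^sup>2 - X x" for x
  define L where "L x = u x - cot x * (w x + Z x)" for x
  have flow: "conic_flow_on \<gamma> J W" using flow by (simp add: J_def)
  have Jbot: "at x within J \<noteq> bot" if "x \<in> J" for x
    unfolding J_def using that \<theta>b by (intro interval_limit_point[of _ \<theta>b "pi/2"]) (auto simp: J_def)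
  have sinJ: "sin x > 0" if "x \<in> J" for x using that \<theta>b by (auto simp: J_def intro!: sin_gt_zero)
  have tJ: "t \<in> J" using t by (auto simp: J_def)
  note E = conic_flow_equations[OF flow _ Jbot]
  have dr: "deriv_on J (density W) x = F 1 x" if x: "x \<in> J" for x
    using F(2)[of x 0] F(1) x by (intro deriv_on_eqI[OF _ Jbot[OF x]]) (simp add: J_def)
  have cU2: "continuous_on J (U2 W)" by (rule DERIV_continuous_on[OF E(4)])
  \<comment> \<open>A neighbourhood on which the flow keeps moving towards the axis.\<close>
  have "\<forall>\<^sub>F x in at t within J. U2 W x < 0"
    using cU2 tJ w by (intro order_tendstoD(2)[of _ "U2 W t"]) (auto simp: continuous_on_def)
  then obtain \<delta> where \<delta>: "\<delta> > 0" "\<And>x. x \<in> J \<Longrightarrow> x \<noteq> t \<Longrightarrow> dist x t < \<delta> \<Longrightarrow> U2 W x < 0"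
    unfolding eventually_at by blast
  define a where "a = max ((\<theta>b + t) / 2) (t - \<delta> / 2)"
  have a: "\<theta>b < a" "a < t" using \<delta>(1) t by (auto simp: a_def less_max_iff_disj)
  define S where "S = {a..t}"
  have SJ: "S \<subseteq> J" using a t by (auto simp: S_def J_def)
  have wS: "w x > 0" if "x \<in> S" for x
  proof (cases "x = t")
    case False
    have "dist x t < \<delta>" using that \<delta>(1) by (auto simp: S_def a_def dist_real_def)
    then show ?thesis using \<delta>(2)[of x] False that SJ by (auto simp: w_def)
  qed (use w in \<open>simp add: w_def\<close>)
  have \<rho>S: "\<rho> x > 0" if "x \<in> S" for x using E(1) that SJ by (auto simp: \<rho>_def)
  have at: "at x within J = at x" if "a < x" "x < t" for x
    unfolding J_def by (rule at_within_Icc_at) (use that a t in auto)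
  have T: "deriv_on J (entropy W) x = 0"
    "(u has_real_derivative - (w x + Z x)) (at x within J)"
    "(w has_real_derivative 2 * u x - w x * cot x - w x * r x) (at x within J)"
    "(Z has_real_derivative Z x * (r x - cot x)) (at x within J)"
    "m x * r x = w x * L x" if x: "x \<in> S" for x
  proof -
    have xJ: "x \<in> J" using x SJ by auto
    have "U2 W x < 0" using wS[OF x] by (simp add: w_def)
    from transverse_flow_equations[OF flow xJ Jbot[OF xJ] this]
    show "deriv_on J (entropy W) x = 0"
      "(u has_real_derivative - (w x + Z x)) (at x within J)"
      "(w has_real_derivative 2 * u x - w x * cot x - w x * r x) (at x within J)"
      "(Z has_real_derivative Z x * (r x - cot x)) (at x within J)"
      "m x * r x = w x * L x"
      by (simp_all add: dr[OF xJ] m_def L_def X_def r_def u_def w_def[abs_def] Z_def[abs_def] \<rho>_def)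
  qed
  note dA = T(1) and du = T(2) and dw = T(3) and dZ = T(4) and mr = T(5)
  have dL: "(L has_real_derivative - cot x * (2 * L x - (w x - Z x) * r x)) (at x within J)" if x: "x \<in> S" for x
    unfolding L_def[abs_def] L_def using sinJ[of x] x SJ by (intro compression_derivative du dw dZ) auto
  have Lt: "L t = 0"
  proof -
    have tS: "t \<in> S" using a by (simp add: S_def)
    have "w t * L t = - (U1 W t * U2 W t + cot t * ((U2 W t)\<^sup>2 + (U3 W t)\<^sup>2))"
      using wS[OF tS] by (simp add: L_def Z_def w_def u_def algebra_simps power2_eq_square)
    then show ?thesis using compression wS[OF tS] by simp
  qed
  have dX: "(X has_real_derivative (\<gamma> - 1) * X x * r x) (at x within J)" if x: "x \<in> S" for x
  proof -
    have xJ: "x \<in> J" using x SJ by auto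
    have "(X has_real_derivative deriv_on J (entropy W) x * \<gamma> * \<rho> x powr (\<gamma> - 1)
        + (\<gamma> - 1) * \<rho> x powr (\<gamma> - 1) * (deriv_on J (density W) x / \<rho> x) * (\<gamma> * entropy W x)) (at x within J)"
      unfolding X_def \<rho>_def using E(1)[OF xJ xJ]
      by (intro DERIV_mult DERIV_cmult powr_log_derivative E(2)[OF xJ xJ] DERIV_cong[OF DERIV_cmult[OF E(6)[OF xJ xJ]]])
        (auto simp: mult_ac)
    then show ?thesis unfolding dA[OF x] dr[OF xJ] by (simp add: r_def X_def mult_ac)
  qed
  have dm: "(m has_real_derivative 2 * w x * (2 * u x - w x * cot x - w x * r x) - (\<gamma> - 1) * X x * r x) (at x within J)"
    if x: "x \<in> S" for x
    unfolding m_def using dw[OF x] dX[OF x] by (auto intro!: derivative_eq_intros)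
  have cw: "continuous_on S w" by (rule DERIV_continuous_on[OF DERIV_subset[OF dw SJ]])
  have cZ: "continuous_on S Z" by (rule DERIV_continuous_on[OF DERIV_subset[OF dZ SJ]])
  have cm: "continuous_on S m" by (rule DERIV_continuous_on[OF DERIV_subset[OF dm SJ]])
  have cc: "continuous_on S cot"
  proof (rule DERIV_continuous_on[OF DERIV_cot_within])
    show "sin x \<noteq> 0" if "x \<in> S" for x using sinJ[of x] that SJ by auto
  qed
  have Sc: "compact S" by (simp add: S_def)
  have "\<exists>K\<ge>0. \<forall>x\<in>S. \<bar>cot x * (2 * m x - (w x - Z x) * w x)\<bar> \<le> K"
    by (intro continuous_on_compact_abs_bound Sc continuous_intros cw cZ cm cc)
  then obtain K where K: "K \<ge> 0" "\<And>x. x \<in> S \<Longrightarrow> \<bar>cot x * (2 * m x - (w x - Z x) * w x)\<bar> \<le> K"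
    by auto
  have tS: "t \<in> S" using a by (simp add: S_def)
  \<comment> \<open>A lower bound for \<open>m\<close>, and an order of flatness \<open>N\<close> that beats the exponent \<open>K / \<mu>\<close>.\<close>
  obtain \<mu> N c where \<mu>: "\<mu> > 0" "N \<ge> 1" "2 * K \<le> real N * \<mu>" "a \<le> c" "c < t"
    and m_ge: "\<And>x. x \<in> {c<..<t} \<Longrightarrow> \<mu> * (t - x) \<le> \<bar>m x\<bar>"
    and flat: "\<And>j. 1 \<le> j \<Longrightarrow> j < 1 + N \<Longrightarrow> F j t = 0"
  proof (cases "m t = 0")
    case False
    have "\<forall>\<^sub>F x in at t within S. \<bar>m x\<bar> > \<bar>m t\<bar> / 2"
      using cm tS False by (intro order_tendstoD(1)[of _ "\<bar>m t\<bar>"] tendsto_rabs) (auto simp: continuous_on_def)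
    then obtain \<eta> where \<eta>: "\<eta> > 0" "\<And>x. x \<in> S \<Longrightarrow> x \<noteq> t \<Longrightarrow> dist x t < \<eta> \<Longrightarrow> \<bar>m x\<bar> > \<bar>m t\<bar> / 2"
      unfolding eventually_at by blast
    \<comment> \<open>Near a regular point any \<open>\<mu>\<close> is admissible, and this one allows \<open>N = 1\<close>.\<close>
    define \<mu> where "\<mu> = 2 * K + 1"
    have \<mu>: "\<mu> > 0" using K(1) by (simp add: \<mu>_def)
    define c where "c = max a (t - min \<eta> (\<bar>m t\<bar> / 2 / \<mu>))"
    have c: "a \<le> c" "c < t" using a \<eta>(1) False \<mu> by (auto simp: c_def)
    show ?thesis
    proof (rule that[of \<mu> 1 c])
      fix x assume x: "x \<in> {c<..<t}"
      have "t - x \<le> \<bar>m t\<bar> / 2 / \<mu>" using x by (auto simp: c_def)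
      then have "\<mu> * (t - x) \<le> \<bar>m t\<bar> / 2" using \<mu> by (simp add: field_simps)
      also have "\<dots> < \<bar>m x\<bar>"
        using x c by (intro \<eta>(2)) (auto simp: S_def dist_real_def c_def)
      finally show "\<mu> * (t - x) \<le> \<bar>m x\<bar>" by simp
    next
      fix j :: nat assume "1 \<le> j" "j < 1 + 1"
      then have "j = 1" by simp
      then show "F j t = 0" using rest[of t] t by simp
    qed (use \<mu> c in \<open>auto simp: \<mu>_def\<close>)
  next
    case True
    have t2: "t < pi / 2" using start True t by (force simp: m_def X_def w_def \<rho>_def)
    have cott: "cot t > 0" using t2 t \<theta>b by (auto simp: cot_def intro!: divide_pos_pos cos_gt_zero sin_gt_zero)
    have rt: "r t = 0" using rest[of t] t by (simp add: r_def)
    have Zt: "Z t \<ge> 0" using wS[OF tS] by (simp add: Z_def)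
    define l where "l = 2 * w t * (u t + cot t * Z t)"
    have ut: "u t = cot t * (w t + Z t)" using Lt by (simp add: L_def)
    have "u t > 0" unfolding ut using cott wS[OF tS] Zt by (intro mult_pos_pos) auto
    then have l: "l > 0" unfolding l_def using wS[OF tS] cott Zt by (intro mult_pos_pos add_pos_nonneg) auto
    have "2 * w t * (2 * u t - w t * cot t - w t * r t) - (\<gamma> - 1) * X t * r t = l"
      unfolding rt l_def by (simp add: ut algebra_simps)
    with dm[OF tS] have dmt: "(m has_real_derivative l) (at t within J)" by simp
    have "((\<lambda>x. m x - l / 2 * x) has_real_derivative l / 2) (at t within S)"
      by (rule DERIV_cong[OF DERIV_diff[OF DERIV_subset[OF dmt SJ] DERIV_cmult_Id[of "l/2"]]]) simp
    from has_real_derivative_pos_inc_left[OF this] l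
    obtain \<eta> where \<eta>: "\<eta> > 0" "\<And>h. 0 < h \<Longrightarrow> t - h \<in> S \<Longrightarrow> h < \<eta> \<Longrightarrow>
        m (t - h) - l / 2 * (t - h) < m t - l / 2 * t" by auto
    define c where "c = max a (t - \<eta>)"
    have c: "a \<le> c" "c < t" using a \<eta>(1) by (auto simp: c_def)
    define N where "N = Suc (nat \<lceil>2 * K / (l / 2)\<rceil>)"
    show ?thesis
    proof (rule that[of "l / 2" N c])
      have "2 * K / (l / 2) \<le> real N" unfolding N_def by linarith
      then show "2 * K \<le> real N * (l / 2)" using l by (simp add: field_simps)
      fix x assume x: "x \<in> {c<..<t}"
      then have "m x - l / 2 * x < 0 - l / 2 * t"
        using \<eta>(2)[of "t - x"] c True by (auto simp: S_def c_def)
      then show "l / 2 * (t - x) \<le> \<bar>m x\<bar>" by (simp add: algebra_simps)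
    next
      fix j assume j: "1 \<le> j" "j < 1 + N"
      show "F j t = 0"
      proof (rule derivatives_vanish_after_constancy[of t "pi/2" F, OF _ t2 _ j(1)])
        show "(F n has_real_derivative F (Suc n) x) (at x within {t..pi/2})" if "x \<in> {t..pi/2}" for n x
          by (rule DERIV_subset[OF F(2)]) (use that t in auto)
      qed (use t2 rest in auto)
    qed (use l c in \<open>auto simp: N_def\<close>)
  qed
  have "\<exists>C\<ge>0. \<forall>x\<in>{a..t}. \<bar>F 1 x\<bar> \<le> C * (t - x) ^ N"
  proof (intro flat_bound flat)
    show "(F n has_real_derivative F (Suc n) x) (at x within {a..t})" if "x \<in> {a..t}" for n x
      by (rule DERIV_subset[OF F(2)]) (use that SJ in \<open>auto simp: S_def J_def\<close>)
  qed
  then obtain C where C: "C \<ge> 0" "\<And>x. x \<in> S \<Longrightarrow> \<bar>F 1 x\<bar> \<le> C * (t - x) ^ N" by (auto simp: S_def)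
  have c\<rho>: "continuous_on S \<rho>"
    using DERIV_continuous_on[OF E(2)] SJ by (auto simp: \<rho>_def intro: continuous_on_subset)
  have "\<exists>D\<ge>0. \<forall>x\<in>S. \<bar>m x / (\<rho> x * w x)\<bar> \<le> D"
    by (intro continuous_on_compact_abs_bound Sc continuous_intros cw cm c\<rho>) (use wS \<rho>S in force)
  then obtain D where D: "D \<ge> 0" "\<And>x. x \<in> S \<Longrightarrow> \<bar>m x / (\<rho> x * w x)\<bar> \<le> D"
    by auto
  have L_flat: "\<bar>L x\<bar> \<le> D * C * (t - x) ^ N" if x: "x \<in> S" for x
  proof -
    have "L x = m x / (\<rho> x * w x) * F 1 x"
      using mr[OF x] wS[OF x] \<rho>S[OF x] by (simp add: r_def field_simps)
    then have "\<bar>L x\<bar> = \<bar>m x / (\<rho> x * w x)\<bar> * \<bar>F 1 x\<bar>" by (simp add: abs_mult)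
    also have "\<dots> \<le> D * (C * (t - x) ^ N)"
      using D C(2)[OF x] x by (intro mult_mono) auto
    finally show ?thesis by simp
  qed
  have L0: "L x = 0" if x: "c < x" "x < t" for x
  proof (rule singular_gronwall[OF \<mu>(2) _ _ _ x, of L "\<lambda>x. - cot x * (2 * L x - (w x - Z x) * r x)" "D * C"])
    fix y assume y: "c < y" "y < t"
    then have yS: "y \<in> S" and ya: "a < y" using \<mu>(4) by (auto simp: S_def)
    show "(L has_real_derivative - cot y * (2 * L y - (w y - Z y) * r y)) (at y)"
      using dL[OF yS] at[OF ya y(2)] by simp
    show "\<bar>L y\<bar> \<le> D * C * (t - y) ^ N" by (rule L_flat[OF yS])
    have "m y * (- cot y * (2 * L y - (w y - Z y) * r y))
        = - cot y * (2 * m y * L y - (w y - Z y) * (m y * r y))" by (simp add: algebra_simps)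
    also have "\<dots> = - (cot y * (2 * m y - (w y - Z y) * w y)) * L y"
      unfolding mr[OF yS] by (simp add: algebra_simps)
    finally have "\<bar>m y\<bar> * \<bar>- cot y * (2 * L y - (w y - Z y) * r y)\<bar>
        = \<bar>cot y * (2 * m y - (w y - Z y) * w y)\<bar> * \<bar>L y\<bar>"
      by (metis abs_mult abs_minus_cancel)
    also have "\<dots> \<le> K * \<bar>L y\<bar>" by (intro mult_right_mono K yS) simp
    finally have mL: "\<bar>m y\<bar> * \<bar>- cot y * (2 * L y - (w y - Z y) * r y)\<bar> \<le> K * \<bar>L y\<bar>" .
    let ?l = "\<bar>- cot y * (2 * L y - (w y - Z y) * r y)\<bar>"
    have "\<mu> * (2 * ?l * (t - y)) = 2 * (\<mu> * (t - y) * ?l)" by simp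
    also have "\<dots> \<le> 2 * (\<bar>m y\<bar> * ?l)"
      using m_ge[of y] y by (intro mult_left_mono mult_right_mono) auto
    also have "\<dots> \<le> 2 * K * \<bar>L y\<bar>" using mL by simp
    also have "\<dots> \<le> real N * \<mu> * \<bar>L y\<bar>" by (intro mult_right_mono \<mu>) auto
    finally have "\<mu> * (2 * ?l * (t - y)) \<le> \<mu> * (real N * \<bar>L y\<bar>)" by (simp add: mult_ac)
    then show "2 * ?l * (t - y) \<le> real N * \<bar>L y\<bar>" using \<mu>(1) by simp
  qed
  show ?thesis
  proof (intro bexI[of _ "c"] ballI conjI)
    show "c \<in> {\<theta>b<..<t}" using \<mu> a by auto
    fix x assume x: "x \<in> {c<..<t}"
    then have xS: "x \<in> S" using \<mu> by (auto simp: S_def)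
    show "U2 W x < 0" using wS[OF xS] by (simp add: w_def)
    have "0 < \<mu> * (t - x)" using \<mu>(1) x by simp
    then have "m x \<noteq> 0" using m_ge[OF x] by auto
    then have "r x = 0" using mr[OF xS] L0[of x] x by simp
    then show "F 1 x = 0" using \<rho>S[OF xS] by (simp add: r_def)
  qed
qed

text \<open>
  With constant density \<open>L = 0\<close>, that is, \<open>U1 = cot * (w + Z)\<close>. Then \<open>(w + Z) / sin\<close> has derivative zero; its value
  \<open>k\<close> at \<open>pi / 2\<close> gives \<open>U1 = k * cos\<close>, and \<open>(w * sin)' = 2 * U1 * sin\<close> integrates to the polar
  velocity. As the pressure is constant too, this is the flow in which all
  particles move along straight lines.
\<close>

lemma constant_density_profile:
  fixes W \<gamma> \<theta>b U02 U03
  assumes flow: "conic_flow_on \<gamma> J W" and J: "\<And>x. x \<in> J \<Longrightarrow> at x within J \<noteq> bot" "J \<subseteq> {0<..<pi}"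
    and S: "convex S" "S \<subseteq> J" "pi / 2 \<in> S"
    and U2: "\<And>x. x \<in> S \<Longrightarrow> U2 W x < 0" and const: "\<And>x. x \<in> S \<Longrightarrow> deriv_on J (density W) x = 0"
    and init: "U2 W (pi / 2) = U02" "U3 W (pi / 2) = U03"
    and x: "x \<in> S"
  defines "k \<equiv> (U02\<^sup>2 + U03\<^sup>2) / - U02"
  shows "density W x = density W (pi / 2)" and "entropy W x = entropy W (pi / 2)"
    and "U1 W x * U2 W x + cot x * ((U2 W x)\<^sup>2 + (U3 W x)\<^sup>2) = 0"
    and "U1 W x = k * cos x" and "- U2 W x * sin x = - U02 - k * (cos x)\<^sup>2"
    and "(U1 W x)\<^sup>2 + (U2 W x)\<^sup>2 + (U3 W x)\<^sup>2 = U02\<^sup>2 + U03\<^sup>2"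
proof -
  have SJ: "x \<in> J" if "x \<in> S" for x using that S by auto
  have sinS: "sin x > 0" if "x \<in> S" for x using SJ[OF that] J(2) sin_gt_zero[of x] by auto
  have U02: "U02 < 0" using U2[OF S(3)] init by simp
  define w where "w x = - U2 W x" for x
  define Z where "Z x = (U3 W x)\<^sup>2 / w x" for x
  have w: "w x > 0" if "x \<in> S" for x using U2[OF that] by (simp add: w_def)
  have U3: "(U3 W x)\<^sup>2 = w x * Z x" if "x \<in> S" for x using w[OF that] by (simp add: Z_def)
  note E = conic_flow_equations[OF flow SJ J(1)[OF SJ]]
  have T: "deriv_on J (entropy W) x = 0"
    "(w has_real_derivative 2 * U1 W x - w x * cot x) (at x within S)"
    "(Z has_real_derivative - Z x * cot x) (at x within S)"
    "U1 W x = cot x * (w x + Z x)" if x: "x \<in> S" for x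
  proof -
    note T = transverse_flow_equations[OF flow SJ[OF x] J(1)[OF SJ[OF x]] U2[OF x], unfolded const[OF x]]
    show "deriv_on J (entropy W) x = 0" by (rule T(1))
    show "(w has_real_derivative 2 * U1 W x - w x * cot x) (at x within S)"
      "(Z has_real_derivative - Z x * cot x) (at x within S)"
      using DERIV_subset[OF T(3) S(2)] DERIV_subset[OF T(4) S(2)] by (simp_all add: w_def[abs_def] Z_def[abs_def])
    show "U1 W x = cot x * (w x + Z x)" using T(5) w[OF x] by (simp add: w_def Z_def)
  qed
  note dA = T(1) and dw = T(2) and dZ = T(3) and u = T(4)
  show "U1 W x * U2 W x + cot x * ((U2 W x)\<^sup>2 + (U3 W x)\<^sup>2) = 0"
    unfolding U3[OF x] u[OF x] by (simp add: w_def algebra_simps power2_eq_square)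
  have w_init: "w (pi / 2) = - U02" and Z_init: "Z (pi / 2) = U03\<^sup>2 / - U02"
    using init by (simp_all add: w_def Z_def)
  have y: "w x + Z x = k * sin x" if x: "x \<in> S" for x
  proof -
    have "((\<lambda>x. (w x + Z x) / sin x) has_real_derivative 0) (at x within S)" if x: "x \<in> S" for x
    proof -
      have "((\<lambda>x. (w x + Z x) / sin x) has_real_derivative
          ((2 * U1 W x - w x * cot x + - Z x * cot x) * sin x - (w x + Z x) * cos x) / (sin x * sin x)) (at x within S)"
        using sinS[OF x] by (intro DERIV_divide DERIV_add dw dZ x has_field_derivative_at_within[OF DERIV_sin]) auto
      also have "(2 * U1 W x - w x * cot x + - Z x * cot x) * sin x - (w x + Z x) * cos x = 0"
        unfolding u[OF x] using sinS[OF x] by (simp add: cot_def field_simps)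
      finally show ?thesis by simp
    qed
    from has_field_derivative_zero_constant[OF S(1) this]
    obtain C where C: "\<And>x. x \<in> S \<Longrightarrow> (w x + Z x) / sin x = C" by auto
    have "C = k"
      using C[OF S(3)] U02 unfolding w_init Z_init k_def by (simp add: field_simps power2_eq_square)
    then show ?thesis using C[OF x] sinS[OF x] by (simp add: field_simps)
  qed
  have u': "U1 W x = k * cos x" if x: "x \<in> S" for x
    unfolding u[OF x] y[OF x] using sinS[OF x] by (simp add: cot_def)
  then show "U1 W x = k * cos x" using x .
  have P: "- U2 W x * sin x = - U02 - k * (cos x)\<^sup>2" if x: "x \<in> S" for x
  proof -
    have "((\<lambda>x. w x * sin x + k * (cos x)\<^sup>2) has_real_derivative 0) (at x within S)" if x: "x \<in> S" for x
    proof -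
      have "((\<lambda>x. w x * sin x + k * (cos x)\<^sup>2) has_real_derivative
          (2 * U1 W x - w x * cot x) * sin x + cos x * w x + k * (2 * cos x * - sin x)) (at x within S)"
        using dw[OF x] by (auto intro!: derivative_eq_intros)
      also have "(2 * U1 W x - w x * cot x) * sin x + cos x * w x + k * (2 * cos x * - sin x) = 0"
        unfolding u'[OF x] using sinS[OF x] by (simp add: cot_def field_simps)
      finally show ?thesis .
    qed
    from has_field_derivative_zero_constant[OF S(1) this]
    obtain C where C: "\<And>x. x \<in> S \<Longrightarrow> w x * sin x + k * (cos x)\<^sup>2 = C" by auto
    show ?thesis using C[OF S(3)] C[OF x] by (simp add: w_init, simp add: w_def)
  qed
  then show "- U2 W x * sin x = - U02 - k * (cos x)\<^sup>2" using x .
  have "(U1 W x)\<^sup>2 + (U2 W x)\<^sup>2 + (U3 W x)\<^sup>2 = (k * cos x)\<^sup>2 + w x * (w x + Z x)"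
    using U3[OF x] u'[OF x] by (simp add: w_def algebra_simps power2_eq_square)
  also have "\<dots> = k * (k * (cos x)\<^sup>2 + w x * sin x)"
    unfolding y[OF x] by (simp add: algebra_simps power2_eq_square)
  also have "w x * sin x = - U02 - k * (cos x)\<^sup>2" using P[OF x] by (simp add: w_def)
  also have "k * (k * (cos x)\<^sup>2 + (- U02 - k * (cos x)\<^sup>2)) = U02\<^sup>2 + U03\<^sup>2"
    using U02 by (simp add: k_def)
  finally show "(U1 W x)\<^sup>2 + (U2 W x)\<^sup>2 + (U3 W x)\<^sup>2 = U02\<^sup>2 + U03\<^sup>2" .
  have "(density W has_real_derivative 0) (at y within S)" "(entropy W has_real_derivative 0) (at y within S)"
    if y: "y \<in> S" for y
    using DERIV_subset[OF E(2)[OF y y] S(2)] DERIV_subset[OF E(6)[OF y y] S(2)] const[OF y] dA[OF y] by simp_all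
  from has_field_derivative_zero_constant[OF S(1) this(1)] has_field_derivative_zero_constant[OF S(1) this(2)]
  show "density W x = density W (pi / 2)" "entropy W x = entropy W (pi / 2)"
    using x S(3) by metis+
qed

lemma continuous_on_zero_left_endpoint:
  fixes f :: "real \<Rightarrow> real"
  assumes "continuous_on {t..b} f" "t < b" "\<And>x. x \<in> {t<..b} \<Longrightarrow> f x = 0"
  shows "f t = 0"
proof (rule tendsto_unique[of "at_right t" f])
  show "(f \<longlongrightarrow> f t) (at_right t)"
    using assms(1,2) by (simp add: continuous_on_Icc_at_rightD)
  have "\<forall>\<^sub>F x in at_right t. f x = 0"
    using assms(2,3) by (auto simp: eventually_at_right_field intro!: exI[of _ b])
  then show "(f \<longlongrightarrow> 0) (at_right t)" by (rule tendsto_eventually)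
qed simp

text \<open>
  Continuation from \<open>pi / 2\<close> to the shock: the infimum \<open>t\<close> of the angles above which the density is constant
  and \<open>U2 < 0\<close> belongs to this set, and if it exceeded \<open>\<theta>b\<close> it could be lowered by \<open>local_constancy\<close>. The
  point is that \<open>U2\<close> cannot vanish at \<open>t\<close>: stagnation excludes swirl, and the profile without swirl
  is \<open>U2 = U02 * sin\<close>.
\<close>

lemma upstream_rigidity:
  fixes W \<gamma> \<theta>b U02 U03
  assumes flow: "conic_flow_on \<gamma> {\<theta>b..pi / 2} W" and \<gamma>: "\<gamma> > 1" and \<theta>b: "0 < \<theta>b" "\<theta>b < pi / 2"
    and init: "U1 W (pi / 2) = 0" "U2 W (pi / 2) = U02" "U3 W (pi / 2) = U03" "U02 < 0"
    and supersonic: "\<gamma> * entropy W (pi / 2) * density W (pi / 2) powr (\<gamma> - 1) < U02\<^sup>2"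
  shows "U2 W \<theta>b < 0" and "density W \<theta>b = density W (pi / 2)" and "entropy W \<theta>b = entropy W (pi / 2)"
    and "- U2 W \<theta>b * sin \<theta>b = - U02 - (U02\<^sup>2 + U03\<^sup>2) / - U02 * (cos \<theta>b)\<^sup>2"
    and "(U1 W \<theta>b)\<^sup>2 + (U2 W \<theta>b)\<^sup>2 + (U3 W \<theta>b)\<^sup>2 = U02\<^sup>2 + U03\<^sup>2"
proof -
  define J where "J = {\<theta>b..pi / 2}"
  have flow: "conic_flow_on \<gamma> J W" using flow by (simp add: J_def)
  have Jbot: "at x within J \<noteq> bot" if "x \<in> J" for x
    unfolding J_def using that \<theta>b by (intro interval_limit_point[of _ \<theta>b "pi/2"]) (auto simp: J_def)
  have Jpi: "J \<subseteq> {0<..<pi}" using \<theta>b by (auto simp: J_def)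
  note E = conic_flow_equations[OF flow _ Jbot]
  have "smooth_fun_on J (density W)" using flow by (simp add: conic_flow_on_def smooth_flow_on_def)
  then obtain F where F: "F 0 = density W"
      "\<And>n x. x \<in> J \<Longrightarrow> (F n has_real_derivative F (Suc n) x) (at x within J)"
    unfolding smooth_fun_on_def by blast
  have dr: "deriv_on J (density W) x = F 1 x" if x: "x \<in> J" for x
    using F(2)[OF x, of 0] F(1) by (intro deriv_on_eqI[OF _ Jbot[OF x]]) simp
  define T where "T = {t \<in> J. \<forall>s\<in>{t..pi / 2}. U2 W s < 0 \<and> F 1 s = 0}"
  have piJ: "pi / 2 \<in> J" using \<theta>b by (simp add: J_def)
  \<comment> \<open>At \<open>pi / 2\<close> the momentum equation reads \<open>(U02\<^sup>2 - c\<^sup>2) * F 1 = 0\<close>, and the incoming flow is supersonic.\<close>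
  have start: "F 1 (pi / 2) = 0"
  proof -
    let ?\<rho> = "density W (pi / 2)" and ?d = "F 1 (pi / 2)" and ?X = "\<gamma> * entropy W (pi / 2) * density W (pi / 2) powr (\<gamma> - 1)"
    have c: "cot (pi / 2 :: real) = 0" by (simp add: cot_def)
    have dA: "deriv_on J (entropy W) (pi / 2) = 0" using E(11)[OF piJ piJ] init by simp
    have mass: "?\<rho> * deriv_on J (U2 W) (pi / 2) = - ?d * U02"
      using E(7)[OF piJ piJ] init unfolding dr[OF piJ] c by simp
    have "?\<rho> * (U02 * deriv_on J (U2 W) (pi / 2) + ?X * (?d / ?\<rho>)) = 0"
      using E(9)[OF piJ piJ] init unfolding dr[OF piJ] dA c by simp
    then have "U02 * (?\<rho> * deriv_on J (U2 W) (pi / 2)) + ?X * ?d = 0"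
      using E(1)[OF piJ piJ] by (simp add: algebra_simps)
    moreover have "U02 * (- ?d * U02) + ?X * ?d = - ((U02\<^sup>2 - ?X) * ?d)"
      by (simp only: algebra_simps power2_eq_square)
    ultimately have "(U02\<^sup>2 - ?X) * ?d = 0" unfolding mass by linarith
    then show ?thesis using supersonic by simp
  qed
  have piT: "pi / 2 \<in> T" using piJ start init by (auto simp: T_def)
  have T_J: "T \<subseteq> J" by (auto simp: T_def)
  have T_ge: "\<theta>b \<le> s" if "s \<in> T" for s using that by (auto simp: T_def J_def)
  have T_bdd: "bdd_below T" using T_ge by (intro bdd_belowI)
  define t where "t = Inf T"
  have t_le: "t \<le> s" if "s \<in> T" for s unfolding t_def by (rule cInf_lower[OF that T_bdd])
  have t_ge: "\<theta>b \<le> t" unfolding t_def using piT T_ge by (intro cInf_greatest) auto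
  have tJ: "t \<in> J" using t_ge t_le[OF piT] by (simp add: J_def)
  have above: "U2 W s < 0 \<and> F 1 s = 0" if "s \<in> {t<..pi / 2}" for s
  proof -
    have "\<exists>s'\<in>T. s' < s"
      using that piT T_bdd by (intro cInf_lessD) (auto simp: t_def)
    then show ?thesis using that by (auto simp: T_def)
  qed
  have tT: "t \<in> T"
  proof (cases "t = pi / 2")
    case False
    then have t2: "t < pi / 2" using t_le[OF piT] by simp
    have SJ: "{t<..pi / 2} \<subseteq> J" using t_ge by (auto simp: J_def)
    have TJ: "{t..pi / 2} \<subseteq> J" using t_ge by (auto simp: J_def)
    have prof: "- U2 W x * sin x - (- U02 - (U02\<^sup>2 + U03\<^sup>2) / - U02 * (cos x)\<^sup>2) = 0" if x: "x \<in> {t<..pi / 2}" for x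
    proof -
      have neg: "U2 W y < 0" and z: "deriv_on J (density W) y = 0" if "y \<in> {t<..pi / 2}" for y
        using above[OF that] dr[of y] SJ that by auto
      have p: "pi / 2 \<in> {t<..pi / 2}" using t2 by simp
      show ?thesis
        using constant_density_profile(5)[OF flow Jbot Jpi convex_real_interval(6) SJ p neg z init(2,3) x]
        by simp
    qed
    have cU2: "continuous_on {t..pi / 2} (U2 W)"
      by (rule continuous_on_subset[OF DERIV_continuous_on[OF E(4)] TJ])
    have "continuous_on {t..pi / 2} (\<lambda>x. - U2 W x * sin x - (- U02 - (U02\<^sup>2 + U03\<^sup>2) / - U02 * (cos x)\<^sup>2))"
      by (intro continuous_intros cU2)
    from continuous_on_zero_left_endpoint[OF this t2 prof]
    have proft: "- U2 W t * sin t = - U02 - (U02\<^sup>2 + U03\<^sup>2) / - U02 * (cos t)\<^sup>2" by simp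
    have "continuous_on {t..pi / 2} (F 1)"
      by (rule continuous_on_subset[OF DERIV_continuous_on[OF F(2)] TJ])
    from continuous_on_zero_left_endpoint[OF this t2] have F1t: "F 1 t = 0" using above by blast
    have "U2 W t \<noteq> 0"
    proof
      assume v0: "U2 W t = 0"
      have "is_interval J" by (simp add: J_def)
      from no_swirl_with_stagnation[OF flow Jbot Jpi this tJ v0 piJ] have "U03 = 0" using init by simp
      with proft v0 init(4) have "U02 * (1 - (cos t)\<^sup>2) = 0"
        by (simp add: field_simps power2_eq_square)
      then have "sin t = 0" using init(4) by (simp add: sin_squared_eq[symmetric])
      then show False using sin_gt_zero[of t] tJ Jpi by auto
    qed
    moreover have "U2 W t \<le> 0"
    proof (rule tendsto_upperbound)
      show "(U2 W \<longlongrightarrow> U2 W t) (at_right t)"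
        using cU2 t2 by (simp add: continuous_on_Icc_at_rightD)
      show "\<forall>\<^sub>F x in at_right t. U2 W x \<le> 0"
        using t2 above by (auto simp: eventually_at_right_field intro!: exI[of _ "pi / 2"] less_imp_le)
    qed simp
    ultimately have "U2 W t < 0" by simp
    then show ?thesis
      using F1t tJ above unfolding T_def by (auto simp: less_eq_real_def)
  qed (use piT in \<open>simp only:\<close>)
  have SJ: "{s..pi / 2} \<subseteq> J" if "s \<in> J" for s using that by (auto simp: J_def)
  have prof: "density W t = density W (pi / 2)" "entropy W t = entropy W (pi / 2)"
    "U1 W t * U2 W t + cot t * ((U2 W t)\<^sup>2 + (U3 W t)\<^sup>2) = 0"
    "- U2 W t * sin t = - U02 - (U02\<^sup>2 + U03\<^sup>2) / - U02 * (cos t)\<^sup>2"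
    "(U1 W t)\<^sup>2 + (U2 W t)\<^sup>2 + (U3 W t)\<^sup>2 = U02\<^sup>2 + U03\<^sup>2"
  proof -
    have p: "pi / 2 \<in> {t..pi / 2}" "t \<in> {t..pi / 2}" using t_le[OF piT] by auto
    have neg: "U2 W x < 0" and z: "deriv_on J (density W) x = 0" if "x \<in> {t..pi / 2}" for x
      using tT that SJ[OF tJ] dr[of x] by (auto simp: T_def)
    note c = constant_density_profile[OF flow Jbot Jpi convex_real_interval(5) SJ[OF tJ] p(1) neg z init(2,3) p(2)]
    show "density W t = density W (pi / 2)" "entropy W t = entropy W (pi / 2)"
      "U1 W t * U2 W t + cot t * ((U2 W t)\<^sup>2 + (U3 W t)\<^sup>2) = 0"
      "- U2 W t * sin t = - U02 - (U02\<^sup>2 + U03\<^sup>2) / - U02 * (cos t)\<^sup>2"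
      "(U1 W t)\<^sup>2 + (U2 W t)\<^sup>2 + (U3 W t)\<^sup>2 = U02\<^sup>2 + U03\<^sup>2"
      using c(1,2,3,5,6) by blast+
  qed
  have t_eq: "t = \<theta>b"
  proof (rule ccontr)
    assume "t \<noteq> \<theta>b"
    then have t': "t \<in> {\<theta>b<..pi / 2}" using tJ by (auto simp: J_def)
    have "\<exists>s\<in>{\<theta>b<..<t}. \<forall>x\<in>{s<..<t}. U2 W x < 0 \<and> F 1 x = 0"
    proof (rule local_constancy[of \<gamma> \<theta>b W t F, OF flow[unfolded J_def] \<gamma> \<theta>b t' _ F(1) _ _ prof(3)])
      show "U2 W t < 0" using tT tJ by (auto simp: T_def J_def)
      show "(F n has_real_derivative F (Suc n) x) (at x within {\<theta>b..pi / 2})" if "x \<in> {\<theta>b..pi / 2}" for n x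
        using F(2)[of x n] that by (simp add: J_def)
      show "F 1 s = 0" if "s \<in> {t..pi / 2}" for s using tT that by (auto simp: T_def)
      show "(U2 W t)\<^sup>2 \<noteq> \<gamma> * entropy W t * density W t powr (\<gamma> - 1)" if "t = pi / 2"
        using supersonic init unfolding that by simp
    qed
    then obtain s where s: "s \<in> {\<theta>b<..<t}" "\<And>x. x \<in> {s<..<t} \<Longrightarrow> U2 W x < 0 \<and> F 1 x = 0" by blast
    define s' where "s' = (s + t) / 2"
    have s': "s < s'" "s' < t" using s by (auto simp: s'_def)
    have "s' \<in> T"
      unfolding T_def
    proof (intro CollectI conjI ballI)
      show "s' \<in> J" using s s' tJ by (auto simp: J_def)
      fix x assume x: "x \<in> {s'..pi / 2}"
      have "U2 W x < 0 \<and> F 1 x = 0"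
        using s(2)[of x] tT s' x by (cases "x < t") (auto simp: T_def)
      then show "U2 W x < 0" "F 1 x = 0" by auto
    qed
    then show False using t_le[of s'] s' by simp
  qed
  show "U2 W \<theta>b < 0" using tT tJ t_eq by (auto simp: T_def J_def)
  show "density W \<theta>b = density W (pi / 2)" "entropy W \<theta>b = entropy W (pi / 2)"
    "- U2 W \<theta>b * sin \<theta>b = - U02 - (U02\<^sup>2 + U03\<^sup>2) / - U02 * (cos \<theta>b)\<^sup>2"
    "(U1 W \<theta>b)\<^sup>2 + (U2 W \<theta>b)\<^sup>2 + (U3 W \<theta>b)\<^sup>2 = U02\<^sup>2 + U03\<^sup>2"
    using prof t_eq by auto
qed

section \<open>The shock polar\<close>

text \<open>
  Across the shock only the velocity \<open>w\<close> normal to the ray jumps. Eliminating pressure and density leaves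
  \<open>w - w'\<close> times a linear expression in \<open>w'\<close>, and \<open>p' > p\<close> rules out the first factor. The third
  conclusion is Prandtl's relation; with \<open>w' < w\<close> it gives \<open>c2 < w\<^sup>2\<close>.
\<close>

lemma normal_shock:
  fixes \<gamma> \<rho> w c2 p \<rho>' w' c2' p' :: real
  assumes "\<gamma> > 1" "\<rho> > 0" "\<rho>' > 0" "w > 0"
    and mass: "\<rho>' * w' = \<rho> * w" and mom: "\<rho>' * w'\<^sup>2 + p' = \<rho> * w\<^sup>2 + p"
    and energy: "w'\<^sup>2 / 2 + c2' / (\<gamma> - 1) = w\<^sup>2 / 2 + c2 / (\<gamma> - 1)"
    and c2: "\<gamma> * p = \<rho> * c2" and c2': "\<gamma> * p' = \<rho>' * c2'" and jump: "p' > p"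
  shows "0 < w'" "w' < w" "(\<gamma> + 1) * w * w' = (\<gamma> - 1) * w\<^sup>2 + 2 * c2"
    "c2' = c2 + (\<gamma> - 1) * (w\<^sup>2 - w'\<^sup>2) / 2"
proof -
  have "0 < \<rho>' * w'" using assms by simp
  then show w': "0 < w'" using assms(3) by (simp add: zero_less_mult_iff)
  have "p' - p = \<rho> * w * w - (\<rho>' * w') * w'" using mom by (simp add: power2_eq_square)
  also have "\<dots> = \<rho> * w * (w - w')" unfolding mass by (simp add: algebra_simps)
  finally have dp: "p' - p = \<rho> * w * (w - w')" .
  with jump have "0 < \<rho> * w * (w - w')" by simp
  then have "0 < w - w'" by (rule zero_less_mult_pos) (simp add: assms)
  then show lt: "w' < w" by simp
  show en: "c2' = c2 + (\<gamma> - 1) * (w\<^sup>2 - w'\<^sup>2) / 2"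
    using energy assms(1) by (simp add: field_simps)
  have "\<rho> * w * c2' = (\<rho>' * c2') * w'" using mass by (simp add: mult_ac)
  also have "\<dots> = \<gamma> * p' * w'" by (simp only: c2')
  also have "p' = p + \<rho> * w * (w - w')" using dp by linarith
  also have "\<gamma> * (p + \<rho> * w * (w - w')) * w' = \<gamma> * p * w' + \<rho> * (\<gamma> * w * (w - w') * w')"
    by (simp add: algebra_simps)
  also have "\<dots> = \<rho> * (c2 * w' + \<gamma> * w * (w - w') * w')" using c2 by (simp add: algebra_simps)
  finally have "\<rho> * (w * c2') = \<rho> * (c2 * w' + \<gamma> * w * (w - w') * w')" by (simp add: mult_ac)
  then have "w * c2' = c2 * w' + \<gamma> * w * (w - w') * w'" using assms(2) by simp
  then have "(w - w') * ((\<gamma> - 1) * w\<^sup>2 + 2 * c2 - (\<gamma> + 1) * w * w') = 0"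
    unfolding en by (simp add: field_simps power2_eq_square)
  then show "(\<gamma> + 1) * w * w' = (\<gamma> - 1) * w\<^sup>2 + 2 * c2" using lt by simp
qed

lemma pressure_sound_speed:
  assumes "density W \<theta> > 0"
  shows "\<gamma> * pressure \<gamma> W \<theta> = density W \<theta> * (\<gamma> * entropy W \<theta> * density W \<theta> powr (\<gamma> - 1))"
  using assms by (simp add: pressure_def powr_diff)

text \<open>
  The tangential components do not jump, since the mass flux is nonzero. Up to a positive factor, Prandtl's relation
  turns the sonic excess into a quadratic in the square of the upstream polar speed.
\<close>

lemma sonic_excess_behind_shock:
  fixes \<gamma> \<theta> Wm Wp
  assumes \<gamma>: "\<gamma> > 1" and pos: "density Wm \<theta> > 0" "density Wp \<theta> > 0" "U2 Wm \<theta> < 0"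
    and RH: "rankine_hugoniot \<gamma> \<theta> Wm Wp" and jump: "pressure \<gamma> Wp \<theta> - pressure \<gamma> Wm \<theta> > 0"
  defines "w2 \<equiv> (U2 Wm \<theta>)\<^sup>2" and "c2 \<equiv> \<gamma> * entropy Wm \<theta> * density Wm \<theta> powr (\<gamma> - 1)"
    and "q2 \<equiv> (U1 Wm \<theta>)\<^sup>2 + (U2 Wm \<theta>)\<^sup>2 + (U3 Wm \<theta>)\<^sup>2"
  shows "(\<gamma> + 1) * w2 * sonic_excess \<gamma> Wp \<theta>
    = - (2 * \<gamma> * w2\<^sup>2 - w2 * ((\<gamma> - 3) * c2 + (\<gamma> + 1) * q2) - 2 * c2\<^sup>2)"
proof -
  define w where "w = - U2 Wm \<theta>"
  define w' where "w' = - U2 Wp \<theta>"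
  define c2' where "c2' = \<gamma> * entropy Wp \<theta> * density Wp \<theta> powr (\<gamma> - 1)"
  have rh: "density Wp \<theta> * U2 Wp \<theta> = density Wm \<theta> * U2 Wm \<theta>"
    "density Wp \<theta> * U1 Wp \<theta> * U2 Wp \<theta> = density Wm \<theta> * U1 Wm \<theta> * U2 Wm \<theta>"
    "density Wp \<theta> * (U2 Wp \<theta>)\<^sup>2 + pressure \<gamma> Wp \<theta> = density Wm \<theta> * (U2 Wm \<theta>)\<^sup>2 + pressure \<gamma> Wm \<theta>"
    "density Wp \<theta> * U2 Wp \<theta> * U3 Wp \<theta> = density Wm \<theta> * U2 Wm \<theta> * U3 Wm \<theta>"
    "bernoulli \<gamma> Wp \<theta> = bernoulli \<gamma> Wm \<theta>"
    using RH[unfolded rankine_hugoniot_def Let_def right_minus_eq] by blast+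
  have flux: "density Wm \<theta> * U2 Wm \<theta> \<noteq> 0" using pos by simp
  have "(density Wm \<theta> * U2 Wm \<theta>) * U1 Wp \<theta> = (density Wp \<theta> * U2 Wp \<theta>) * U1 Wp \<theta>"
    by (simp only: rh(1))
  also have "\<dots> = density Wp \<theta> * U1 Wp \<theta> * U2 Wp \<theta>" by (simp only: mult_ac)
  also have "\<dots> = (density Wm \<theta> * U2 Wm \<theta>) * U1 Wm \<theta>" unfolding rh(2) by (simp only: mult_ac)
  finally have U1: "U1 Wp \<theta> = U1 Wm \<theta>" using flux mult_left_cancel by blast
  have "(density Wm \<theta> * U2 Wm \<theta>) * U3 Wp \<theta> = density Wp \<theta> * U2 Wp \<theta> * U3 Wp \<theta>"
    by (simp only: rh(1))
  also have "\<dots> = (density Wm \<theta> * U2 Wm \<theta>) * U3 Wm \<theta>" by (simp only: rh(4))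
  finally have U3: "U3 Wp \<theta> = U3 Wm \<theta>" using flux mult_left_cancel by blast
  have energy: "w'\<^sup>2 / 2 + c2' / (\<gamma> - 1) = w\<^sup>2 / 2 + c2 / (\<gamma> - 1)"
    using rh(5) unfolding bernoulli_alt[of Wp, OF pos(2)] bernoulli_alt[of Wm, OF pos(1)]
    by (simp add: U1 U3 w_def w'_def c2_def c2'_def add_divide_distrib)
  have w: "0 < w" using pos by (simp add: w_def)
  have mass: "density Wp \<theta> * w' = density Wm \<theta> * w" using rh(1) by (simp add: w_def w'_def)
  have mom: "density Wp \<theta> * w'\<^sup>2 + pressure \<gamma> Wp \<theta> = density Wm \<theta> * w\<^sup>2 + pressure \<gamma> Wm \<theta>"
    using rh(3) by (simp add: w_def w'_def)
  have "pressure \<gamma> Wm \<theta> < pressure \<gamma> Wp \<theta>" using jump by simp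
  note ns = normal_shock(2-4)[OF \<gamma> pos(1,2) w mass mom energy
      pressure_sound_speed[OF pos(1), of \<gamma>, folded c2_def] pressure_sound_speed[OF pos(2), of \<gamma>, folded c2'_def] this]
  have se: "sonic_excess \<gamma> Wp \<theta> = q2 - w\<^sup>2 + w'\<^sup>2 - c2'"
    by (simp add: sonic_excess_def q2_def U1 U3 w_def w'_def c2'_def)
  have ww: "w2 = w\<^sup>2" by (simp add: w2_def w_def)
  have "(\<gamma> + 1) * ((\<gamma> + 1) * w2 * sonic_excess \<gamma> Wp \<theta>)
      = (\<gamma> + 1)\<^sup>2 * w\<^sup>2 * (q2 - c2 - (\<gamma> + 1) / 2 * w\<^sup>2) + (\<gamma> + 1) / 2 * ((\<gamma> + 1) * w * w')\<^sup>2"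
    unfolding se ns(3) ww by (simp add: field_simps power2_eq_square)
  also have "\<dots> = (\<gamma> + 1) * - (2 * \<gamma> * w2\<^sup>2 - w2 * ((\<gamma> - 3) * c2 + (\<gamma> + 1) * q2) - 2 * c2\<^sup>2)"
    unfolding ns(2) ww by (simp add: field_simps power2_eq_square)
  finally show ?thesis using \<gamma> by (subst (asm) mult_left_cancel) auto
qed

lemma entropy_pos_behind_shock:
  assumes "density Wm \<theta> > 0" "density Wp \<theta> > 0" "entropy Wm \<theta> > 0"
    and "pressure \<gamma> Wp \<theta> - pressure \<gamma> Wm \<theta> > 0"
  shows "entropy Wp \<theta> > 0"
proof -
  have "0 < pressure \<gamma> Wm \<theta>" using assms by (simp add: pressure_def)
  then have "0 < pressure \<gamma> Wp \<theta>" using assms(4) by simp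
  then show ?thesis using assms(2) by (simp add: pressure_def zero_less_mult_iff)
qed

text \<open>
  The number \<open>a_sharp_sq\<close> is the positive root of the quadratic that governs the sonic excess. The roots have
  product \<open>- 1 / \<gamma>\<close>, hence the form of the second factor, which is positive for \<open>a > 0\<close>.
\<close>

lemma a_sharp_sq_factorization:
  assumes \<gamma>: "\<gamma> > 1"
  shows "a_sharp_sq \<gamma> M > 0"
    and "2 * \<gamma> * a\<^sup>2 - a * ((\<gamma> - 3) + (\<gamma> + 1) * M\<^sup>2) - 2
      = (a - a_sharp_sq \<gamma> M) * (2 * \<gamma> * a + 2 / a_sharp_sq \<gamma> M)"
proof -
  define \<beta> where "\<beta> = (\<gamma> - 3) + (\<gamma> + 1) * M\<^sup>2"
  define d where "d = sqrt (\<beta>\<^sup>2 + 16 * \<gamma>)"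
  define s where "s = a_sharp_sq \<gamma> M"
  have s: "s = (\<beta> + d) / (4 * \<gamma>)" by (simp add: s_def a_sharp_sq_def \<beta>_def d_def)
  have d2: "d\<^sup>2 = \<beta>\<^sup>2 + 16 * \<gamma>" unfolding d_def using \<gamma> by (intro real_sqrt_pow2) simp
  have "\<bar>\<beta>\<bar> < d" unfolding d_def using \<gamma> by (intro real_less_rsqrt) simp
  then have s0: "s > 0" unfolding s using \<gamma> by simp
  then show "a_sharp_sq \<gamma> M > 0" by (simp add: s_def)
  have "(4 * \<gamma> * s - \<beta>)\<^sup>2 = \<beta>\<^sup>2 + 16 * \<gamma>" unfolding s using \<gamma> d2 by simp
  then have "8 * \<gamma> * (2 * \<gamma> * s\<^sup>2 - \<beta> * s - 2) = 0" by (simp add: power2_eq_square algebra_simps)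
  then have "2 * \<gamma> * s\<^sup>2 - \<beta> * s - 2 = 0" using \<gamma> by simp
  then have \<beta>: "\<beta> = 2 * \<gamma> * s - 2 / s" using s0 by (simp add: field_simps power2_eq_square)
  show "2 * \<gamma> * a\<^sup>2 - a * ((\<gamma> - 3) + (\<gamma> + 1) * M\<^sup>2) - 2
      = (a - a_sharp_sq \<gamma> M) * (2 * \<gamma> * a + 2 / a_sharp_sq \<gamma> M)"
    unfolding \<beta>_def[symmetric] s_def[symmetric] unfolding \<beta> using s0
    by (simp add: field_simps power2_eq_square)
qed

lemma a_sharp_sq_gt_1:
  assumes "\<gamma> > 1" "M\<^sup>2 > 1"
  shows "a_sharp_sq \<gamma> M > 1"
proof (rule ccontr)
  assume "\<not> ?thesis"
  then have "0 \<le> (1 - a_sharp_sq \<gamma> M) * (2 * \<gamma> * 1 + 2 / a_sharp_sq \<gamma> M)"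
    using a_sharp_sq_factorization(1)[OF assms(1), of M] assms(1) by (intro mult_nonneg_nonneg) auto
  also have "\<dots> = (\<gamma> + 1) * (1 - M\<^sup>2)"
    using a_sharp_sq_factorization(2)[OF assms(1), of 1 M, symmetric] by (simp add: algebra_simps)
  also have "\<dots> < 0" using assms by (intro mult_pos_neg) auto
  finally show False by simp
qed

lemma sonic_classification:
  assumes \<gamma>: "\<gamma> > 1" and c: "c > 0" and w2: "w2 > 0"
    and e: "(\<gamma> + 1) * w2 * e = - (2 * \<gamma> * w2\<^sup>2 - w2 * ((\<gamma> - 3) * c\<^sup>2 + (\<gamma> + 1) * q\<^sup>2) - 2 * (c\<^sup>2)\<^sup>2)"
  shows "sgn e = sgn (a_sharp_sq \<gamma> (q / c) - w2 / c\<^sup>2)"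
proof -
  define s where "s = a_sharp_sq \<gamma> (q / c)"
  define a where "a = w2 / c\<^sup>2"
  have a: "a > 0" "w2 = a * c\<^sup>2" using c w2 by (simp_all add: a_def)
  have s: "s > 0" unfolding s_def by (rule a_sharp_sq_factorization(1)[OF \<gamma>])
  note e
  also have "- (2 * \<gamma> * w2\<^sup>2 - w2 * ((\<gamma> - 3) * c\<^sup>2 + (\<gamma> + 1) * q\<^sup>2) - 2 * (c\<^sup>2)\<^sup>2)
      = - ((c\<^sup>2)\<^sup>2 * (2 * \<gamma> * a\<^sup>2 - a * ((\<gamma> - 3) + (\<gamma> + 1) * (q / c)\<^sup>2) - 2))"
    unfolding a(2) using c by (simp add: field_simps power2_eq_square)
  also have "\<dots> = (c\<^sup>2)\<^sup>2 * ((2 * \<gamma> * a + 2 / s) * (s - a))"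
    unfolding a_sharp_sq_factorization(2)[OF \<gamma>] s_def[symmetric]
    by (simp only: mult_minus_right[symmetric] minus_diff_eq[of a s, symmetric] mult.commute[of "2 * \<gamma> * a + 2 / s"] mult_minus_left)
  finally have "sgn ((\<gamma> + 1) * w2 * e) = sgn ((c\<^sup>2)\<^sup>2 * ((2 * \<gamma> * a + 2 / s) * (s - a)))" by simp
  moreover have "2 * \<gamma> * a + 2 / s > 0" using \<gamma> a s by (simp add: add_pos_pos)
  ultimately show ?thesis using \<gamma> w2 c by (simp add: sgn_mult s_def a_def)
qed

section \<open>Critical angles\<close>

text \<open>
  As functions of \<open>x = sin \<theta>\<close>, the upstream polar speed is \<open>(q0\<^sup>2 * x - U03\<^sup>2 / x) / \<bar>U02\<bar>\<close>; this and the next lemma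
  reduce both critical angles to values of one increasing function.
\<close>

lemma polar_speed_strict_mono:
  fixes q2 z2 x y :: real
  assumes "q2 > 0" "z2 \<ge> 0" "0 < x" "x < y"
  shows "q2 * x - z2 / x < q2 * y - z2 / y"
proof -
  have "q2 * x < q2 * y" "z2 / y \<le> z2 / x" using assms by (auto intro!: divide_left_mono)
  then show ?thesis by linarith
qed

lemma polar_mach_formula:
  fixes U02 U03 q0 c0 \<theta> :: real
  assumes q2: "q0\<^sup>2 = U02\<^sup>2 + U03\<^sup>2" and sp: "sin \<theta> \<noteq> 0"
  shows "(U02\<^sup>2 - q0\<^sup>2 * (cos \<theta>)\<^sup>2)\<^sup>2 / (c0\<^sup>2 * U02\<^sup>2 * (sin \<theta>)\<^sup>2)
    = ((q0\<^sup>2 * sin \<theta> - U03\<^sup>2 / sin \<theta>) / (c0 * \<bar>U02\<bar>))\<^sup>2"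
proof -
  have "(q0\<^sup>2 * sin \<theta> - U03\<^sup>2 / sin \<theta>) * sin \<theta> = q0\<^sup>2 * (sin \<theta>)\<^sup>2 - U03\<^sup>2"
    using sp by (simp add: field_simps power2_eq_square)
  then have "U02\<^sup>2 - q0\<^sup>2 * (cos \<theta>)\<^sup>2 = (q0\<^sup>2 * sin \<theta> - U03\<^sup>2 / sin \<theta>) * sin \<theta>"
    unfolding cos_squared_eq using q2 by (simp add: algebra_simps)
  then show ?thesis using sp by (simp add: power_mult_distrib power_divide)
qed

text \<open>
  At this angle the upstream polar speed equals the speed of sound. The defining expression is the square of the positive
  root of \<open>q0\<^sup>2 * x\<^sup>2 - c0 * \<bar>U02\<bar> * x - U03\<^sup>2 = 0\<close>.
\<close>

lemma theta_lower_properties: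
  fixes U02 U03 q0 c0 :: real
  assumes "U02 < 0" "c0 > 0" and q0: "q0 = sqrt (U02\<^sup>2 + U03\<^sup>2)" and sup: "c0\<^sup>2 < U02\<^sup>2"
  defines "\<theta>l \<equiv> theta_lower q0 c0 U02 U03"
  shows "0 < \<theta>l" "\<theta>l < pi / 2" "q0\<^sup>2 * sin \<theta>l - U03\<^sup>2 / sin \<theta>l = c0 * \<bar>U02\<bar>"
proof -
  have q2: "q0\<^sup>2 = U02\<^sup>2 + U03\<^sup>2" unfolding q0 by simp
  have U: "\<bar>U02\<bar> > 0" using assms by simp
  have q0p: "q0\<^sup>2 > 0" unfolding q2 using assms(1) by (simp add: add_pos_nonneg)
  define h where "h = c0 * \<bar>U02\<bar>"
  have h: "h > 0" using assms(2) U by (simp add: h_def)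
  define R where "R = sqrt (4 * q0\<^sup>2 * U03\<^sup>2 + h\<^sup>2)"
  have R2: "R\<^sup>2 = 4 * q0\<^sup>2 * U03\<^sup>2 + h\<^sup>2" unfolding R_def by (intro real_sqrt_pow2) simp
  have R: "R \<ge> 0" unfolding R_def by simp
  have hh: "c0\<^sup>2 * U02\<^sup>2 = h\<^sup>2" by (simp add: h_def power_mult_distrib)
  define sl where "sl = (2 * q0\<^sup>2 * U03\<^sup>2 + h\<^sup>2 + h * R) / (2 * (q0\<^sup>2)\<^sup>2)"
  \<comment> \<open>The positive root, whose square turns out to be \<open>sl\<close>.\<close>
  define x where "x = (h + R) / (2 * q0\<^sup>2)"
  have x: "x > 0" unfolding x_def using h R q0p by simp
  have "Q * ((h + R) / (2 * Q))\<^sup>2 - h * ((h + R) / (2 * Q)) - z = (R\<^sup>2 - h\<^sup>2 - 4 * Q * z) / (4 * Q)"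
    if "Q > 0" for Q z using that by (simp add: field_simps power2_eq_square)
  from this[OF q0p, of "U03\<^sup>2"]
  have "q0\<^sup>2 * x\<^sup>2 - h * x - U03\<^sup>2 = (R\<^sup>2 - h\<^sup>2 - 4 * q0\<^sup>2 * U03\<^sup>2) / (4 * q0\<^sup>2)"
    by (simp add: x_def)
  then have root: "q0\<^sup>2 * x\<^sup>2 - h * x - U03\<^sup>2 = 0" unfolding R2 by simp
  have x2: "x\<^sup>2 = sl"
  proof -
    have "x\<^sup>2 = (h\<^sup>2 + 2 * h * R + R\<^sup>2) / (4 * (q0\<^sup>2)\<^sup>2)"
      unfolding x_def by (simp add: power_divide power2_sum power_mult_distrib)
    note this[unfolded R2]
    moreover have "(h\<^sup>2 + 2 * h * R + (4 * Q * z + h\<^sup>2)) / (4 * Q\<^sup>2) = (2 * Q * z + h\<^sup>2 + h * R) / (2 * Q\<^sup>2)"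
      if "Q > 0" for Q z using that by (simp add: field_simps)
    note this[OF q0p, of "U03\<^sup>2"]
    ultimately show ?thesis unfolding sl_def by (rule trans)
  qed
  have G: "q0\<^sup>2 * x - U03\<^sup>2 / x = h"
    using root x by (simp add: field_simps power2_eq_square)
  have x1: "x < 1"
  proof (rule ccontr)
    assume "\<not> x < 1"
    then have "q0\<^sup>2 * 1 - U03\<^sup>2 / 1 \<le> h"
      using polar_speed_strict_mono[OF q0p zero_le_power2, of 1 x U03] G by (cases "x = 1") auto
    then have "U02\<^sup>2 \<le> c0 * \<bar>U02\<bar>" by (simp add: q2 h_def)
    moreover have "c0 < \<bar>U02\<bar>" using sup assms(2) by (metis abs_of_pos power2_less_imp_less abs_ge_zero power2_abs)
    then have "c0 * \<bar>U02\<bar> < \<bar>U02\<bar> * \<bar>U02\<bar>" using U by (rule mult_strict_right_mono)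
    ultimately show False by (simp add: power2_eq_square)
  qed
  have "\<theta>l = (THE \<theta>. 0 < \<theta> \<and> \<theta> < pi / 2 \<and> (sin \<theta>)\<^sup>2 = sl)"
  proof -
    have e: "c0 * \<bar>U02\<bar> * sqrt (4 * q0\<^sup>2 * U03\<^sup>2 + c0\<^sup>2 * U02\<^sup>2) = h * R" by (simp add: h_def R_def power_mult_distrib)
    have "2 * q0 ^ 4 = 2 * (q0\<^sup>2)\<^sup>2" by simp
    then show ?thesis unfolding \<theta>l_def theta_lower_def e unfolding hh sl_def by simp
  qed
  also have "\<dots> = arcsin x"
  proof (rule the_equality)
    show "0 < arcsin x \<and> arcsin x < pi / 2 \<and> (sin (arcsin x))\<^sup>2 = sl"
      using x x1 x2 arcsin_less_arcsin[of 0 x] arcsin_less_arcsin[of x 1] by simp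
    fix \<theta> assume \<theta>: "0 < \<theta> \<and> \<theta> < pi / 2 \<and> (sin \<theta>)\<^sup>2 = sl"
    then have "(sin \<theta>)\<^sup>2 = x\<^sup>2" using x2 by simp
    moreover have "sin \<theta> > 0" using \<theta> by (intro sin_gt_zero) auto
    ultimately have "sin \<theta> = x" using x by (simp add: power2_eq_iff)
    then show "\<theta> = arcsin x" using \<theta> by (metis arcsin_sin less_imp_le neg_less_0_iff_less less_trans pi_half_gt_zero)
  qed
  finally have \<theta>l: "\<theta>l = arcsin x" .
  show "0 < \<theta>l" "\<theta>l < pi / 2"
    unfolding \<theta>l using x x1 arcsin_less_arcsin[of 0 x] arcsin_less_arcsin[of x 1] by simp_all
  show "q0\<^sup>2 * sin \<theta>l - U03\<^sup>2 / sin \<theta>l = c0 * \<bar>U02\<bar>"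
    unfolding \<theta>l using x x1 G by (simp add: h_def)
qed

text \<open>
  Since \<open>1 < a_sharp_sq < a1_sq\<close>, the polar Mach number takes the required value strictly between
  \<open>theta_lower\<close> and \<open>pi / 2\<close>; there the polar speed is positive, so squaring loses nothing.
\<close>

lemma theta_sharp_exists_unique:
  fixes U02 U03 q0 c0 :: real
  assumes \<gamma>: "\<gamma> > 1" and "U02 < 0" "c0 > 0" and q0: "q0 = sqrt (U02\<^sup>2 + U03\<^sup>2)" and sup: "c0\<^sup>2 < U02\<^sup>2"
    and sharp: "a_sharp_sq \<gamma> (q0 / c0) < U02\<^sup>2 / c0\<^sup>2"
  shows "\<exists>!\<theta>. is_theta_sharp \<gamma> q0 c0 U02 U03 \<theta>"
proof -
  define \<theta>l where "\<theta>l = theta_lower q0 c0 U02 U03"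
  note \<theta>l = theta_lower_properties[OF assms(2-5), folded \<theta>l_def]
  define G where "G \<theta> = q0\<^sup>2 * sin \<theta> - U03\<^sup>2 / sin \<theta>" for \<theta>
  define s where "s = a_sharp_sq \<gamma> (q0 / c0)"
  have q2: "q0\<^sup>2 = U02\<^sup>2 + U03\<^sup>2" unfolding q0 by simp
  have q0p: "q0\<^sup>2 > 0" unfolding q2 using assms(2) by (simp add: add_pos_nonneg)
  have U: "\<bar>U02\<bar> > 0" using assms by simp
  have "c0\<^sup>2 < q0\<^sup>2" using sup zero_le_power2[of U03] unfolding q2 by linarith
  then have "(q0 / c0)\<^sup>2 > 1" using assms(3) by (simp add: power_divide)
  then have s1: "s > 1" unfolding s_def by (rule a_sharp_sq_gt_1[OF \<gamma>])
  define h where "h = c0 * \<bar>U02\<bar> * sqrt s"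
  have h_low: "c0 * \<bar>U02\<bar> < h" unfolding h_def using s1 assms(3) U by simp
  have h_up: "h < U02\<^sup>2"
  proof -
    have "sqrt s < sqrt (U02\<^sup>2 / c0\<^sup>2)" using sharp by (simp add: s_def)
    then have "sqrt s < \<bar>U02\<bar> / c0" using assms(3) by (simp add: real_sqrt_divide)
    then have "c0 * sqrt s < \<bar>U02\<bar>" using assms(3) by (simp add: field_simps)
    then have "\<bar>U02\<bar> * (c0 * sqrt s) < \<bar>U02\<bar> * \<bar>U02\<bar>" using U by (rule mult_strict_left_mono)
    also have "\<bar>U02\<bar> * \<bar>U02\<bar> = U02\<^sup>2" by (simp add: power2_eq_square)
    finally show ?thesis by (simp add: h_def mult_ac)
  qed
  have mono: "G x < G y" if "0 < x" "x < y" "y \<le> pi / 2" for x y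
    unfolding G_def using that
    by (intro polar_speed_strict_mono q0p sin_gt_zero sin_monotone_2pi) auto
  have iff: "is_theta_sharp \<gamma> q0 c0 U02 U03 \<theta> \<longleftrightarrow> \<theta>l < \<theta> \<and> \<theta> < pi / 2 \<and> G \<theta> = h" for \<theta>
  proof (cases "\<theta>l < \<theta> \<and> \<theta> < pi / 2")
    case True
    then have \<theta>: "0 < \<theta>" "\<theta> < pi / 2" using \<theta>l by auto
    have sp: "sin \<theta> > 0" using \<theta> by (intro sin_gt_zero) auto
    have "G \<theta>l < G \<theta>" using True \<theta>l \<theta> by (intro mono) auto
    then have Gp: "G \<theta> > 0" using \<theta>l(3) assms(3) U by (simp add: G_def) (smt (verit) mult_pos_pos)
    have "(U02\<^sup>2 - q0\<^sup>2 * (cos \<theta>)\<^sup>2)\<^sup>2 / (c0\<^sup>2 * U02\<^sup>2 * (sin \<theta>)\<^sup>2) = (G \<theta> / (c0 * \<bar>U02\<bar>))\<^sup>2"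
      unfolding G_def using sp by (intro polar_mach_formula q2) simp
    moreover have "(G \<theta> / (c0 * \<bar>U02\<bar>))\<^sup>2 = s \<longleftrightarrow> G \<theta> / (c0 * \<bar>U02\<bar>) = sqrt s"
      using Gp s1 assms(3) U by (smt (verit) divide_pos_pos mult_pos_pos real_sqrt_pow2 real_sqrt_unique)
    moreover have "G \<theta> / (c0 * \<bar>U02\<bar>) = sqrt s \<longleftrightarrow> G \<theta> = h"
      using assms(3) U by (simp add: h_def field_simps)
    ultimately show ?thesis using True by (simp add: is_theta_sharp_def \<theta>l_def s_def)
  qed (auto simp: is_theta_sharp_def \<theta>l_def)
  have Gl: "G \<theta>l = c0 * \<bar>U02\<bar>" using \<theta>l(3) by (simp add: G_def)
  have Gpi: "G (pi / 2) = U02\<^sup>2" by (simp add: G_def q2)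
  have "\<exists>x\<ge>\<theta>l. x \<le> pi / 2 \<and> G x = h"
  proof (rule IVT')
    show "continuous_on {\<theta>l..pi / 2} G" unfolding G_def
    proof (intro continuous_intros ballI)
      fix x assume "x \<in> {\<theta>l..pi / 2}"
      then have "sin x > 0" using \<theta>l by (intro sin_gt_zero) auto
      then show "sin x \<noteq> 0" by simp
    qed
  qed (use Gl Gpi h_low h_up \<theta>l in auto)
  then obtain x where x: "\<theta>l \<le> x" "x \<le> pi / 2" "G x = h" by blast
  have x': "\<theta>l < x" "x < pi / 2"
    using x Gl Gpi h_low h_up by (metis less_le less_irrefl)+
  show ?thesis
  proof (rule ex1I[of _ x])
    show "is_theta_sharp \<gamma> q0 c0 U02 U03 x" using x x' iff by simp
    fix y assume "is_theta_sharp \<gamma> q0 c0 U02 U03 y"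
    then have "\<theta>l < y" "y < pi / 2" "G y = h" using iff by auto
    then show "y = x" using x x' \<theta>l(1) mono[of x y] mono[of y x] by (cases x y rule: linorder_cases) auto
  qed
qed

section \<open>Construction of the two flows\<close>

lemma conic_flow_onI:
  fixes \<rho> u v z \<rho>' u' v' z' :: "real \<Rightarrow> real" and A :: real
  assumes I: "\<And>x. x \<in> I \<Longrightarrow> at x within I \<noteq> bot"
    and smooth: "smooth_fun_on I \<rho>" "smooth_fun_on I u" "smooth_fun_on I v" "smooth_fun_on I z"
    and pos: "\<And>x. x \<in> I \<Longrightarrow> \<rho> x > 0"
    and d: "\<And>x. x \<in> I \<Longrightarrow> (\<rho> has_real_derivative \<rho>' x) (at x within I)"
      "\<And>x. x \<in> I \<Longrightarrow> (u has_real_derivative u' x) (at x within I)"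
      "\<And>x. x \<in> I \<Longrightarrow> (v has_real_derivative v' x) (at x within I)"
      "\<And>x. x \<in> I \<Longrightarrow> (z has_real_derivative z' x) (at x within I)"
    and eqs: "\<And>x. x \<in> I \<Longrightarrow> \<rho>' x * v x + \<rho> x * v' x + 2 * \<rho> x * u x + cot x * \<rho> x * v x = 0"
      "\<And>x. x \<in> I \<Longrightarrow> v x * u' x = (v x)\<^sup>2 + (z x)\<^sup>2"
      "\<And>x. x \<in> I \<Longrightarrow> v x * v' x + \<gamma> * A * \<rho> x powr (\<gamma> - 1) * (\<rho>' x / \<rho> x) + u x * v x - (z x)\<^sup>2 * cot x = 0"
      "\<And>x. x \<in> I \<Longrightarrow> v x * z' x + u x * z x + v x * z x * cot x = 0"
  shows "conic_flow_on \<gamma> I \<lparr>density = \<rho>, U1 = u, U2 = v, U3 = z, entropy = (\<lambda>_. A)\<rparr>"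
proof -
  define W where "W = \<lparr>density = \<rho>, U1 = u, U2 = v, U3 = z, entropy = (\<lambda>_::real. A)\<rparr>"
  have sel: "density W = \<rho>" "U1 W = u" "U2 W = v" "U3 W = z" "entropy W = (\<lambda>_. A)"
    by (simp_all add: W_def)
  have A: "smooth_fun_on I (\<lambda>_. A)"
    by (rule smooth_if_generators_closed[of "{}"]) (auto intro: alg_const)
  have "conic_euler_on \<gamma> I W"
    unfolding conic_euler_on_def
  proof (intro ballI conjI)
    fix x assume x: "x \<in> I"
    have dA: "((\<lambda>_. A) has_real_derivative 0) (at x within I)" by simp
    have D: "deriv_on I (\<lambda>s. \<rho> s * v s) x = \<rho>' x * v x + v' x * \<rho> x" "deriv_on I u x = u' x"
      "deriv_on I v x = v' x" "deriv_on I z x = z' x" "deriv_on I (\<lambda>_. A) x = 0"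
      by (intro deriv_on_eqI I x DERIV_mult d dA)+
    have "deriv_on I (pressure \<gamma> W) x = density W x * (0 * density W x powr (\<gamma> - 1)
       + \<gamma> * entropy W x * density W x powr (\<gamma> - 1) * (\<rho>' x / density W x))"
      by (intro deriv_on_eqI I x pressure_derivative) (simp_all add: sel d x dA pos)
    then have P: "1 / \<rho> x * deriv_on I (pressure \<gamma> W) x = \<gamma> * A * \<rho> x powr (\<gamma> - 1) * (\<rho>' x / \<rho> x)"
      using pos[OF x] by (simp add: sel)
    show "deriv_on I (\<lambda>s. density W s * U2 W s) x + 2 * density W x * U1 W x
          + cot x * density W x * U2 W x = 0"
      using eqs(1)[OF x] by (simp add: sel D mult_ac)
    show "U2 W x * deriv_on I (U1 W) x - ((U2 W x)\<^sup>2 + (U3 W x)\<^sup>2) = 0"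
      using eqs(2)[OF x] by (simp add: sel D)
    show "U2 W x * deriv_on I (U2 W) x + 1 / density W x * deriv_on I (pressure \<gamma> W) x
          + U1 W x * U2 W x - (U3 W x)\<^sup>2 * cot x = 0"
      unfolding sel P D by (rule eqs(3)[OF x])
    show "U2 W x * deriv_on I (U3 W) x + U1 W x * U3 W x + U2 W x * U3 W x * cot x = 0"
      using eqs(4)[OF x] by (simp add: sel D)
    show "U2 W x * deriv_on I (entropy W) x = 0" by (simp add: sel D)
  qed
  then show ?thesis
    using smooth A pos unfolding W_def[symmetric] conic_flow_on_def smooth_flow_on_def by (simp add: sel)
qed

lemma sqrt_log_derivative:
  fixes g :: "real \<Rightarrow> real"
  assumes "(g has_real_derivative d) (at x within I)" "g x > 0"
  shows "((\<lambda>s. sqrt (g s)) has_real_derivative sqrt (g x) * (d / (2 * g x))) (at x within I)"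
proof -
  have "inverse (sqrt (g x)) = sqrt (g x) / g x"
    using assms(2) by (metis real_div_sqrt less_imp_le inverse_divide divide_inverse inverse_eq_divide)
  then have "(inverse (sqrt (g x)) / 2) * d = sqrt (g x) * (d / (2 * g x))" by simp
  with DERIV_chain2[OF DERIV_real_sqrt[OF assms(2)] assms(1)] show ?thesis by (simp only:)
qed

text \<open>
  The profile of \<open>constant_density_profile\<close>, with \<open>U3 = U03 * sqrt g / sin\<close> and
  \<open>U2 = U02 * g / sin\<close> for \<open>g = 1 - k / a * cos\<^sup>2\<close>. The assumption says that \<open>g\<close>, and with it the flow towards the
  axis, is positive at \<open>\<theta>b\<close>; without it the square root would not be smooth.
\<close>

lemma upstream_flow_exists:
  fixes \<gamma> \<rho>0 A0 U02 U03 \<theta>b :: real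
  assumes "\<rho>0 > 0" "U02 < 0" "0 < \<theta>b" "\<theta>b < pi / 2"
    and moving: "(U02\<^sup>2 + U03\<^sup>2) * (cos \<theta>b)\<^sup>2 < U02\<^sup>2"
  defines "k \<equiv> (U02\<^sup>2 + U03\<^sup>2) / - U02"
  obtains W where "conic_flow_on \<gamma> {\<theta>b..pi / 2} W" "\<And>x. density W x = \<rho>0" "\<And>x. entropy W x = A0"
    "\<And>x. U1 W x = k * cos x" "\<And>x. U2 W x = - (- U02 - k * (cos x)\<^sup>2) / sin x"
    "U3 W (pi / 2) = U03"
    "\<And>x. x \<in> {\<theta>b..pi / 2} \<Longrightarrow> (U3 W x)\<^sup>2 = U03\<^sup>2 * (- U02 - k * (cos x)\<^sup>2) / (- U02 * (sin x)\<^sup>2)"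
proof -
  define J where "J = {\<theta>b..pi / 2}"
  have Jbot: "at x within J \<noteq> bot" if "x \<in> J" for x
    unfolding J_def using that assms by (intro interval_limit_point[of _ \<theta>b "pi/2"]) (auto simp: J_def)
  have sinJ: "sin x > 0" if "x \<in> J" for x using that assms by (auto simp: J_def intro!: sin_gt_zero)
  define a where "a = - U02"
  have a: "a > 0" "U02 = - a" using assms by (simp_all add: a_def)
  define g where "g x = 1 - k / a * (cos x)\<^sup>2" for x
  have k: "k * a = a\<^sup>2 + U03\<^sup>2" using a by (simp add: k_def)
  have k0: "k \<ge> 0" unfolding k_def a(2) using a(1) by simp
  have g: "g x > 0" if x: "x \<in> J" for x
  proof -
    have "cos x \<le> cos \<theta>b" "0 \<le> cos x"
      using x assms by (auto simp: J_def intro!: cos_monotone_0_pi_le cos_ge_zero)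
    then have "(cos x)\<^sup>2 \<le> (cos \<theta>b)\<^sup>2" by (intro power_mono)
    then have "k * a * (cos x)\<^sup>2 \<le> k * a * (cos \<theta>b)\<^sup>2" using k0 a by (intro mult_left_mono) auto
    also have "\<dots> < a\<^sup>2" using moving by (simp add: k a(2))
    finally show ?thesis using a by (simp add: g_def field_simps power2_eq_square)
  qed
  define s where "s x = inverse (sin x)" for x :: real
  define ig where "ig x = inverse (g x)" for x
  define u where "u x = k * cos x" for x
  define v where "v x = - (- U02 - k * (cos x)\<^sup>2) / sin x" for x
  define z where "z x = U03 * sqrt (g x) * s x" for x
  have v_g: "v x = - a * g x * s x" for x
    using a by (simp add: v_def g_def s_def divide_inverse algebra_simps)
  have dg: "(g has_real_derivative 2 * k / a * cos x * sin x) (at x within J)" for x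
    unfolding g_def using a(1) by (auto intro!: derivative_eq_intros)
  have ds: "(s has_real_derivative - (cos x * (s x)\<^sup>2)) (at x within J)" if "x \<in> J" for x
    unfolding s_def using sinJ[OF that]
    by (auto intro!: derivative_eq_intros simp: power2_eq_square)
  have du: "(u has_real_derivative - k * sin x) (at x within J)" for x
    unfolding u_def by (auto intro!: derivative_eq_intros)
  have dv: "(v has_real_derivative - a * (2 * k / a * cos x * sin x * s x + - (cos x * (s x)\<^sup>2) * g x)) (at x within J)"
    if x: "x \<in> J" for x
  proof -
    have "((\<lambda>x. - a * (g x * s x)) has_real_derivative
        - a * (2 * k / a * cos x * sin x * s x + - (cos x * (s x)\<^sup>2) * g x)) (at x within J)"
      by (intro DERIV_cmult DERIV_mult dg ds x)
    then show ?thesis by (simp add: v_g[abs_def] mult_ac)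
  qed
  have dz: "(z has_real_derivative z x * (k / a * cos x * sin x * ig x - cos x * s x)) (at x within J)"
    if x: "x \<in> J" for x
  proof -
    have "(z has_real_derivative
        U03 * (sqrt (g x) * (2 * k / a * cos x * sin x / (2 * g x))) * s x
        + - (cos x * (s x)\<^sup>2) * (U03 * sqrt (g x))) (at x within J)"
      unfolding z_def by (intro DERIV_mult DERIV_cmult sqrt_log_derivative dg ds g x)
    moreover have "2 * k / a * cos x * sin x / (2 * g x) = k / a * cos x * sin x * ig x"
      using g[OF x] a(1) by (simp add: ig_def field_simps)
    ultimately have "(z has_real_derivative
        U03 * (sqrt (g x) * (k / a * cos x * sin x * ig x)) * s x
        + - (cos x * (s x)\<^sup>2) * (U03 * sqrt (g x))) (at x within J)" by (simp only:)
    moreover have "U03 * (R * T) * y + - (c * y\<^sup>2) * (U03 * R) = U03 * R * y * (T - c * y)" for R T y c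
      by (simp add: algebra_simps power2_eq_square)
    ultimately show ?thesis by (simp only: z_def)
  qed
  have dig: "(ig has_real_derivative - (ig x * (2 * k / a * cos x * sin x) * ig x)) (at x within J)" if "x \<in> J" for x
    unfolding ig_def using g[OF that] dg[of x]
    by (intro DERIV_inverse'[THEN DERIV_cong]) (auto simp: mult_ac)
  define G where "G = {cos, sin, s, g, ig, z}"
  have mem: "alg_generated G cos" "alg_generated G sin" "alg_generated G s" "alg_generated G g"
    "alg_generated G ig" "alg_generated G z"
    by (auto intro!: alg_gen simp: G_def)
  have closed: "\<exists>f'. alg_generated G f' \<and> (\<forall>x\<in>J. (f has_real_derivative f' x) (at x within J))" if fG: "f \<in> G" for f
  proof -
    consider "f = cos" | "f = sin" | "f = s" | "f = g" | "f = ig" | "f = z" using fG by (auto simp: G_def)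
    then show ?thesis
    proof cases
      case 1
      show ?thesis unfolding 1
        by (rule exI[of _ "\<lambda>x. - sin x"], intro conjI ballI alg_intros mem)
          (auto intro!: derivative_eq_intros)
    next
      case 2
      show ?thesis unfolding 2
        by (rule exI[of _ "\<lambda>x. cos x"], intro conjI ballI alg_intros mem)
          (auto intro!: derivative_eq_intros)
    next
      case 3
      show ?thesis unfolding 3
        by (rule exI[of _ "\<lambda>x. - (cos x * (s x)\<^sup>2)"], intro conjI ballI alg_intros mem ds)
    next
      case 4
      show ?thesis unfolding 4
        by (rule exI[of _ "\<lambda>x. 2 * k / a * cos x * sin x"], intro conjI ballI alg_intros mem dg)
    next
      case 5
      show ?thesis unfolding 5
        by (rule exI[of _ "\<lambda>x. - (ig x * (2 * k / a * cos x * sin x) * ig x)"], intro conjI ballI alg_intros mem dig)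
    next
      case 6
      show ?thesis unfolding 6
        by (rule exI[of _ "\<lambda>x. z x * (k / a * cos x * sin x * ig x - cos x * s x)"], intro conjI ballI alg_intros mem dz)
    qed
  qed
  have sm: "smooth_fun_on J f" if "alg_generated G f" for f
    by (rule smooth_if_generators_closed[OF closed that])
  have zz: "(z x)\<^sup>2 = U03\<^sup>2 * g x * (s x)\<^sup>2" if "x \<in> J" for x
    using g[OF that] by (simp add: z_def power_mult_distrib)
  have flow: "conic_flow_on \<gamma> J \<lparr>density = (\<lambda>_. \<rho>0), U1 = u, U2 = v, U3 = z, entropy = (\<lambda>_. A0)\<rparr>"
  proof (rule conic_flow_onI[OF Jbot, where \<rho>' = "\<lambda>_. 0"])
    show "smooth_fun_on J (\<lambda>_. \<rho>0)" by (rule sm) (intro alg_intros)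
    show "smooth_fun_on J u" unfolding u_def by (rule sm) (intro alg_intros mem)
    show "smooth_fun_on J z" by (rule sm) (intro mem)
    have "smooth_fun_on J (\<lambda>x. - a * g x * s x)" by (rule sm) (intro alg_intros mem)
    then show "smooth_fun_on J v" by (simp add: v_g[abs_def])
    fix x assume x: "x \<in> J"
    show "((\<lambda>_. \<rho>0) has_real_derivative 0) (at x within J)" by simp
    show "\<rho>0 > 0" by fact
    have sx: "sin x * s x = 1" using sinJ[OF x] by (simp add: s_def)
    have c: "cot x = cos x * s x" by (simp add: cot_def s_def divide_inverse)
    have ag: "a * g x = a - k * (cos x)\<^sup>2" using a by (simp add: g_def field_simps)
    have gi: "g x * ig x = 1" using g[OF x] by (simp add: ig_def)
    have dv': "- a * (2 * k / a * cos x * sin x * s x + - (cos x * (s x)\<^sup>2) * g x)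
        = - 2 * k * cos x + a * g x * cos x * (s x)\<^sup>2"
    proof -
      have "- a * (2 * k / a * cos x * sin x * s x + - (cos x * (s x)\<^sup>2) * g x)
          = - 2 * k * cos x * (sin x * s x) + a * g x * cos x * (s x)\<^sup>2"
        using a by (simp add: field_simps)
      then show ?thesis unfolding sx by simp
    qed
    show "(u has_real_derivative - k * sin x) (at x within J)" by (rule du)
    show "(v has_real_derivative - 2 * k * cos x + a * g x * cos x * (s x)\<^sup>2) (at x within J)"
      using dv[OF x] unfolding dv' .
    show "(z has_real_derivative z x * (k / a * cos x * sin x * ig x - cos x * s x)) (at x within J)"
      by (rule dz[OF x])
    show "0 * v x + \<rho>0 * (- 2 * k * cos x + a * g x * cos x * (s x)\<^sup>2) + 2 * \<rho>0 * u x + cot x * \<rho>0 * v x = 0"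
      unfolding c v_g u_def by (simp add: algebra_simps power2_eq_square)
    \<comment> \<open>The squared speed transverse to the ray, from which radial and polar momentum follow.\<close>
    have S: "(v x)\<^sup>2 + (z x)\<^sup>2 = k * a * g x"
    proof -
      have "a * (a * g x) + U03\<^sup>2 = (a\<^sup>2 + U03\<^sup>2) - k * a * (cos x)\<^sup>2"
        unfolding ag by (simp add: algebra_simps power2_eq_square)
      also have "\<dots> = k * a * (sin x)\<^sup>2"
        unfolding k[symmetric] sin_squared_eq by (simp add: algebra_simps)
      finally have "g x * (s x)\<^sup>2 * (a * (a * g x) + U03\<^sup>2) = k * a * g x * (sin x * s x)\<^sup>2"
        by (simp add: power_mult_distrib algebra_simps)
      then show ?thesis unfolding sx unfolding zz[OF x] v_g by (simp add: algebra_simps power2_eq_square)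
    qed
    have vu: "v x * (k * sin x) = - (k * a * g x)"
    proof -
      have "v x * (k * sin x) = - (k * a * g x) * (sin x * s x)" unfolding v_g by (simp add: algebra_simps)
      then show ?thesis unfolding sx by simp
    qed
    show "v x * (- k * sin x) = (v x)\<^sup>2 + (z x)\<^sup>2" unfolding S using vu by simp
    show "v x * (- 2 * k * cos x + a * g x * cos x * (s x)\<^sup>2)
        + \<gamma> * A0 * \<rho>0 powr (\<gamma> - 1) * (0 / \<rho>0) + u x * v x - (z x)\<^sup>2 * cot x = 0"
    proof -
      have "v x * (- 2 * k * cos x + a * g x * cos x * (s x)\<^sup>2) + u x * v x - (z x)\<^sup>2 * cot x
          = - (v x * k * cos x) - cot x * ((v x)\<^sup>2 + (z x)\<^sup>2)"
        unfolding c u_def by (simp add: v_g algebra_simps power2_eq_square)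
      also have "\<dots> = 0" unfolding S unfolding c v_g by (simp add: algebra_simps)
      finally show ?thesis by simp
    qed
    show "v x * (z x * (k / a * cos x * sin x * ig x - cos x * s x)) + u x * z x + v x * z x * cot x = 0"
    proof -
      have "v x * (k / a * cos x * sin x * ig x) = - (k * cos x * (sin x * s x) * (g x * ig x))"
        unfolding v_g using a by (simp add: field_simps)
      then have "v x * (k / a * cos x * sin x * ig x) = - u x" unfolding sx gi u_def by simp
      moreover have "v x * (z x * (k / a * cos x * sin x * ig x - cos x * s x)) + u x * z x + v x * z x * cot x
          = z x * (v x * (k / a * cos x * sin x * ig x) + u x)" unfolding c by (simp add: algebra_simps)
      ultimately show ?thesis by simp
    qed
  qed
  show ?thesis
  proof (rule that[OF flow[unfolded J_def]])
    show "U3 \<lparr>density = (\<lambda>_. \<rho>0), U1 = u, U2 = v, U3 = z, entropy = (\<lambda>_. A0)\<rparr> (pi / 2) = U03"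
      by (simp add: z_def s_def g_def)
    fix x assume x: "x \<in> {\<theta>b..pi / 2}"
    have "U03\<^sup>2 * (- U02 - k * (cos x)\<^sup>2) / (- U02 * (sin x)\<^sup>2) = U03\<^sup>2 * g x * (s x)\<^sup>2"
      using a by (simp add: g_def s_def divide_inverse power_mult_distrib algebra_simps power2_eq_square)
    then show "(U3 \<lparr>density = (\<lambda>_. \<rho>0), U1 = u, U2 = v, U3 = z, entropy = (\<lambda>_. A0)\<rparr> x)\<^sup>2
        = U03\<^sup>2 * (- U02 - k * (cos x)\<^sup>2) / (- U02 * (sin x)\<^sup>2)"
      using zz[of x] x by (simp add: J_def)
  qed (simp_all add: u_def v_def)
qed

text \<open>
  The swirl is recovered from \<open>compressive_branch\<close> as \<open>z = zb * sqrt g\<close>, where \<open>g\<close> is \<open>\<rho> * w / sin\<close> normalised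
  by its value at the shock. This keeps the sign of \<open>zb\<close> and covers \<open>zb = 0\<close>.
\<close>

lemma downstream_flow_exists:
  fixes \<gamma> A \<theta>b ub wb \<rho>b zb :: real
  assumes pos: "\<gamma> > 1" "A > 0" "0 < \<theta>b" "\<theta>b < pi / 2" "ub > 0" "wb > 0" "\<rho>b > 0"
    and subsonic: "wb\<^sup>2 < \<gamma> * A * \<rho>b powr (\<gamma> - 1)" and swirl: "zb\<^sup>2 \<le> \<gamma> * A * \<rho>b powr (\<gamma> - 1)"
    and compression: "cot \<theta>b * (wb + zb\<^sup>2 / wb) < ub"
  obtains \<theta>w W where "0 < \<theta>w" "\<theta>w < \<theta>b" "conic_flow_on \<gamma> {\<theta>w<..\<theta>b} W"
    "density W \<theta>b = \<rho>b" "U1 W \<theta>b = ub" "U2 W \<theta>b = - wb" "U3 W \<theta>b = zb" "entropy W \<theta>b = A"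
    "(U2 W \<longlongrightarrow> 0) (at_right \<theta>w)"
proof -
  have sinb: "sin \<theta>b > 0" using pos by (intro sin_gt_zero) auto
  define \<kappa> where "\<kappa> = zb\<^sup>2 * sin \<theta>b / (wb * \<rho>b)"
  have \<kappa>0: "\<kappa> \<ge> 0" unfolding \<kappa>_def using pos sinb by simp
  have \<kappa>b: "\<kappa> * \<rho>b / sin \<theta>b = zb\<^sup>2 / wb" unfolding \<kappa>_def using pos sinb by simp
  have "wb * (\<kappa> * \<rho>b / sin \<theta>b) \<le> \<gamma> * A * \<rho>b powr (\<gamma> - 1)" unfolding \<kappa>b using swirl pos by simp
  moreover have "cot \<theta>b * (wb + \<kappa> * \<rho>b / sin \<theta>b) < ub" unfolding \<kappa>b by (rule compression)
  ultimately obtain \<theta>w u w \<rho> r where \<theta>w: "0 < \<theta>w" "\<theta>w < \<theta>b"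
    and init: "u \<theta>b = ub" "w \<theta>b = wb" "\<rho> \<theta>b = \<rho>b"
    and sol: "compressive_branch \<gamma> A \<kappa> {\<theta>w<..\<theta>b} u w \<rho> r"
    and lim: "(w \<longlongrightarrow> 0) (at_right \<theta>w)"
    by (rule downstream_branch[OF pos(1,2) \<kappa>0 pos(3-7) subsonic]) blast
  define I where "I = {\<theta>w<..\<theta>b}"
  have Ibot: "at x within I \<noteq> bot" if "x \<in> I" for x
    using that \<theta>w by (intro interval_limit_point[of I "(\<theta>w + \<theta>b) / 2" \<theta>b])
      (auto simp: I_def intro: convex_connected convex_real_interval)
  have sinI: "sin x > 0" if "x \<in> I" for x using that \<theta>w pos by (auto simp: I_def intro!: sin_gt_zero)
  define X where "X x = \<gamma> * A * \<rho> x powr (\<gamma> - 1)" for x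
  define s where "s x = inverse (sin x)" for x :: real
  define Z where "Z x = \<kappa> * \<rho> x * s x" for x
  define h where "h x = inverse (X x - (w x)\<^sup>2)" for x
  define iw where "iw x = inverse (w x)" for x
  define g where "g x = \<rho> x * w x * s x * (sin \<theta>b / (\<rho>b * wb))" for x
  define z where "z x = zb * sqrt (g x)" for x
  have S: "w x > 0" "\<rho> x > 0" "X x - (w x)\<^sup>2 > 0"
    "r x = w x * (u x - cos x * s x * (w x + Z x)) * h x"
    "(u has_real_derivative - (w x + Z x)) (at x within I)"
    "(w has_real_derivative 2 * u x - w x * (cos x * s x) + w x * r x) (at x within I)"
    "(\<rho> has_real_derivative - (\<rho> x * r x)) (at x within I)" if "x \<in> I" for x
  proof -
    have c: "cot x = cos x * s x" by (simp add: cot_def s_def divide_inverse)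
    have zs: "\<kappa> * \<rho> x / sin x = Z x" by (simp add: Z_def s_def divide_inverse)
    have hX: "y / (X x - (w x)\<^sup>2) = y * h x" for y by (simp add: h_def divide_inverse)
    note * = sol[unfolded compressive_branch_def, rule_format, of x, unfolded c zs, folded I_def X_def, unfolded hX, OF that]
    show "w x > 0" "\<rho> x > 0" "r x = w x * (u x - cos x * s x * (w x + Z x)) * h x"
      "(u has_real_derivative - (w x + Z x)) (at x within I)"
      "(w has_real_derivative 2 * u x - w x * (cos x * s x) + w x * r x) (at x within I)"
      "(\<rho> has_real_derivative - (\<rho> x * r x)) (at x within I)"
      using * by blast+
    have "(w x)\<^sup>2 < X x" using * by blast
    then show "X x - (w x)\<^sup>2 > 0" by simp
  qed
  have ds: "(s has_real_derivative - (cos x * (s x)\<^sup>2)) (at x within I)" if "x \<in> I" for x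
    unfolding s_def using sinI[OF that] by (auto intro!: derivative_eq_intros simp: power2_eq_square)
  have dX: "(X has_real_derivative - (\<gamma> - 1) * X x * r x) (at x within I)" if x: "x \<in> I" for x
    unfolding X_def
    using DERIV_cmult[OF powr_log_derivative[OF S(7)[OF x] S(2)[OF x], of "\<gamma> - 1"], of "\<gamma> * A"] S(2)[OF x]
    by (simp add: algebra_simps)
  have dh: "(h has_real_derivative - (h x * (- (\<gamma> - 1) * X x * r x
      - 2 * w x * (2 * u x - w x * (cos x * s x) + w x * r x)) * h x)) (at x within I)" if x: "x \<in> I" for x
  proof -
    have "((\<lambda>x. X x - (w x)\<^sup>2) has_real_derivative - (\<gamma> - 1) * X x * r x
      - 2 * w x * (2 * u x - w x * (cos x * s x) + w x * r x)) (at x within I)"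
      using dX[OF x] S(6)[OF x] by (auto intro!: derivative_eq_intros)
    then show ?thesis unfolding h_def using S(3)[OF x] by (intro DERIV_inverse') auto
  qed
  have diw: "(iw has_real_derivative - (iw x * (2 * u x - w x * (cos x * s x) + w x * r x) * iw x)) (at x within I)"
    if x: "x \<in> I" for x
    unfolding iw_def using S(1,6)[OF x] by (intro DERIV_inverse') auto
  have g: "g x > 0" if "x \<in> I" for x
    unfolding g_def s_def using S(1,2)[OF that] sinI[OF that] sinb pos by simp
  have dz: "(z has_real_derivative z x * (u x * iw x - cos x * s x)) (at x within I)" if x: "x \<in> I" for x
  proof -
    have "(g has_real_derivative
        ((- (\<rho> x * r x) * w x + (2 * u x - w x * (cos x * s x) + w x * r x) * \<rho> x) * s x
          + - (cos x * (s x)\<^sup>2) * (\<rho> x * w x)) * (sin \<theta>b / (\<rho>b * wb))) (at x within I)"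
      unfolding g_def by (intro DERIV_cmult_right DERIV_mult S(6,7) ds x)
    also have "((- (\<rho> x * r x) * w x + (2 * u x - w x * (cos x * s x) + w x * r x) * \<rho> x) * s x
          + - (cos x * (s x)\<^sup>2) * (\<rho> x * w x)) = \<rho> x * s x * (2 * (u x - w x * (cos x * s x)))"
      by (simp add: algebra_simps power2_eq_square)
    also have "\<dots> = \<rho> x * w x * s x * (2 * (u x * iw x - cos x * s x))"
      using S(1)[OF x] by (simp add: iw_def algebra_simps)
    finally have "(g has_real_derivative g x * (2 * (u x * iw x - cos x * s x))) (at x within I)"
      by (simp only: g_def[abs_def] mult_ac)
    from DERIV_cmult[OF sqrt_log_derivative[OF this g[OF x]], of zb]
    have "(z has_real_derivative zb * (sqrt (g x) * (g x * (2 * (u x * iw x - cos x * s x)) / (2 * g x)))) (at x within I)"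
      by (simp only: z_def[abs_def])
    moreover have "zb * (sqrt (g x) * (g x * (2 * q) / (2 * g x))) = z x * q" for q
      unfolding z_def using g[OF x] by simp
    ultimately show ?thesis by (simp only:)
  qed
  define G where "G = {cos, sin, s, u, w, \<rho>, X, h, iw, z}"
  have mem: "alg_generated G cos" "alg_generated G sin" "alg_generated G s" "alg_generated G u"
    "alg_generated G w" "alg_generated G \<rho>" "alg_generated G X" "alg_generated G h" "alg_generated G iw"
    "alg_generated G z"
    by (auto intro!: alg_gen simp: G_def)
  define rp where "rp x = w x * (u x - cos x * s x * (w x + \<kappa> * \<rho> x * s x)) * h x" for x
  have memr: "alg_generated G rp" unfolding rp_def by (intro alg_intros mem)
  have r: "r x = rp x" if "x \<in> I" for x using S(4)[OF that] by (simp add: rp_def Z_def)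
  have closed: "\<exists>f'. alg_generated G f' \<and> (\<forall>x\<in>I. (f has_real_derivative f' x) (at x within I))" if fG: "f \<in> G" for f
  proof -
    consider "f = cos" | "f = sin" | "f = s" | "f = u" | "f = w" | "f = \<rho>" | "f = X" | "f = h" | "f = iw" | "f = z"
      using fG by (auto simp: G_def)
    then show ?thesis
    proof cases
      case 1
      show ?thesis unfolding 1
        by (rule exI[of _ "\<lambda>x. - sin x"], intro conjI ballI alg_intros mem)
          (auto intro!: derivative_eq_intros)
    next
      case 2
      show ?thesis unfolding 2
        by (rule exI[of _ "\<lambda>x. cos x"], intro conjI ballI alg_intros mem)
          (auto intro!: derivative_eq_intros)
    next
      case 3
      show ?thesis unfolding 3
        by (rule exI[of _ "\<lambda>x. - (cos x * (s x)\<^sup>2)"], intro conjI ballI alg_intros mem ds)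
    next
      case 4
      show ?thesis unfolding 4
        by (rule exI[of _ "\<lambda>x. - (w x + \<kappa> * \<rho> x * s x)"], intro conjI ballI alg_intros mem)
          (use S(5) in \<open>simp add: Z_def\<close>)
    next
      case 5
      show ?thesis unfolding 5
        by (rule exI[of _ "\<lambda>x. 2 * u x - w x * (cos x * s x) + w x * rp x"], intro conjI ballI alg_intros mem memr)
          (use S(6) r in simp)
    next
      case 6
      show ?thesis unfolding 6
        by (rule exI[of _ "\<lambda>x. - (\<rho> x * rp x)"], intro conjI ballI alg_intros mem memr)
          (use S(7) r in simp)
    next
      case 7
      show ?thesis unfolding 7
        by (rule exI[of _ "\<lambda>x. - (\<gamma> - 1) * X x * rp x"], intro conjI ballI alg_intros mem memr)
          (use dX r in simp)
    next
      case 8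
      show ?thesis unfolding 8
        by (rule exI[of _ "\<lambda>x. - (h x * (- (\<gamma> - 1) * X x * rp x
            - 2 * w x * (2 * u x - w x * (cos x * s x) + w x * rp x)) * h x)"],
            intro conjI ballI alg_intros mem memr)
          (use dh r in simp)
    next
      case 9
      show ?thesis unfolding 9
        by (rule exI[of _ "\<lambda>x. - (iw x * (2 * u x - w x * (cos x * s x) + w x * rp x) * iw x)"],
            intro conjI ballI alg_intros mem memr)
          (use diw r in simp)
    next
      case 10
      show ?thesis unfolding 10
        by (rule exI[of _ "\<lambda>x. z x * (u x * iw x - cos x * s x)"], intro conjI ballI alg_intros mem dz)
    qed
  qed
  have sm: "smooth_fun_on I f" if "alg_generated G f" for f
    by (rule smooth_if_generators_closed[OF closed that])
  have zz: "(z x)\<^sup>2 = w x * Z x" if x: "x \<in> I" for x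
  proof -
    have "(z x)\<^sup>2 = zb\<^sup>2 * g x" using g[OF x] by (simp add: z_def power_mult_distrib)
    then show ?thesis by (simp add: g_def Z_def \<kappa>_def mult_ac)
  qed
  define W where "W = \<lparr>density = \<rho>, U1 = u, U2 = (\<lambda>x. - w x), U3 = z, entropy = (\<lambda>_::real. A)\<rparr>"
  have flow: "conic_flow_on \<gamma> I W"
    unfolding W_def
  proof (rule conic_flow_onI[OF Ibot])
    show "smooth_fun_on I \<rho>" "smooth_fun_on I u" "smooth_fun_on I (\<lambda>x. - w x)" "smooth_fun_on I z"
      by (rule sm, intro alg_intros mem)+
    fix x assume x: "x \<in> I"
    show "\<rho> x > 0" by (rule S(2)[OF x])
    show "(\<rho> has_real_derivative - (\<rho> x * r x)) (at x within I)" by (rule S(7)[OF x])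
    show "(u has_real_derivative - (w x + Z x)) (at x within I)" by (rule S(5)[OF x])
    show "((\<lambda>x. - w x) has_real_derivative - (2 * u x - w x * (cos x * s x) + w x * r x)) (at x within I)"
      by (rule DERIV_minus[OF S(6)[OF x]])
    show "(z has_real_derivative z x * (u x * iw x - cos x * s x)) (at x within I)" by (rule dz[OF x])
    have c: "cot x = cos x * s x" by (simp add: cot_def s_def divide_inverse)
    show "- (\<rho> x * r x) * - w x + \<rho> x * - (2 * u x - w x * (cos x * s x) + w x * r x) + 2 * \<rho> x * u x
        + cot x * \<rho> x * - w x = 0" unfolding c by (simp add: algebra_simps)
    show "- w x * - (w x + Z x) = (- w x)\<^sup>2 + (z x)\<^sup>2"
      unfolding zz[OF x] by (simp add: algebra_simps power2_eq_square)
    show "- w x * - (2 * u x - w x * (cos x * s x) + w x * r x)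
        + \<gamma> * A * \<rho> x powr (\<gamma> - 1) * (- (\<rho> x * r x) / \<rho> x) + u x * - w x - (z x)\<^sup>2 * cot x = 0"
    proof -
      have "r x * (X x - (w x)\<^sup>2) = w x * (u x - cos x * s x * (w x + Z x))"
        unfolding S(4)[OF x] h_def using S(3)[OF x] by simp
      moreover have "- (\<rho> x * r x) / \<rho> x = - r x" using S(2)[OF x] by simp
      ultimately show ?thesis
        unfolding zz[OF x] c X_def by (simp add: algebra_simps power2_eq_square)
    qed
    have "w x * iw x = 1" using S(1)[OF x] by (simp add: iw_def)
    moreover have "- w x * (z x * (u x * iw x - cos x * s x)) + u x * z x + - w x * z x * cot x
        = u x * z x * (1 - w x * iw x)" unfolding c by (simp add: algebra_simps)
    ultimately show "- w x * (z x * (u x * iw x - cos x * s x)) + u x * z x + - w x * z x * cot x = 0" by simp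
  qed
  have "g \<theta>b = 1" unfolding g_def s_def using init sinb pos by simp
  then have zb: "z \<theta>b = zb" by (simp add: z_def)
  have "((\<lambda>x. - w x) \<longlongrightarrow> - 0) (at_right \<theta>w)" by (intro tendsto_intros lim)
  then have "(U2 W \<longlongrightarrow> 0) (at_right \<theta>w)" by (simp add: W_def)
  then show ?thesis
    using that[OF \<theta>w flow[unfolded I_def]] init zb by (simp add: W_def)
qed

text \<open>
  The state behind the shock is defined by Prandtl's relation for \<open>w'\<close> and by the jump conditions. Two of its
  properties start the downstream flow. It is normally subsonic with \<open>U3\<^sup>2 \<le> c\<^sup>2\<close>, because
  the squared speed of sound exceeds \<open>w * w'\<close>. And it is compressive: as \<open>L = 0\<close> ahead of the shock,
  \<open>L\<close> behind it is \<open>cot * (w - w') * (1 - U3\<^sup>2 / (w * w'))\<close>, and \<open>U3\<^sup>2 < w * w'\<close> is \<open>hyp\<close>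
  up to a positive factor.
\<close>

lemma shock_solution_exists:
  fixes \<gamma> \<rho>0 A0 U02 U03 \<theta>b :: real
  assumes \<gamma>: "\<gamma> > 1" and pos: "\<rho>0 > 0" "A0 > 0" "U02 < 0" and \<theta>b: "0 < \<theta>b" "\<theta>b < pi / 2"
  defines "k \<equiv> (U02\<^sup>2 + U03\<^sup>2) / - U02" and "c2 \<equiv> \<gamma> * A0 * \<rho>0 powr (\<gamma> - 1)"
  defines "w \<equiv> (- U02 - k * (cos \<theta>b)\<^sup>2) / sin \<theta>b"
  assumes w: "w > 0" and supersonic: "c2 < w\<^sup>2"
    and hyp: "(\<gamma> - 1) * (U02\<^sup>2 + U03\<^sup>2)\<^sup>2 * ((sin \<theta>b)\<^sup>2)\<^sup>2
      + (2 * c2 * U02\<^sup>2 - (3 * \<gamma> - 1) * U03\<^sup>2 * (U02\<^sup>2 + U03\<^sup>2)) * (sin \<theta>b)\<^sup>2 + 2 * \<gamma> * U03 ^ 4 > 0"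
  shows "\<exists>\<theta>w Wm Wp. 0 < \<theta>w \<and> problem_II_solution \<gamma> \<rho>0 A0 U02 U03 \<theta>w \<theta>b Wm Wp"
proof -
  define a where "a = - U02"
  have a: "a > 0" "U02 = - a" using pos by (simp_all add: a_def)
  have sp: "sin \<theta>b > 0" using \<theta>b by (intro sin_gt_zero) auto
  have cp: "cos \<theta>b > 0" using \<theta>b by (intro cos_gt_zero) auto
  have k: "k * a = a\<^sup>2 + U03\<^sup>2" using a by (simp add: k_def)
  have c20: "c2 > 0" unfolding c2_def using \<gamma> pos by simp
  have ws: "w * sin \<theta>b = a - k * (cos \<theta>b)\<^sup>2" unfolding w_def using sp a by simp
  have aws: "a * (w * sin \<theta>b) = (a\<^sup>2 + U03\<^sup>2) * (sin \<theta>b)\<^sup>2 - U03\<^sup>2"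
  proof -
    have "a * (w * sin \<theta>b) = a\<^sup>2 - k * a * (cos \<theta>b)\<^sup>2" unfolding ws by (simp add: algebra_simps power2_eq_square)
    then show ?thesis unfolding k cos_squared_eq by (simp add: algebra_simps)
  qed
  have moving: "(U02\<^sup>2 + U03\<^sup>2) * (cos \<theta>b)\<^sup>2 < U02\<^sup>2"
  proof -
    have "0 < a * (w * sin \<theta>b)" using a w sp by simp
    then show ?thesis unfolding aws sin_squared_eq a(2) by (simp add: algebra_simps)
  qed
  obtain Wm where Wm: "conic_flow_on \<gamma> {\<theta>b..pi / 2} Wm" "\<And>x. density Wm x = \<rho>0" "\<And>x. entropy Wm x = A0"
    "\<And>x. U1 Wm x = k * cos x" "\<And>x. U2 Wm x = - (- U02 - k * (cos x)\<^sup>2) / sin x"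
    "U3 Wm (pi / 2) = U03"
    "\<And>x. x \<in> {\<theta>b..pi / 2} \<Longrightarrow> (U3 Wm x)\<^sup>2 = U03\<^sup>2 * (- U02 - k * (cos x)\<^sup>2) / (- U02 * (sin x)\<^sup>2)"
    unfolding k_def using upstream_flow_exists[OF pos(1,3) \<theta>b moving] by metis
  define z where "z = U3 Wm \<theta>b"
  have U2m: "U2 Wm \<theta>b = - w" unfolding Wm(5) w_def by (metis minus_divide_left)
  have zw: "z\<^sup>2 * (a * sin \<theta>b) = U03\<^sup>2 * w"
  proof -
    have "z\<^sup>2 = U03\<^sup>2 * (w * sin \<theta>b) / (a * (sin \<theta>b)\<^sup>2)"
      unfolding z_def ws using Wm(7)[of \<theta>b] \<theta>b by (simp add: a_def)
    then show ?thesis using a sp by (simp add: field_simps power2_eq_square)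
  qed

  define w' where "w' = ((\<gamma> - 1) * w\<^sup>2 + 2 * c2) / ((\<gamma> + 1) * w)"
  have w': "(\<gamma> + 1) * w * w' = (\<gamma> - 1) * w\<^sup>2 + 2 * c2" unfolding w'_def using w \<gamma> by simp
  have w'0: "w' > 0" unfolding w'_def using w \<gamma> c20 by (intro divide_pos_pos add_nonneg_pos) auto
  have c2: "c2 = ((\<gamma> + 1) * w * w' - (\<gamma> - 1) * w\<^sup>2) / 2" using w' by simp
  have w'_less: "w' < w"
  proof -
    have "(\<gamma> + 1) * w * w' < (\<gamma> + 1) * w * w" unfolding w' using supersonic by (simp add: algebra_simps power2_eq_square)
    then show ?thesis using \<gamma> w by simp
  qed
  define \<rho>b where "\<rho>b = \<rho>0 * w / w'"
  have \<rho>b: "\<rho>b > 0" "\<rho>b * w' = \<rho>0 * w" unfolding \<rho>b_def using pos w w'0 by simp_all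
  define p0 where "p0 = A0 * \<rho>0 powr \<gamma>"
  have p0: "p0 > 0" "\<gamma> * p0 = \<rho>0 * c2" using pos \<gamma> by (simp_all add: p0_def c2_def powr_diff)
  define pb where "pb = p0 + \<rho>0 * w * (w - w')"
  have pb: "pb > p0" unfolding pb_def using pos w w'_less by simp
  define Ab where "Ab = pb / \<rho>b powr \<gamma>"
  have Ab: "Ab > 0" "Ab * \<rho>b powr \<gamma> = pb" unfolding Ab_def using pb p0 \<rho>b by simp_all
  define X where "X = \<gamma> * Ab * \<rho>b powr (\<gamma> - 1)"
  have X: "X = w' * ((\<gamma> + 1) * w - (\<gamma> - 1) * w') / 2"
  proof -
    have "\<rho>b * X = \<gamma> * (Ab * \<rho>b powr \<gamma>)" using \<rho>b by (simp add: X_def powr_diff)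
    also have "\<dots> = \<gamma> * p0 + \<gamma> * (\<rho>0 * w * (w - w'))" unfolding Ab pb_def by (simp add: algebra_simps)
    also have "\<dots> = \<rho>0 * (c2 + \<gamma> * w * (w - w'))" unfolding p0 by (simp add: algebra_simps)
    finally have "\<rho>b * X * w' = \<rho>0 * (c2 + \<gamma> * w * (w - w')) * w'" by (simp only:)
    moreover have "\<rho>b * X * w' = \<rho>0 * (w * X)" using \<rho>b(2) by (simp add: mult_ac)
    ultimately have "\<rho>0 * (w * X) = \<rho>0 * ((c2 + \<gamma> * w * (w - w')) * w')" by simp
    then have "w * X = (c2 + \<gamma> * w * (w - w')) * w'" using pos(1) by simp
    also have "\<dots> = w * (w' * ((\<gamma> + 1) * w - (\<gamma> - 1) * w') / 2)" unfolding c2 by (simp add: field_simps power2_eq_square)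
    finally show ?thesis using w by simp
  qed
  have X_ww': "w * w' < X"
  proof -
    have "X - w * w' = w' * (\<gamma> - 1) * (w - w') / 2" unfolding X by (simp add: field_simps)
    also have "\<dots> > 0" using w'0 w'_less \<gamma> by simp
    finally show ?thesis by simp
  qed
  have X_w': "w'\<^sup>2 < X"
  proof -
    have "w'\<^sup>2 < w * w'" using w'_less w'0 by (simp add: power2_eq_square)
    then show ?thesis using X_ww' by simp
  qed
  have z_ww': "z\<^sup>2 < w * w'"
  proof -
    let ?t = "(sin \<theta>b)\<^sup>2" and ?Q = "a\<^sup>2 + U03\<^sup>2"
    have t: "a\<^sup>2 * ?t > 0" using a sp by simp
    \<comment> \<open>Multiplication by \<open>a\<^sup>2 * ?t\<close> clears the denominators of the explicit upstream profile.\<close>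
    have e1: "a\<^sup>2 * ?t * w\<^sup>2 = (?Q * ?t - U03\<^sup>2)\<^sup>2" unfolding aws[symmetric] by (simp add: power_mult_distrib)
    have "a\<^sup>2 * ?t * z\<^sup>2 = a * sin \<theta>b * (z\<^sup>2 * (a * sin \<theta>b))" by (simp add: power2_eq_square)
    also have "\<dots> = U03\<^sup>2 * (a * (w * sin \<theta>b))" unfolding zw by simp
    finally have e2: "a\<^sup>2 * ?t * z\<^sup>2 = U03\<^sup>2 * (?Q * ?t - U03\<^sup>2)" unfolding aws .
    have "a\<^sup>2 * ?t * ((\<gamma> - 1) * w\<^sup>2 + 2 * c2 - (\<gamma> + 1) * z\<^sup>2)
        = (\<gamma> - 1) * (a\<^sup>2 * ?t * w\<^sup>2) + 2 * c2 * (a\<^sup>2 * ?t) - (\<gamma> + 1) * (a\<^sup>2 * ?t * z\<^sup>2)"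
      by (simp add: algebra_simps)
    also have "\<dots> = (\<gamma> - 1) * ?Q\<^sup>2 * ?t\<^sup>2 + (2 * c2 * a\<^sup>2 - (3 * \<gamma> - 1) * U03\<^sup>2 * ?Q) * ?t + 2 * \<gamma> * (U03\<^sup>2)\<^sup>2"
    proof -
      have "(\<gamma> - 1) * (Q * t - y)\<^sup>2 + 2 * c * (b * t) - (\<gamma> + 1) * (y * (Q * t - y))
          = (\<gamma> - 1) * Q\<^sup>2 * t\<^sup>2 + (2 * c * b - (3 * \<gamma> - 1) * y * Q) * t + 2 * \<gamma> * y\<^sup>2" for Q t y c b :: real
        by (simp add: algebra_simps power2_eq_square)
      then show ?thesis unfolding e1 e2 .
    qed
    also have "\<dots> > 0" using hyp by (simp add: a(2))
    finally have "(\<gamma> + 1) * z\<^sup>2 < (\<gamma> + 1) * (w * w')"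
      using t w' by (simp add: zero_less_mult_iff mult_ac)
    then show ?thesis using \<gamma> by simp
  qed
  have compression: "cot \<theta>b * (w' + z\<^sup>2 / w') < k * cos \<theta>b"
  proof -
    have "(w + z\<^sup>2 / w) * (a * sin \<theta>b) = a * (w * sin \<theta>b) + (z\<^sup>2 * (a * sin \<theta>b)) / w"
      by (simp add: algebra_simps add_divide_distrib)
    also have "\<dots> = (a\<^sup>2 + U03\<^sup>2) * (sin \<theta>b)\<^sup>2" unfolding aws zw using w by simp
    also have "\<dots> = (k * sin \<theta>b) * (a * sin \<theta>b)" unfolding k[symmetric] by (simp add: power2_eq_square)
    finally have y: "w + z\<^sup>2 / w = k * sin \<theta>b" using a sp by simp
    have "(w + z\<^sup>2 / w) - (w' + z\<^sup>2 / w') = (w - w') * (w * w' - z\<^sup>2) / (w * w')"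
      using w w'0 by (simp add: field_simps)
    also have "\<dots> > 0" using w w'0 w'_less z_ww' by simp
    finally have "w' + z\<^sup>2 / w' < k * sin \<theta>b" unfolding y by simp
    then have "cot \<theta>b * (w' + z\<^sup>2 / w') < cot \<theta>b * (k * sin \<theta>b)"
      using sp cp by (intro mult_strict_left_mono) (auto simp: cot_def)
    also have "cot \<theta>b * (k * sin \<theta>b) = k * cos \<theta>b" using sp by (simp add: cot_def)
    finally show ?thesis .
  qed
  have "k * a > 0" unfolding k using a by (simp add: add_pos_nonneg)
  then have k0: "k > 0" using a by (simp add: zero_less_mult_iff)
  obtain \<theta>w Wp where Wp: "0 < \<theta>w" "\<theta>w < \<theta>b" "conic_flow_on \<gamma> {\<theta>w<..\<theta>b} Wp"
    "density Wp \<theta>b = \<rho>b" "U1 Wp \<theta>b = k * cos \<theta>b" "U2 Wp \<theta>b = - w'" "U3 Wp \<theta>b = z" "entropy Wp \<theta>b = Ab"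
    "(U2 Wp \<longlongrightarrow> 0) (at_right \<theta>w)"
  proof (rule downstream_flow_exists[OF \<gamma> Ab(1) \<theta>b _ w'0 \<rho>b(1), of "k * cos \<theta>b" z])
    show "z\<^sup>2 \<le> \<gamma> * Ab * \<rho>b powr (\<gamma> - 1)" using z_ww' X_ww' by (simp add: X_def)
  qed (use k0 cp X_w' compression in \<open>auto simp: X_def\<close>)
  have pm: "pressure \<gamma> Wm \<theta>b = p0" by (simp add: pressure_def Wm p0_def)
  have pp: "pressure \<gamma> Wp \<theta>b = pb" by (simp add: pressure_def Wp Ab)
  have "rankine_hugoniot \<gamma> \<theta>b Wm Wp"
    unfolding rankine_hugoniot_def Let_def right_minus_eq
  proof (intro conjI)
    show 1: "density Wp \<theta>b * U2 Wp \<theta>b = density Wm \<theta>b * U2 Wm \<theta>b"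
      using \<rho>b(2) by (simp add: Wp Wm(2) U2m)
    show "density Wp \<theta>b * U1 Wp \<theta>b * U2 Wp \<theta>b = density Wm \<theta>b * U1 Wm \<theta>b * U2 Wm \<theta>b"
      using \<rho>b(2) by (simp add: Wp Wm(2,4) U2m)
    show "density Wp \<theta>b * U2 Wp \<theta>b * U3 Wp \<theta>b = density Wm \<theta>b * U2 Wm \<theta>b * U3 Wm \<theta>b"
      unfolding 1 by (simp add: Wp z_def)
    have "\<rho>b * w'\<^sup>2 = \<rho>0 * w * w'" using \<rho>b(2) by (simp add: power2_eq_square mult.assoc[symmetric])
    then show "density Wp \<theta>b * (U2 Wp \<theta>b)\<^sup>2 + pressure \<gamma> Wp \<theta>b = density Wm \<theta>b * (U2 Wm \<theta>b)\<^sup>2 + pressure \<gamma> Wm \<theta>b"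
      unfolding pm pp by (simp add: Wp Wm(2) U2m pb_def algebra_simps power2_eq_square)
    have "X / (\<gamma> - 1) + w'\<^sup>2 / 2 = c2 / (\<gamma> - 1) + w\<^sup>2 / 2"
      unfolding X c2 using \<gamma> by (simp add: field_simps power2_eq_square)
    moreover have "density Wp \<theta>b > 0" "density Wm \<theta>b > 0" using \<rho>b pos by (simp_all add: Wp Wm(2))
    ultimately show "bernoulli \<gamma> Wp \<theta>b = bernoulli \<gamma> Wm \<theta>b"
      by (simp add: bernoulli_alt Wp Wm(2,3,4) U2m X_def c2_def z_def add_divide_distrib)
  qed
  then have "problem_II_solution \<gamma> \<rho>0 A0 U02 U03 \<theta>w \<theta>b Wm Wp"
    unfolding problem_II_solution_def pm pp using Wp \<theta>b Wm pb by simp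
  then show ?thesis using Wp(1) by blast
qed

section \<open>Existence and classification of conic shocks\<close>

text \<open>
  Rigidity makes the incoming state at the shock explicit, so that the sonic classification becomes a statement about the
  shock angle alone.
\<close>

lemma conic_shock_classification:
  fixes \<gamma> \<rho>0 A0 U02 U03 q0 c0 :: real
  assumes \<gamma>: "\<gamma> > 1" and pos: "\<rho>0 > 0" "A0 > 0" "U02 < 0"
    and q0: "q0 = sqrt (U02\<^sup>2 + U03\<^sup>2)" and c0: "c0 = sqrt (A0 * \<gamma> * \<rho>0 powr (\<gamma> - 1))"
    and sup: "c0\<^sup>2 < U02\<^sup>2"
    and \<theta>w: "0 < \<theta>w" and sol: "problem_II_solution \<gamma> \<rho>0 A0 U02 U03 \<theta>w \<theta>b Wm Wp"
  defines "G \<equiv> q0\<^sup>2 * sin \<theta>b - U03\<^sup>2 / sin \<theta>b"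
  shows "G > 0" and "sgn (sonic_excess \<gamma> Wp \<theta>b) = sgn (a_sharp_sq \<gamma> (q0 / c0) - (G / (c0 * \<bar>U02\<bar>))\<^sup>2)"
    and "(U3 Wp \<longlongrightarrow> 0) (at_right \<theta>w)"
proof -
  have q2: "q0\<^sup>2 = U02\<^sup>2 + U03\<^sup>2" unfolding q0 by simp
  have c2: "c0\<^sup>2 = \<gamma> * A0 * \<rho>0 powr (\<gamma> - 1)" unfolding c0 using \<gamma> pos by simp
  have c0p: "c0 > 0" unfolding c0 using \<gamma> pos by simp
  have P: "\<theta>w < \<theta>b" "\<theta>b < pi / 2" "conic_flow_on \<gamma> {\<theta>b..pi / 2} Wm" "conic_flow_on \<gamma> {\<theta>w<..\<theta>b} Wp"
    "density Wm (pi / 2) = \<rho>0" "U1 Wm (pi / 2) = 0" "U2 Wm (pi / 2) = U02" "U3 Wm (pi / 2) = U03"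
    "entropy Wm (pi / 2) = A0" "(U2 Wp \<longlongrightarrow> 0) (at_right \<theta>w)"
    "pressure \<gamma> Wp \<theta>b - pressure \<gamma> Wm \<theta>b > 0" "rankine_hugoniot \<gamma> \<theta>b Wm Wp"
    using sol unfolding problem_II_solution_def by auto
  have \<theta>b: "0 < \<theta>b" using \<theta>w P(1) by simp
  have sp: "sin \<theta>b > 0" using \<theta>b P(2) by (intro sin_gt_zero) auto
  note R = upstream_rigidity[OF P(3) \<gamma> \<theta>b P(2) P(6-8) pos(3), unfolded P(5,9) c2[symmetric], OF sup]
  have \<rho>: "density Wm \<theta>b > 0" "density Wp \<theta>b > 0"
    using P(1-4) by (auto simp: conic_flow_on_def)
  have "- U2 Wm \<theta>b * sin \<theta>b * \<bar>U02\<bar> = U02\<^sup>2 - (U02\<^sup>2 + U03\<^sup>2) * (cos \<theta>b)\<^sup>2"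
    unfolding R(4) using pos(3) by (simp add: field_simps power2_eq_square)
  also have "\<dots> = G * sin \<theta>b"
    unfolding cos_squared_eq q2[symmetric] G_def using sp q2 by (simp add: field_simps power2_eq_square)
  finally have "G * sin \<theta>b = (- U2 Wm \<theta>b * \<bar>U02\<bar>) * sin \<theta>b" by (simp add: mult_ac)
  then have GU: "G = - U2 Wm \<theta>b * \<bar>U02\<bar>" using sp by (metis mult_right_cancel less_irrefl)
  show "G > 0" unfolding GU using R(1) pos(3) by (intro mult_pos_pos) auto
  have "(\<gamma> + 1) * (U2 Wm \<theta>b)\<^sup>2 * sonic_excess \<gamma> Wp \<theta>b
      = - (2 * \<gamma> * ((U2 Wm \<theta>b)\<^sup>2)\<^sup>2 - (U2 Wm \<theta>b)\<^sup>2 * ((\<gamma> - 3) * c0\<^sup>2 + (\<gamma> + 1) * q0\<^sup>2) - 2 * (c0\<^sup>2)\<^sup>2)"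
    using sonic_excess_behind_shock[OF \<gamma> \<rho> R(1) P(12) P(11)]
    unfolding R(2,3,5) q2 c2 .
  from sonic_classification[OF \<gamma> c0p _ this]
  have "sgn (sonic_excess \<gamma> Wp \<theta>b) = sgn (a_sharp_sq \<gamma> (q0 / c0) - (U2 Wm \<theta>b)\<^sup>2 / c0\<^sup>2)"
    using R(1) by simp
  moreover have "(U2 Wm \<theta>b)\<^sup>2 / c0\<^sup>2 = (G / (c0 * \<bar>U02\<bar>))\<^sup>2"
    unfolding GU using pos(3) by (simp add: power_mult_distrib power_divide)
  ultimately show "sgn (sonic_excess \<gamma> Wp \<theta>b) = sgn (a_sharp_sq \<gamma> (q0 / c0) - (G / (c0 * \<bar>U02\<bar>))\<^sup>2)"
    by simp
  have "entropy Wp \<theta>b > 0"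
    using entropy_pos_behind_shock[OF \<rho> _ P(11)] R(3) pos(2) by simp
  then show "(U3 Wp \<longlongrightarrow> 0) (at_right \<theta>w)"
    using P(2) pi_gt_zero by (intro swirl_vanishes_at_cone[OF P(4) \<gamma> \<theta>w P(1) _ _ P(10)]) linarith+
qed

theorem theorem2p7:
  fixes \<gamma> \<rho>0 A0 U02 U03 q0 c0 a1_sq :: real
  assumes "\<gamma> > 1" and "\<rho>0 > 0" and "A0 > 0" and "U02 < 0"
    and "q0 = sqrt (U02\<^sup>2 + U03\<^sup>2)"
    and "c0 = sqrt (A0 * \<gamma> * \<rho>0 powr (\<gamma> - 1))"
    and "a1_sq = U02\<^sup>2 / c0\<^sup>2"
    and "a1_sq > 1"
    and "\<forall>t. 0 < t \<and> t < 1 \<longrightarrow>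
           (\<gamma> - 1) * q0 ^ 4 * t\<^sup>2
             + (2 * c0\<^sup>2 * U02\<^sup>2 - (3 * \<gamma> - 1) * U03\<^sup>2 * q0\<^sup>2) * t
             + 2 * \<gamma> * U03 ^ 4 > 0"
  shows "\<exists>D. D \<noteq> {} \<and> D \<subseteq> {0<..<pi / 2} \<and>
    (\<forall>\<theta>w\<in>D. \<exists>\<theta>b Wm Wp. problem_II_solution \<gamma> \<rho>0 A0 U02 U03 \<theta>w \<theta>b Wm Wp) \<and>
    (\<forall>\<theta>w\<in>D. \<forall>\<theta>b Wm Wp. problem_II_solution \<gamma> \<rho>0 A0 U02 U03 \<theta>w \<theta>b Wm Wp \<longrightarrow>
       (U3 Wp \<longlongrightarrow> 0) (at_right \<theta>w)) \<and>
    (a_sharp_sq \<gamma> (q0 / c0) \<ge> a1_sq \<longrightarrow>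
       (\<forall>\<theta>w\<in>D. \<forall>\<theta>b Wm Wp. problem_II_solution \<gamma> \<rho>0 A0 U02 U03 \<theta>w \<theta>b Wm Wp \<longrightarrow>
          supersonic_at \<gamma> Wp \<theta>b)) \<and>
    (a_sharp_sq \<gamma> (q0 / c0) < a1_sq \<longrightarrow>
       (\<exists>!\<theta>s. is_theta_sharp \<gamma> q0 c0 U02 U03 \<theta>s) \<and>
       (\<forall>\<theta>s. is_theta_sharp \<gamma> q0 c0 U02 U03 \<theta>s \<longrightarrow>
          (\<forall>\<theta>w\<in>D. \<forall>\<theta>b Wm Wp. problem_II_solution \<gamma> \<rho>0 A0 U02 U03 \<theta>w \<theta>b Wm Wp \<longrightarrow>
             (theta_lower q0 c0 U02 U03 < \<theta>b \<and> \<theta>b < \<theta>s \<longrightarrow> supersonic_at \<gamma> Wp \<theta>b) \<and>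
             (\<theta>b = \<theta>s \<longrightarrow> sonic_at \<gamma> Wp \<theta>b) \<and>
             (\<theta>s < \<theta>b \<and> \<theta>b < pi / 2 \<longrightarrow> subsonic_at \<gamma> Wp \<theta>b))))"
proof -
  have q2: "q0\<^sup>2 = U02\<^sup>2 + U03\<^sup>2" using assms(5) by simp
  have q4: "q0 ^ 4 = (U02\<^sup>2 + U03\<^sup>2)\<^sup>2" unfolding q2[symmetric] by simp
  have c2: "c0\<^sup>2 = \<gamma> * A0 * \<rho>0 powr (\<gamma> - 1)" using assms by simp
  have c0p: "c0 > 0" using assms by simp
  have U: "\<bar>U02\<bar> > 0" using assms(4) by simp
  have h: "c0 * \<bar>U02\<bar> > 0" using c0p U by simp
  have "1 < U02\<^sup>2 / c0\<^sup>2" using assms(7,8) by simp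
  then have sup: "c0\<^sup>2 < U02\<^sup>2" using c0p by (simp add: less_divide_eq_1_pos)
  have q0p: "q0\<^sup>2 > 0" unfolding q2 using assms(4) by (simp add: add_pos_nonneg)
  define \<theta>l where "\<theta>l = theta_lower q0 c0 U02 U03"
  note \<theta>l = theta_lower_properties[OF assms(4) c0p assms(5) sup, folded \<theta>l_def]
  define G where "G \<theta> = q0\<^sup>2 * sin \<theta> - U03\<^sup>2 / sin \<theta>" for \<theta>
  have mono: "G x < G y" if "0 < x" "x < y" "y \<le> pi / 2" for x y
    unfolding G_def using that
    by (intro polar_speed_strict_mono q0p sin_gt_zero sin_monotone_2pi) auto
  have Gl: "G \<theta>l = c0 * \<bar>U02\<bar>" using \<theta>l(3) by (simp add: G_def)
  have Gpi: "G (pi / 2) = U02\<^sup>2" by (simp add: G_def q2)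

  \<comment> \<open>Any shock angle above \<open>\<theta>l\<close> would do; its downstream flow determines the cone.\<close>
  define \<theta>b where "\<theta>b = (\<theta>l + pi / 2) / 2"
  have \<theta>b: "0 < \<theta>b" "\<theta>b < pi / 2" "\<theta>l < \<theta>b" using \<theta>l by (auto simp: \<theta>b_def)
  have "\<exists>\<theta>w Wm Wp. 0 < \<theta>w \<and> problem_II_solution \<gamma> \<rho>0 A0 U02 U03 \<theta>w \<theta>b Wm Wp"
  proof -
    define w where "w = (- U02 - (U02\<^sup>2 + U03\<^sup>2) / - U02 * (cos \<theta>b)\<^sup>2) / sin \<theta>b"
    have sp: "sin \<theta>b > 0" using \<theta>b by (intro sin_gt_zero) auto
    have wU: "w * \<bar>U02\<bar> = G \<theta>b"
    proof -
      have "w * \<bar>U02\<bar> * sin \<theta>b = U02\<^sup>2 - q0\<^sup>2 * (cos \<theta>b)\<^sup>2"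
        unfolding w_def q2 using assms(4) sp by (simp add: field_simps power2_eq_square)
      also have "\<dots> = G \<theta>b * sin \<theta>b"
        unfolding cos_squared_eq G_def using sp q2 by (simp add: field_simps power2_eq_square)
      finally show ?thesis using sp by simp
    qed
    have "G \<theta>l < G \<theta>b" using \<theta>b \<theta>l by (intro mono) auto
    then have "c0 * \<bar>U02\<bar> < w * \<bar>U02\<bar>" unfolding Gl wU .
    then have cw: "c0 < w" using U by simp
    then have c2w: "\<gamma> * A0 * \<rho>0 powr (\<gamma> - 1) < w\<^sup>2"
      unfolding c2[symmetric] using c0p by (intro power_strict_mono) auto
    have "0 < (sin \<theta>b)\<^sup>2" using sp by simp
    moreover have "0 < (cos \<theta>b)\<^sup>2" using cos_gt_zero[of \<theta>b] \<theta>b by simp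
    then have "(sin \<theta>b)\<^sup>2 < 1" by (simp add: sin_squared_eq)
    ultimately have hyp: "(\<gamma> - 1) * q0 ^ 4 * ((sin \<theta>b)\<^sup>2)\<^sup>2
             + (2 * c0\<^sup>2 * U02\<^sup>2 - (3 * \<gamma> - 1) * U03\<^sup>2 * q0\<^sup>2) * (sin \<theta>b)\<^sup>2
             + 2 * \<gamma> * U03 ^ 4 > 0" using assms(9) by blast
    show ?thesis
    proof (rule shock_solution_exists[OF assms(1-4) \<theta>b(1,2)], unfold w_def[symmetric])
      show "w > 0" using cw c0p by linarith
    qed (fact c2w, fact hyp[unfolded q4 q2 c2])
  qed
  then obtain \<theta>w Wm Wp where \<theta>w: "0 < \<theta>w" and ex: "problem_II_solution \<gamma> \<rho>0 A0 U02 U03 \<theta>w \<theta>b Wm Wp" by blast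
  have \<theta>w2: "\<theta>w < pi / 2" using ex \<theta>b by (simp add: problem_II_solution_def)
  note cl = conic_shock_classification[OF assms(1-6) sup \<theta>w, folded G_def]
  have range: "0 < \<theta>b' \<and> \<theta>b' < pi / 2" if "problem_II_solution \<gamma> \<rho>0 A0 U02 U03 \<theta>w \<theta>b' Wm Wp" for \<theta>b' Wm Wp
    using that \<theta>w by (auto simp: problem_II_solution_def)
  have sq_less: "(x / (c0 * \<bar>U02\<bar>))\<^sup>2 < (y / (c0 * \<bar>U02\<bar>))\<^sup>2" if "0 < x" "x < y" for x y
    using that h by (intro power_strict_mono divide_strict_right_mono) auto
  let ?s = "a_sharp_sq \<gamma> (q0 / c0)"
  have a1: "a1_sq = (G (pi / 2) / (c0 * \<bar>U02\<bar>))\<^sup>2"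
  proof -
    have "G (pi / 2) / (c0 * \<bar>U02\<bar>) = - U02 / c0"
      unfolding Gpi using assms(4) by (simp add: power2_eq_square)
    then show ?thesis by (simp add: assms(7) power_divide)
  qed
  have sgn_lt: "x < 0" if "sgn x = sgn y" "y < 0" for x y :: real using that by (simp add: sgn_if split: if_splits)
  have sgn_gt: "x > 0" if "sgn x = sgn y" "y > 0" for x y :: real using that by (simp add: sgn_if split: if_splits)
  have case1: "supersonic_at \<gamma> Wp \<theta>b'"
    if "?s \<ge> a1_sq" and S: "problem_II_solution \<gamma> \<rho>0 A0 U02 U03 \<theta>w \<theta>b' Wm Wp" for \<theta>b' Wm Wp
  proof -
    have "G \<theta>b' < G (pi / 2)" using range[OF S] by (intro mono) auto
    then have "(G \<theta>b' / (c0 * \<bar>U02\<bar>))\<^sup>2 < ?s"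
      using sq_less[OF cl(1)[OF S]] that(1) a1 by fastforce
    then show ?thesis unfolding supersonic_at_def by (intro sgn_gt[OF cl(2)[OF S]]) simp
  qed
  have unique: "\<exists>!\<theta>. is_theta_sharp \<gamma> q0 c0 U02 U03 \<theta>" if "?s < a1_sq"
    using that unfolding assms(7) by (rule theta_sharp_exists_unique[OF assms(1,4) c0p assms(5) sup])
  have case2: "(\<theta>l < \<theta>b' \<and> \<theta>b' < \<theta>s \<longrightarrow> supersonic_at \<gamma> Wp \<theta>b') \<and>
      (\<theta>b' = \<theta>s \<longrightarrow> sonic_at \<gamma> Wp \<theta>b') \<and> (\<theta>s < \<theta>b' \<and> \<theta>b' < pi / 2 \<longrightarrow> subsonic_at \<gamma> Wp \<theta>b')"
    if sharp: "is_theta_sharp \<gamma> q0 c0 U02 U03 \<theta>s" and S: "problem_II_solution \<gamma> \<rho>0 A0 U02 U03 \<theta>w \<theta>b' Wm Wp"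
    for \<theta>s \<theta>b' Wm Wp
  proof -
    have \<theta>s: "\<theta>l < \<theta>s" "\<theta>s < pi / 2"
      "(U02\<^sup>2 - q0\<^sup>2 * (cos \<theta>s)\<^sup>2)\<^sup>2 / (c0\<^sup>2 * U02\<^sup>2 * (sin \<theta>s)\<^sup>2) = ?s"
      using sharp by (auto simp: is_theta_sharp_def \<theta>l_def)
    have \<theta>s0: "0 < \<theta>s" using \<theta>s \<theta>l by simp
    have "sin \<theta>s > 0" using \<theta>s0 \<theta>s by (intro sin_gt_zero) auto
    then have Gs: "(G \<theta>s / (c0 * \<bar>U02\<bar>))\<^sup>2 = ?s"
      using \<theta>s(3) polar_mach_formula[OF q2, of \<theta>s c0] by (simp add: G_def)
    have "G \<theta>l < G \<theta>s" using \<theta>s \<theta>l by (intro mono) auto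
    then have Gs0: "G \<theta>s > 0" using Gl h by simp
    note cl2 = cl(2)[OF S]
    show ?thesis
    proof (intro conjI impI)
      assume "\<theta>l < \<theta>b' \<and> \<theta>b' < \<theta>s"
      then have "G \<theta>b' < G \<theta>s" using range[OF S] \<theta>s by (intro mono) auto
      from sq_less[OF cl(1)[OF S] this] show "supersonic_at \<gamma> Wp \<theta>b'"
        unfolding supersonic_at_def Gs by (intro sgn_gt[OF cl2]) simp
    next
      assume "\<theta>b' = \<theta>s"
      then show "sonic_at \<gamma> Wp \<theta>b'" using cl2 Gs by (simp add: sonic_at_def sgn_zero_iff)
    next
      assume "\<theta>s < \<theta>b' \<and> \<theta>b' < pi / 2"
      then have "G \<theta>s < G \<theta>b'" using \<theta>s0 by (intro mono) auto
      from sq_less[OF Gs0 this] show "subsonic_at \<gamma> Wp \<theta>b'"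
        unfolding subsonic_at_def Gs by (intro sgn_lt[OF cl2]) simp
    qed
  qed
  show ?thesis
  proof (intro exI[of _ "{\<theta>w}"] conjI)
    show "{\<theta>w} \<subseteq> {0<..<pi / 2}" using \<theta>w \<theta>w2 by simp
  qed (use ex cl(3) case1 case2[unfolded \<theta>l_def] unique in \<open>blast+\<close>)
qed

end
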